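(* There exists a threefold $X_{2,4}\subset\mathbb{P}^5$, a complete intersection of a quadric hypersurface and a quartic hypersurface, containing $7$ ordinary triple points as its only singularities.
   Context: All varieties are over $\mathbb{C}$. An ordinary triple point on a threefold $X$ is an isolated singularity $O$ of $X$ such that the tangent cone to $X$ at $O$ is a cone over a smooth surface of degree three (a smooth cubic surface in $\mathbb{P}^3$). *)

theory Defs
  imports "HOL-Analysis.Analysis" "HOL-Library.Poly_Mapping" "HOL-Library.Numeral_Type"
begin

text \<open>Keys are exponent vectors; the ring structure is the convolution product of
  \<^theory>\<open>HOL-Library.Poly_Mapping\<close>. The type of variables is arbitrary.\<close>

type_synonym 'v mpol = "('v \<Rightarrow>\<^sub>0 nat) \<Rightarrow>\<^sub>0 complex"

definition Const :: "complex \<Rightarrow> 'v mpol" where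
  "Const c = Poly_Mapping.single 0 c"

definition Var :: "'v \<Rightarrow> 'v mpol" where
  "Var i = Poly_Mapping.single (Poly_Mapping.single i 1) 1"

text \<open>The value of \<open>p\<close> at \<open>f\<close> in a ring whose complex scalars are given by \<open>h\<close>.\<close>

definition insertion :: "(complex \<Rightarrow> 'a) \<Rightarrow> ('v \<Rightarrow> 'a) \<Rightarrow> 'v mpol \<Rightarrow> 'a::comm_ring_1" where
  "insertion h f p =
     (\<Sum>m\<in>Poly_Mapping.keys p. h (Poly_Mapping.lookup p m) *
        (\<Prod>i\<in>Poly_Mapping.keys m. f i ^ Poly_Mapping.lookup m i))"

definition poly_eval :: "'v mpol \<Rightarrow> complex ^ 'v::finite \<Rightarrow> complex" where
  "poly_eval p x = insertion id (\<lambda>i. x $ i) p"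

definition poly_subst :: "('v \<Rightarrow> 'w mpol) \<Rightarrow> 'v mpol \<Rightarrow> 'w mpol" where
  "poly_subst f p = insertion Const f p"

definition pdiff :: "'v \<Rightarrow> 'v mpol \<Rightarrow> 'v mpol" where
  "pdiff i p =
     (\<Sum>m\<in>Poly_Mapping.keys p.
        Poly_Mapping.single (m - Poly_Mapping.single i 1)
          (of_nat (Poly_Mapping.lookup m i) * Poly_Mapping.lookup p m))"

definition mdeg :: "('v \<Rightarrow>\<^sub>0 nat) \<Rightarrow> nat" where
  "mdeg m = (\<Sum>i\<in>Poly_Mapping.keys m. Poly_Mapping.lookup m i)"

definition homogeneous :: "nat \<Rightarrow> 'v mpol \<Rightarrow> bool" where
  "homogeneous d p \<longleftrightarrow> (\<forall>m\<in>Poly_Mapping.keys p. mdeg m = d)"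

definition hom_component :: "nat \<Rightarrow> 'v mpol \<Rightarrow> 'v mpol" where
  "hom_component d p =
     (\<Sum>m\<in>{m \<in> Poly_Mapping.keys p. mdeg m = d}. Poly_Mapping.single m (Poly_Mapping.lookup p m))"

text \<open>The nonzero homogeneous component of least degree; the initial form of 0 is 0.\<close>

definition initial_form :: "'v mpol \<Rightarrow> 'v mpol" where
  "initial_form p = hom_component (LEAST d. \<exists>m\<in>Poly_Mapping.keys p. mdeg m = d) p"

definition is_ideal :: "'a::comm_ring_1 set \<Rightarrow> bool" where
  "is_ideal I \<longleftrightarrow> 0 \<in> I \<and> (\<forall>a\<in>I. \<forall>b\<in>I. a + b \<in> I) \<and> (\<forall>r. \<forall>a\<in>I. r * a \<in> I)"

definition ideal_gen :: "'a::comm_ring_1 set \<Rightarrow> 'a set" where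
  "ideal_gen S = is_ideal hull S"

definition is_prime_ideal :: "'a::comm_ring_1 set \<Rightarrow> bool" where
  "is_prime_ideal I \<longleftrightarrow>
     is_ideal I \<and> 1 \<notin> I \<and> (\<forall>a b. a * b \<in> I \<longrightarrow> a \<in> I \<or> b \<in> I)"

text \<open>A closed subscheme of \<open>\<P>\<^sup>n\<close> is given by a homogeneous ideal \<open>I\<close> of the polynomial ring
  in \<open>n + 1\<close> variables; it is a variety (integral) when \<open>I\<close> is prime. Its points are the lines
  \<^term>\<open>vec.span {p}\<close> through the nonzero common zeros \<open>p\<close> of \<open>I\<close>.\<close>

text \<open>Algebraic independence over the complex numbers of (the classes of) the elements of \<open>A\<close>
  modulo \<open>I\<close>. The elements of \<open>A\<close> themselves serve as the variables of the relation \<open>P\<close>.\<close>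

definition alg_indep_mod :: "'v mpol set \<Rightarrow> 'v mpol set \<Rightarrow> bool" where
  "alg_indep_mod I A \<longleftrightarrow>
     (\<forall>P :: 'v mpol mpol.
        (\<forall>m\<in>Poly_Mapping.keys P. Poly_Mapping.keys m \<subseteq> A) \<and> poly_subst id P \<in> I \<longrightarrow> P = 0)"

definition trdeg_mod :: "'v mpol set \<Rightarrow> nat" where
  "trdeg_mod I = (GREATEST n. \<exists>A. finite A \<and> card A = n \<and> alg_indep_mod I A)"

text \<open>For a prime ideal \<open>I\<close>, the homogeneous coordinate ring has transcendence degree one more
  than the function field of the variety.\<close>

definition proj_dim :: "'v mpol set \<Rightarrow> int" where
  "proj_dim I = int (trdeg_mod I) - 1"

definition cone_points :: "'v mpol set \<Rightarrow> (complex ^ 'v::finite) set" where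
  "cone_points I = {p. p \<noteq> 0 \<and> (\<forall>f\<in>I. poly_eval f p = 0)}"

text \<open>For \<open>p\<close> in the cone: the linear subspace whose projectivization is the embedded projective tangent space
  at the point with homogeneous coordinates \<open>p\<close>.\<close>

definition tangent_space :: "'v mpol set \<Rightarrow> complex ^ 'v::finite \<Rightarrow> (complex ^ 'v) set" where
  "tangent_space I p = {v. \<forall>f\<in>I. (\<Sum>i\<in>UNIV. poly_eval (pdiff i f) p * v $ i) = 0}"

definition singular_at :: "'v mpol set \<Rightarrow> complex ^ 'v::finite \<Rightarrow> bool" where
  "singular_at I p \<longleftrightarrow>
     p \<in> cone_points I \<and> int (vec.dim (tangent_space I p)) - 1 > proj_dim I"

definition singular_points :: "'v mpol set \<Rightarrow> (complex ^ 'v::finite) set set" where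
  "singular_points I = {vec.span {p} | p. singular_at I p}"

text \<open>Isolatedness in the Zariski topology: \<open>p\<close> is the only singular point of the variety
  in the open set \<open>h \<noteq> 0\<close>.\<close>

definition isolated_singularity :: "'v mpol set \<Rightarrow> complex ^ 'v::finite \<Rightarrow> bool" where
  "isolated_singularity I p \<longleftrightarrow>
     singular_at I p \<and>
     (\<exists>h d. homogeneous d h \<and> poly_eval h p \<noteq> 0 \<and>
        (\<forall>q. singular_at I q \<and> poly_eval h q \<noteq> 0 \<longrightarrow> vec.span {q} = vec.span {p}))"

definition hypersurface_form :: "nat \<Rightarrow> 'v mpol \<Rightarrow> bool" where
  "hypersurface_form d f \<longleftrightarrow> f \<noteq> 0 \<and> homogeneous d f"

definition smooth_hypersurface :: "'v::finite mpol \<Rightarrow> bool" where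
  "smooth_hypersurface f \<longleftrightarrow>
     (\<forall>y. y \<noteq> 0 \<and> poly_eval f y = 0 \<longrightarrow> (\<exists>i. poly_eval (pdiff i f) y \<noteq> 0))"

text \<open>The variety with ideal \<open>I\<close> is the complete intersection of the hypersurfaces
  \<open>f = 0\<close> and \<open>g = 0\<close>: they generate its homogeneous ideal and its codimension is two.\<close>

definition complete_intersection2 ::
    "'v::finite mpol set \<Rightarrow> 'v mpol \<Rightarrow> 'v mpol \<Rightarrow> bool" where
  "complete_intersection2 I f g \<longleftrightarrow>
     I = ideal_gen {f, g} \<and> proj_dim I = (int CARD('v) - 1) - 2"

text \<open>The affine chart \<open>y \<mapsto> [p + y\<^sub>1 e\<^sub>1 + \<dots> + y\<^sub>n e\<^sub>n]\<close> of \<open>\<P>\<^sup>n\<close> sends the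
  origin to \<open>[p]\<close>; it is an isomorphism onto the complement of a hyperplane if and only if
  \<open>p, e\<^sub>1, \<dots>, e\<^sub>n\<close> is a basis.\<close>

definition centered_chart :: "complex ^ 'v::finite \<Rightarrow> ('w::finite \<Rightarrow> complex ^ 'v) \<Rightarrow> bool" where
  "centered_chart p e \<longleftrightarrow>
     CARD('v) = CARD('w) + 1 \<and> vec.span (insert p (range e)) = UNIV"

text \<open>The ideal in the chart is the image of the homogeneous ideal under dehomogenization,
  a surjective ring homomorphism.\<close>

definition chart_ideal ::
    "complex ^ 'v::finite \<Rightarrow> ('w::finite \<Rightarrow> complex ^ 'v) \<Rightarrow> 'v mpol set \<Rightarrow> 'w mpol set" where
  "chart_ideal p e I =
     poly_subst (\<lambda>j. Const (p $ j) + (\<Sum>k\<in>UNIV. Const (e k $ j) * Var k)) ` I"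

text \<open>The ideal of the tangent cone at the origin (as a scheme), that is, the kernel of the map
  from the polynomial ring to the associated graded ring of the local ring at the origin.\<close>

definition tangent_cone_ideal :: "'w mpol set \<Rightarrow> 'w mpol set" where
  "tangent_cone_ideal J = ideal_gen (initial_form ` J)"

text \<open>The ideal of the image of the affine cone \<open>c = 0\<close> under the linear map \<open>L\<close>.\<close>

definition embedded_cone_ideal :: "complex ^ 'u::finite ^ 'w::finite \<Rightarrow> 'u mpol \<Rightarrow> 'w mpol set" where
  "embedded_cone_ideal L c =
     {f. poly_subst (\<lambda>k. \<Sum>l\<in>UNIV. Const (L $ k $ l) * Var l) f \<in> ideal_gen {c}}"

text \<open>The tangent cone of a threefold in \<open>\<P>\<^sup>5\<close> lives in the tangent space of \<open>\<P>\<^sup>5\<close>, a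
  five-dimensional affine space; the cone over a cubic surface in \<open>\<P>\<^sup>3\<close> lies in a
  four-dimensional linear subspace of it, the image of \<open>L\<close>.\<close>

definition ordinary_triple_point :: "6 mpol set \<Rightarrow> complex ^ 6 \<Rightarrow> bool" where
  "ordinary_triple_point I p \<longleftrightarrow>
     isolated_singularity I p \<and>
     (\<exists>(e :: 5 \<Rightarrow> complex ^ 6) (L :: complex ^ 4 ^ 5) (c :: 4 mpol).
        centered_chart p e \<and> inj (\<lambda>y. L *v y) \<and>
        hypersurface_form 3 c \<and> smooth_hypersurface c \<and>
        tangent_cone_ideal (chart_ideal p e I) = embedded_cone_ideal L c)"

end

theory Submission
  imports Defs
    "HOL-Computational_Algebra.Polynomial_Factorial"
    "HOL-Computational_Algebra.Field_as_Ring"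
    "HOL-Computational_Algebra.Fundamental_Theorem_Algebra"
begin

text \<open>
  Write \<open>s\<^sub>1, s\<^sub>2, s\<^sub>3\<close> and \<open>t\<^sub>1, t\<^sub>2, t\<^sub>3\<close> for the elementary symmetric
  polynomials of the coordinates \<open>x\<^sub>1, x\<^sub>2, x\<^sub>3\<close> and \<open>y\<^sub>1, y\<^sub>2, y\<^sub>3\<close> of \<open>\<P>\<^sup>5\<close>. The threefold is
  given by \<open>Q = s\<^sub>2 - t\<^sub>2\<close> and
  \<open>F = s\<^sub>1 t\<^sub>1 (s\<^sub>2 + t\<^sub>2) + 9 (s\<^sub>3 t\<^sub>1 + s\<^sub>1 t\<^sub>3) - 12 s\<^sub>2 t\<^sub>2\<close>; its triple points are the six
  coordinate points and \<open>[1 : 1 : 1 : 1 : 1 : 1]\<close>. Near a coordinate point the quartic is, up to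
  a multiple of \<open>Q\<close>, of degree one in the coordinate that does not vanish there; this gives
  multiplicity at least three there for all choices of the three coefficients (with \<open>s\<^sub>3 t\<^sub>1\<close> and
  \<open>s\<^sub>1 t\<^sub>3\<close> sharing one). The same condition at the seventh point determines the coefficients
  \<open>1, 9, -12\<close> up to a common factor. The symmetry under permutations
  within each block and under the exchange of the blocks keeps all computations small.

  Singular points. By the Jacobian criterion they are the points of the threefold at which
  the gradient of \<open>F + m Q\<close> vanishes for some \<open>m\<close>. By symmetry the three derivatives with respect to
  the \<open>x\<^sub>i\<close> are the values at the \<open>x\<^sub>i\<close> of one quadratic polynomial, with leading coefficient
  \<open>9 t\<^sub>1\<close>. So two of the \<open>x\<^sub>i\<close> coincide if \<open>t\<^sub>1 \<noteq> 0\<close>, and two of the \<open>y\<^sub>j\<close> if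
  \<open>s\<^sub>1 \<noteq> 0\<close>. The systems in few unknowns that remain are elementary, except for one, which
  an explicit certificate excludes (\<open>critical_classification\<close>).

  Tangent cones. In a chart at one of the seven points \<open>Q\<close> starts with a linear form \<open>l\<close> and, after
  subtraction of a multiple of \<open>Q\<close>, \<open>F\<close> starts with a cubic form \<open>C\<close> that is not divisible by \<open>l\<close>.
  Then \<open>l\<close> and \<open>C\<close> generate the ideal of all initial forms (\<open>initial_form_mem\<close>), and the tangent
  cone is the cone over the cubic surface \<open>C = 0\<close> in the hyperplane \<open>l = 0\<close>. Up to scaling, this cubic
  is \<open>w\<^sub>1 w\<^sub>2 (w\<^sub>1 + w\<^sub>2) + w\<^sub>3 w\<^sub>4 (w\<^sub>3 + w\<^sub>4)\<close> at the point with equal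
  coordinates and \<open>2 t\<^sub>1 t\<^sub>2 + 9 t\<^sub>3 - 9 z\<^sup>2 t\<^sub>1\<close> at a coordinate point.

  Integrality. Let \<open>q\<close> be the common value of \<open>s\<^sub>2\<close> and \<open>t\<^sub>2\<close> on the quadric. Where
  \<open>(x\<^sub>2 + x\<^sub>3) (y\<^sub>2 + y\<^sub>3) \<noteq> 0\<close>, the coordinates \<open>x\<^sub>1\<close> and \<open>y\<^sub>1\<close> are rational functions of
  \<open>q, x\<^sub>2, x\<^sub>3, y\<^sub>2, y\<^sub>3\<close>, and \<open>F\<close> becomes a cubic polynomial in \<open>q\<close> with leading coefficient
  \<open>2\<close>. It has no root in the polynomial ring in the other variables, hence it is irreducible and, in a
  factorial ring, prime (\<open>prime_model_cubic\<close>). Since the two denominators are not zero divisors modulo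
  \<open>(Q, F)\<close> (\<open>denominator_regular\<close>), primality carries over to \<open>(Q, F)\<close>.

  Dimension. The cubic has a root for all values of \<open>x\<^sub>2, x\<^sub>3, y\<^sub>2, y\<^sub>3\<close>, so these
  four functions are algebraically independent. On the other hand, up to denominators every polynomial is
  congruent to a combination of \<open>1, q, q\<^sup>2\<close> over the polynomials in these four; a count of
  monomials shows that any five polynomials are dependent (\<open>five_dependent\<close>).
\<close>

section \<open>Homomorphisms and polynomials\<close>

abbreviation "lookup \<equiv> Poly_Mapping.lookup"
abbreviation "keys \<equiv> Poly_Mapping.keys"
abbreviation "single \<equiv> Poly_Mapping.single"

definition unital_ring_hom :: "('a::comm_ring_1 \<Rightarrow> 'b::comm_ring_1) \<Rightarrow> bool" where
  "unital_ring_hom h \<longleftrightarrow> h 1 = 1 \<and> (\<forall>a b. h (a + b) = h a + h b) \<and> (\<forall>a b. h (a * b) = h a * h b)"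

lemma unital_ring_homI:
  assumes "h 1 = 1" "\<And>a b. h (a + b) = h a + h b" "\<And>a b. h (a * b) = h a * h b"
  shows "unital_ring_hom h"
  using assms by (simp add: unital_ring_hom_def)

lemma hom_simps:
  assumes "unital_ring_hom h"
  shows "h 0 = 0" "h 1 = 1" "h (a + b) = h a + h b" "h (a * b) = h a * h b"
    "h (- a) = - h a" "h (a - b) = h a - h b" "h (a ^ n) = h a ^ n" "h (numeral k) = numeral k"
    "h (of_nat m) = of_nat m"
proof -
  show add: "h (a + b) = h a + h b" and one: "h 1 = 1" and mult: "h (a * b) = h a * h b" for a b
    using assms by (simp_all add: unital_ring_hom_def)
  show zero: "h 0 = 0" using add[of 0 0] by simp
  have neg: "h (- a) = - h a" for a
    using add[of a "- a"] zero by (simp add: eq_neg_iff_add_eq_0 add.commute)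
  show "h (- a) = - h a" by (rule neg)
  show "h (a - b) = h a - h b" using add[of a "- b"] neg by simp
  show "h (a ^ n) = h a ^ n" by (induction n) (simp_all add: one mult)
  have nat: "h (of_nat m) = of_nat m" for m by (induction m) (simp_all add: zero one add)
  show "h (of_nat m) = of_nat m" by (rule nat)
  show "h (numeral k) = numeral k" using nat[of "numeral k"] by simp
qed

lemma hom_sum:
  assumes "unital_ring_hom h"
  shows "h (sum f A) = (\<Sum>x\<in>A. h (f x))"
  by (induction A rule: infinite_finite_induct) (simp_all add: hom_simps[OF assms])

lemma unital_ring_hom_id: "unital_ring_hom id"
  by (simp add: unital_ring_hom_def)

lemma unital_ring_hom_comp:
  assumes "unital_ring_hom g" "unital_ring_hom h"
  shows "unital_ring_hom (\<lambda>x. g (h x))"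
  by (rule unital_ring_homI) (simp_all add: hom_simps[OF assms(1)] hom_simps[OF assms(2)])

section \<open>Induction\<close>

lemma sum_single: "(\<Sum>m\<in>keys p. single m (lookup p m)) = p"
proof (rule poly_mapping_eqI)
  fix k
  have "lookup (\<Sum>m\<in>keys p. single m (lookup p m)) k = (\<Sum>m\<in>keys p. if m = k then lookup p m else 0)"
    by (simp add: lookup_sum lookup_single when_def)
  also have "\<dots> = lookup p k"
    by (simp add: sum.delta in_keys_iff)
  finally show "lookup (\<Sum>m\<in>keys p. single m (lookup p m)) k = lookup p k" .
qed

lemma poly_mapping_single_induct [case_names single add]:
  fixes p :: "'k \<Rightarrow>\<^sub>0 'a::comm_monoid_add"
  assumes "\<And>m c. P (single m c)" "\<And>p q. P p \<Longrightarrow> P q \<Longrightarrow> P (p + q)"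
  shows "P p"
proof -
  have "P (\<Sum>m\<in>A. single m (lookup p m))" if "finite A" for A
    using that
  proof (induction A)
    case empty
    show ?case using assms(1)[of undefined 0] by simp
  next
    case (insert x A)
    then show ?case using assms by simp
  qed
  from this[of "keys p"] show ?thesis by (simp add: sum_single)
qed

lemma Const_hom: "unital_ring_hom Const"
  unfolding Const_def by (rule unital_ring_homI) (simp_all add: single_add mult_single)

lemma Const_mult_single: "Const c * single m d = single m (c * d)"
  by (simp add: Const_def mult_single)

lemma single_eq_prod_Var:
  "single m (1::complex) = (\<Prod>i\<in>keys m. Var i ^ lookup m i)"
proof -
  have pow: "Var i ^ n = single (single i n) 1" for i :: 'v and n
    by (induction n) (simp_all add: Var_def mult_single flip: single_add)
  have "(\<Prod>i\<in>A. Var i ^ f i) = single (\<Sum>i\<in>A. single i (f i)) 1" for A :: "'v set" and f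
    by (induction A rule: infinite_finite_induct) (simp_all add: pow mult_single)
  from this[of "lookup m" "keys m"] show ?thesis by (simp add: sum_single)
qed

text \<open>Polynomials are generated as a ring by constants and variables; this is how statements that are
  compatible with sums and products are reduced to the generators.\<close>

lemma mpol_induct [case_names Const Var add mult]:
  fixes p :: "'v mpol"
  assumes C: "\<And>c. P (Const c)" and V: "\<And>i. P (Var i)"
    and add: "\<And>p q. P p \<Longrightarrow> P q \<Longrightarrow> P (p + q)" and mult: "\<And>p q. P p \<Longrightarrow> P q \<Longrightarrow> P (p * q)"
  shows "P p"
proof (induction p rule: poly_mapping_single_induct)
  case (single m c)
  have one: "P 1" using C[of 1] by (simp add: hom_simps[OF Const_hom])
  have pow: "P (Var i ^ n)" for i n by (induction n) (simp_all add: one V mult)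
  have "P (\<Prod>i\<in>A. Var i ^ f i)" for A :: "'v set" and f
    by (induction A rule: infinite_finite_induct) (simp_all add: one mult pow)
  then have "P (Const c * single m 1)" using C mult by (simp add: single_eq_prod_Var)
  then show ?case by (simp add: Const_mult_single)
qed (rule add)

section \<open>Values of polynomials\<close>

definition monom_val :: "('v \<Rightarrow> 'a::comm_ring_1) \<Rightarrow> ('v \<Rightarrow>\<^sub>0 nat) \<Rightarrow> 'a" where
  "monom_val f m = (\<Prod>i\<in>keys m. f i ^ lookup m i)"

lemma monom_val_superset:
  assumes "finite S" "keys m \<subseteq> S"
  shows "monom_val f m = (\<Prod>i\<in>S. f i ^ lookup m i)"
  unfolding monom_val_def using assms
  by (intro prod.mono_neutral_left) (auto simp: in_keys_iff)

lemma monom_val_add: "monom_val f (m + n) = monom_val f m * monom_val f n"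
proof -
  have "keys (m + n) \<subseteq> keys m \<union> keys n" by (rule keys_add)
  then show ?thesis
    by (simp add: monom_val_superset[where S = "keys m \<union> keys n"] lookup_add power_add prod.distrib)
qed

lemma monom_val_single: "monom_val f (single i n) = f i ^ n"
  by (cases n) (simp_all add: monom_val_def)

lemma monom_val_0: "monom_val f 0 = 1"
  by (simp add: monom_val_def)

lemma insertion_superset:
  assumes "unital_ring_hom h" "finite S" "keys p \<subseteq> S"
  shows "insertion h f p = (\<Sum>m\<in>S. h (lookup p m) * monom_val f m)"
  unfolding insertion_def monom_val_def using assms
  by (intro sum.mono_neutral_left) (auto simp: in_keys_iff hom_simps[OF assms(1)])

lemma insertion_single:
  assumes "unital_ring_hom h"
  shows "insertion h f (single m c) = h c * monom_val f m"
  using insertion_superset[OF assms, of "{m}" "single m c" f] by auto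

lemma insertion_hom:
  assumes h: "unital_ring_hom h"
  shows "unital_ring_hom (insertion h f)"
proof (rule unital_ring_homI)
  show "insertion h f 1 = 1"
    using insertion_single[OF h, of f 0 1]  by (simp add: hom_simps[OF h] monom_val_0)
  show add: "insertion h f (p + q) = insertion h f p + insertion h f q" for p q
  proof -
    have "keys (p + q) \<subseteq> keys p \<union> keys q" by (rule keys_add)
    then show ?thesis
      by (simp add: insertion_superset[OF h, where S = "keys p \<union> keys q"] lookup_add
          hom_simps[OF h] distrib_right sum.distrib)
  qed
  show "insertion h f (p * q) = insertion h f p * insertion h f q" for p q
  proof (induction p rule: poly_mapping_single_induct)
    case (single m c)
    show ?case
      by (induction q rule: poly_mapping_single_induct)
        (simp_all add: mult_single insertion_single[OF h] hom_simps[OF h] monom_val_add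
          distrib_left add)
  qed (simp add: add distrib_right)
qed

lemma insertion_Var: "unital_ring_hom h \<Longrightarrow> insertion h f (Var i) = f i"
  by (simp add: Var_def insertion_single monom_val_single hom_simps)

lemma insertion_Const: "unital_ring_hom h \<Longrightarrow> insertion h f (Const c) = h c"
  by (simp add: Const_def insertion_single monom_val_0)

lemma hom_eq_insertion:
  assumes g: "unital_ring_hom g"
  shows "g p = insertion (\<lambda>c. g (Const c)) (\<lambda>i. g (Var i)) p"
proof -
  have h: "unital_ring_hom (\<lambda>c. g (Const c))"
    by (rule unital_ring_hom_comp[OF g Const_hom])
  show ?thesis
    by (induction p rule: mpol_induct)
      (simp_all add: insertion_Var[OF h] insertion_Const[OF h] hom_simps[OF g]
        hom_simps[OF insertion_hom[OF h]])
qed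

lemma mpol_hom_eqI:
  assumes "unital_ring_hom g" "unital_ring_hom h"
    and "\<And>c. g (Const c) = h (Const c)" "\<And>i. g (Var i) = h (Var i)"
  shows "g p = h p"
  using assms hom_eq_insertion[of g p] hom_eq_insertion[of h p] by simp

lemma poly_eval_hom: "unital_ring_hom (\<lambda>p. poly_eval p x)"
  unfolding poly_eval_def by (rule insertion_hom[OF unital_ring_hom_id])

lemma poly_eval_Var: "poly_eval (Var i) x = x $ i"
  by (simp add: poly_eval_def insertion_Var[OF unital_ring_hom_id])

lemma poly_eval_Const: "poly_eval (Const c) x = c"
  by (simp add: poly_eval_def insertion_Const[OF unital_ring_hom_id])

lemmas poly_eval_simps = hom_simps[OF poly_eval_hom] poly_eval_Var poly_eval_Const

lemma poly_subst_hom: "unital_ring_hom (poly_subst f)"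
  unfolding poly_subst_def[abs_def] by (rule insertion_hom[OF Const_hom])

lemma poly_subst_Var: "poly_subst f (Var i) = f i"
  by (simp add: poly_subst_def insertion_Var[OF Const_hom])

lemma poly_subst_Const: "poly_subst f (Const c) = Const c"
  by (simp add: poly_subst_def insertion_Const[OF Const_hom])

lemma monom_val_inj:
  assumes "m \<noteq> n"
  shows "\<exists>f. monom_val f m \<noteq> (monom_val f n :: complex)"
proof -
  obtain i where i: "lookup m i \<noteq> lookup n i"
    using assms by (metis poly_mapping_eqI)
  define f where "f j = (if j = i then 2 else 1 :: complex)" for j
  have "monom_val f k = 2 ^ lookup k i" for k
  proof -
    have "monom_val f k = (\<Prod>j\<in>insert i (keys k). f j ^ lookup k j)"
      by (rule monom_val_superset) auto
    also have "\<dots> = f i ^ lookup k i * (\<Prod>j\<in>keys k - {i}. f j ^ lookup k j)"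
      by (subst prod.insert_remove) simp_all
    also have "(\<Prod>j\<in>keys k - {i}. f j ^ lookup k j) = 1"
      by (rule prod.neutral) (auto simp: f_def)
    finally show "monom_val f k = 2 ^ lookup k i" by (simp add: f_def[of i])
  qed
  moreover have "(2::complex) ^ a = 2 ^ b \<longleftrightarrow> a = b" for a b
  proof -
    have "(2::complex) ^ a = 2 ^ b \<longleftrightarrow> (of_nat (2 ^ a) :: complex) = of_nat (2 ^ b)" by simp
    also have "\<dots> \<longleftrightarrow> a = b" unfolding of_nat_eq_iff by simp
    finally show ?thesis .
  qed
  ultimately show ?thesis using i by (intro exI[of _ f]) simp
qed

text \<open>Distinct exponent vectors give distinct multiplicative functions on the space of points, and
  distinct characters are linearly independent (Artin); so a complex polynomial, in any number of
  variables, is determined by its values.\<close>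

lemma monom_val_lin_indep:
  assumes "finite S" "\<And>f. (\<Sum>m\<in>S. c m * monom_val f m) = (0::complex)"
  shows "\<forall>m\<in>S. c m = 0"
  using assms
proof (induction S arbitrary: c)
  case (insert n S)
  have sub: "c m = 0" if "m \<in> S" for m
  proof -
    from that insert.hyps have "m \<noteq> n" by auto
    then obtain g where g: "monom_val g m \<noteq> (monom_val g n :: complex)"
      using monom_val_inj by blast
    define d where "d k = c k * (monom_val g k - monom_val g n)" for k
    have "(\<Sum>k\<in>S. d k * monom_val f k) = 0" for f
    proof -
      have mul: "monom_val (\<lambda>i. f i * g i) k = monom_val f k * monom_val g k" for k
        by (simp add: monom_val_def power_mult_distrib prod.distrib)
      have "(\<Sum>k\<in>S. d k * monom_val f k) = (\<Sum>k\<in>insert n S. d k * monom_val f k)"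
        using insert.hyps by (simp add: d_def)
      also have "\<dots> = (\<Sum>k\<in>insert n S. c k * monom_val (\<lambda>i. f i * g i) k)
          - monom_val g n * (\<Sum>k\<in>insert n S. c k * monom_val f k)"
        unfolding d_def mul sum_distrib_left by (subst sum_subtractf[symmetric]) (simp add: algebra_simps)
      also have "\<dots> = 0" by (simp only: insert.prems) simp
      finally show ?thesis .
    qed
    then have "\<forall>m\<in>S. d m = 0" using insert.IH by blast
    with that have "d m = 0" by blast
    with g show ?thesis by (simp add: d_def)
  qed
  moreover have "c n = 0"
    using insert.prems[of "\<lambda>_. 1"] insert.hyps sub by (simp add: monom_val_def)
  ultimately show ?case by blast
qed simp

lemma mpol_eq_0I:
  fixes p :: "'v mpol"
  assumes "\<And>f. insertion id f p = 0"
  shows "p = 0"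
proof -
  have "\<forall>m\<in>keys p. lookup p m = 0"
    by (rule monom_val_lin_indep)
      (use assms in \<open>simp_all add: insertion_superset[OF unital_ring_hom_id, of "keys p"]\<close>)
  then show ?thesis by (metis in_keys_iff keys_eq_empty ex_in_conv)
qed

lemma mpol_eq_0_poly_evalI:
  assumes "\<And>x. poly_eval p x = 0"
  shows "p = 0"
proof (rule mpol_eq_0I)
  fix f
  show "insertion id f p = 0" using assms[of "\<chi> i. f i"] by (simp add: poly_eval_def)
qed

section \<open>Formal derivatives\<close>

lemma pdiff_superset:
  assumes "finite S" "keys p \<subseteq> S"
  shows "pdiff i p = (\<Sum>m\<in>S. single (m - single i 1) (of_nat (lookup m i) * lookup p m))"
  unfolding pdiff_def using assms
  by (intro sum.mono_neutral_left) (auto simp: in_keys_iff)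

lemma pdiff_single: "pdiff i (single m c) = single (m - single i 1) (of_nat (lookup m i) * c)"
  using pdiff_superset[of "{m}" "single m c" i] by auto

lemma pdiff_add: "pdiff i (p + q) = pdiff i p + pdiff i q"
proof -
  have "keys (p + q) \<subseteq> keys p \<union> keys q" by (rule keys_add)
  then show ?thesis
    by (simp add: pdiff_superset[where S = "keys p \<union> keys q"] lookup_add single_add
        distrib_left sum.distrib)
qed

lemma pdiff_mult: "pdiff i (p * q) = pdiff i p * q + p * pdiff i q"
proof (induction p rule: poly_mapping_single_induct)
  case (single m c)
  show ?case
  proof (induction q rule: poly_mapping_single_induct)
    case (single n d)
    have left: "single (m + n - single i 1) (of_nat (lookup m i) * a) =
        single (m - single i 1 + n) (of_nat (lookup m i) * a)" for m n and a :: complex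
    proof (cases "lookup m i = 0")
      case False
      then have "m + n - single i 1 = m - single i 1 + n"
        by (intro poly_mapping_eqI) (auto simp: lookup_add lookup_minus lookup_single when_def)
      then show ?thesis by simp
    qed simp
    show ?case
      using left[of m n "c * d"] left[of n m "c * d"]
      by (simp add: pdiff_single mult_single lookup_add distrib_left distrib_right single_add
          add.commute mult.assoc mult.left_commute)
  qed (simp add: pdiff_add algebra_simps)
qed (simp add: pdiff_add algebra_simps)

lemma pdiff_Const: "pdiff i (Const c) = 0"
  by (simp add: Const_def pdiff_single)

lemma pdiff_Var: "pdiff i (Var j) = (if i = j then 1 else 0)"
  by (auto simp: Var_def pdiff_single lookup_single when_def)

lemma pdiff_0: "pdiff i 0 = 0"
  using pdiff_Const[of i 0] by (simp add: hom_simps[OF Const_hom])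

lemma pdiff_1: "pdiff i 1 = 0"
  using pdiff_Const[of i 1] by (simp add: hom_simps[OF Const_hom])

lemma pdiff_numeral: "pdiff i (numeral k) = 0"
  using pdiff_Const[of i "numeral k"] by (simp add: hom_simps[OF Const_hom])

lemma pdiff_uminus: "pdiff i (- p) = - pdiff i p"
  using pdiff_add[of i p "- p"] by (simp add: pdiff_0 eq_neg_iff_add_eq_0 add.commute)

lemma pdiff_minus: "pdiff i (p - q) = pdiff i p - pdiff i q"
  using pdiff_add[of i p "- q"] by (simp add: pdiff_uminus)

lemma pdiff_square: "pdiff i (p ^ 2) = 2 * p * pdiff i p"
  by (simp add: power2_eq_square pdiff_mult algebra_simps mult_2)

lemmas pdiff_simps = pdiff_0 pdiff_1 pdiff_numeral pdiff_Const pdiff_Var pdiff_add pdiff_minus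
  pdiff_uminus pdiff_mult pdiff_square

section \<open>Ideals\<close>

lemma ideal_gen_ideal: "is_ideal (ideal_gen S)"
  unfolding ideal_gen_def
  by (rule hull_in) (auto simp: is_ideal_def)

lemma ideal_gen_base: "x \<in> S \<Longrightarrow> x \<in> ideal_gen S"
  unfolding ideal_gen_def by (rule hull_inc)

lemma ideal_gen_least: "is_ideal I \<Longrightarrow> S \<subseteq> I \<Longrightarrow> ideal_gen S \<subseteq> I"
  unfolding ideal_gen_def by (rule hull_minimal)

lemma is_idealD:
  assumes "is_ideal I"
  shows "0 \<in> I" "a \<in> I \<Longrightarrow> b \<in> I \<Longrightarrow> a + b \<in> I" "a \<in> I \<Longrightarrow> r * a \<in> I" "a \<in> I \<Longrightarrow> a * r \<in> I"
    "a \<in> I \<Longrightarrow> - a \<in> I" "a \<in> I \<Longrightarrow> b \<in> I \<Longrightarrow> a - b \<in> I"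
proof -
  show "0 \<in> I" and add: "a \<in> I \<Longrightarrow> b \<in> I \<Longrightarrow> a + b \<in> I"
    and mult: "a \<in> I \<Longrightarrow> r * a \<in> I" for a b r
    using assms by (auto simp: is_ideal_def)
  show "a \<in> I \<Longrightarrow> a * r \<in> I" using mult[of a r] by (simp add: mult.commute)
  show neg: "a \<in> I \<Longrightarrow> - a \<in> I" for a using mult[of a "-1"] by simp
  show "a \<in> I \<Longrightarrow> b \<in> I \<Longrightarrow> a - b \<in> I" using add[of a "- b"] neg by simp
qed

lemma is_ideal_sum:
  assumes "is_ideal I" "\<And>x. x \<in> A \<Longrightarrow> f x \<in> I"
  shows "sum f A \<in> I"
  using assms(2) by (induction A rule: infinite_finite_induct) (auto intro: is_idealD[OF assms(1)])

lemma ideal_gen_pair: "ideal_gen {f, g} = {a * f + b * g | a b. True}"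
proof
  have "is_ideal {a * f + b * g | a b. True}"
    unfolding is_ideal_def
  proof (intro conjI ballI allI)
    show "0 \<in> {a * f + b * g | a b. True}"
      by (auto intro!: exI[of _ 0])
    show "x + y \<in> {a * f + b * g | a b. True}"
      if xy: "x \<in> {a * f + b * g | a b. True}" "y \<in> {a * f + b * g | a b. True}" for x y
    proof -
      from xy obtain a b a' b' where "x = a * f + b * g" "y = a' * f + b' * g" by blast
      then have "x + y = (a + a') * f + (b + b') * g" by (simp add: algebra_simps)
      then show ?thesis by blast
    qed
    show "r * x \<in> {a * f + b * g | a b. True}" if "x \<in> {a * f + b * g | a b. True}" for r x
    proof -
      from that obtain a b where "x = a * f + b * g" by blast
      then have "r * x = (r * a) * f + (r * b) * g" by (simp add: algebra_simps)
      then show ?thesis by blast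
    qed
  qed
  moreover have "f = 1 * f + 0 * g" "g = 0 * f + 1 * g" by simp_all
  then have "{f, g} \<subseteq> {a * f + b * g | a b. True}" by blast
  ultimately show "ideal_gen {f, g} \<subseteq> {a * f + b * g | a b. True}"
    by (rule ideal_gen_least)
  have "a * f + b * g \<in> ideal_gen {f, g}" for a b
    by (intro is_idealD(2,3)[OF ideal_gen_ideal] ideal_gen_base) auto
  then show "{a * f + b * g | a b. True} \<subseteq> ideal_gen {f, g}" by blast
qed

lemma ideal_gen_singleton: "ideal_gen {f} = range (\<lambda>a. a * f)"
proof -
  have "ideal_gen {f} = ideal_gen {f, 0}"
    by (intro antisym ideal_gen_least ideal_gen_ideal)
      (auto intro: ideal_gen_base is_idealD[OF ideal_gen_ideal])
  then show ?thesis by (auto simp: ideal_gen_pair)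
qed

lemma UNIV_4: "(UNIV :: 4 set) = {0, 1, 2, 3}"
  by (rule card_subset_eq[symmetric]) (simp_all add: card_insert_if)
lemma UNIV_5: "(UNIV :: 5 set) = {0, 1, 2, 3, 4}"
  by (rule card_subset_eq[symmetric]) (simp_all add: card_insert_if)
lemma UNIV_6: "(UNIV :: 6 set) = {0, 1, 2, 3, 4, 5}"
  by (rule card_subset_eq[symmetric]) (simp_all add: card_insert_if)

section \<open>The quadric and the quartic\<close>

text \<open>The forms are defined over an arbitrary ring, so that the same expression serves for
  polynomials, for their values and for their images under substitutions. The coordinates \<open>x\<^sub>i\<close>
  have the indices \<open>0, 1, 2\<close>, the coordinates \<open>y\<^sub>j\<close> the indices \<open>3, 4, 5\<close>.\<close>

definition quadric :: "'a::comm_ring_1 \<Rightarrow> 'a \<Rightarrow> 'a \<Rightarrow> 'a \<Rightarrow> 'a \<Rightarrow> 'a \<Rightarrow> 'a" where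
  "quadric x1 x2 x3 y1 y2 y3 = (x1 * x2 + x1 * x3 + x2 * x3) - (y1 * y2 + y1 * y3 + y2 * y3)"

definition quartic :: "'a::comm_ring_1 \<Rightarrow> 'a \<Rightarrow> 'a \<Rightarrow> 'a \<Rightarrow> 'a \<Rightarrow> 'a \<Rightarrow> 'a" where
  "quartic x1 x2 x3 y1 y2 y3 =
    (let s1 = x1 + x2 + x3; s2 = x1 * x2 + x1 * x3 + x2 * x3; s3 = x1 * x2 * x3;
         t1 = y1 + y2 + y3; t2 = y1 * y2 + y1 * y3 + y2 * y3; t3 = y1 * y2 * y3
     in s1 * t1 * (s2 + t2) + 9 * (s3 * t1 + s1 * t3) - 12 * s2 * t2)"

text \<open>The partial derivative of the quartic with respect to its first argument; all others arise from
  this one by symmetry. It is grouped as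
  \<open>\<partial>F/\<partial>s\<^sub>1 + \<partial>F/\<partial>s\<^sub>2 (x\<^sub>2 + x\<^sub>3) + \<partial>F/\<partial>s\<^sub>3 x\<^sub>2 x\<^sub>3\<close>.\<close>

definition quartic_dx :: "'a::comm_ring_1 \<Rightarrow> 'a \<Rightarrow> 'a \<Rightarrow> 'a \<Rightarrow> 'a \<Rightarrow> 'a \<Rightarrow> 'a" where
  "quartic_dx x1 x2 x3 y1 y2 y3 =
    (let s1 = x1 + x2 + x3; s2 = x1 * x2 + x1 * x3 + x2 * x3;
         t1 = y1 + y2 + y3; t2 = y1 * y2 + y1 * y3 + y2 * y3; t3 = y1 * y2 * y3
     in t1 * (s2 + t2) + 9 * t3 + (s1 * t1 - 12 * t2) * (x2 + x3) + 9 * t1 * x2 * x3)"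

abbreviation Q6 :: "6 mpol" where "Q6 \<equiv> quadric (Var 0) (Var 1) (Var 2) (Var 3) (Var 4) (Var 5)"
abbreviation F6 :: "6 mpol" where "F6 \<equiv> quartic (Var 0) (Var 1) (Var 2) (Var 3) (Var 4) (Var 5)"

lemma hom_quadric:
  "unital_ring_hom h \<Longrightarrow> h (quadric a b c d e f) = quadric (h a) (h b) (h c) (h d) (h e) (h f)"
  by (simp add: quadric_def hom_simps)

lemma hom_quartic:
  "unital_ring_hom h \<Longrightarrow> h (quartic a b c d e f) = quartic (h a) (h b) (h c) (h d) (h e) (h f)"
  by (simp add: quartic_def hom_simps Let_def)

lemma hom_quartic_dx:
  "unital_ring_hom h \<Longrightarrow> h (quartic_dx a b c d e f) = quartic_dx (h a) (h b) (h c) (h d) (h e) (h f)"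
  by (simp add: quartic_dx_def hom_simps Let_def)

lemma poly_eval_Q6: "poly_eval Q6 p = quadric (p$0) (p$1) (p$2) (p$3) (p$4) (p$5)"
  by (simp add: hom_quadric[OF poly_eval_hom] poly_eval_Var)
lemma poly_eval_F6: "poly_eval F6 p = quartic (p$0) (p$1) (p$2) (p$3) (p$4) (p$5)"
  by (simp add: hom_quartic[OF poly_eval_hom] poly_eval_Var)

lemma poly_eval_pdiff_Q6:
  "poly_eval (pdiff 0 Q6) p = p$1 + p$2" "poly_eval (pdiff 1 Q6) p = p$0 + p$2"
  "poly_eval (pdiff 2 Q6) p = p$0 + p$1" "poly_eval (pdiff 3 Q6) p = - (p$4 + p$5)"
  "poly_eval (pdiff 4 Q6) p = - (p$3 + p$5)" "poly_eval (pdiff 5 Q6) p = - (p$3 + p$4)"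
  by (simp_all add: quadric_def pdiff_simps poly_eval_simps)

text \<open>The chain rule through the elementary symmetric polynomials.\<close>

lemma pdiff_quartic:
  "pdiff i (quartic x1 x2 x3 y1 y2 y3) =
     pdiff i x1 * quartic_dx x1 x2 x3 y1 y2 y3 + pdiff i x2 * quartic_dx x2 x1 x3 y1 y2 y3
     + pdiff i x3 * quartic_dx x3 x1 x2 y1 y2 y3 + pdiff i y1 * quartic_dx y1 y2 y3 x1 x2 x3
     + pdiff i y2 * quartic_dx y2 y1 y3 x1 x2 x3 + pdiff i y3 * quartic_dx y3 y1 y2 x1 x2 x3"
proof -
  define s1 s2 s3 where "s1 = x1 + x2 + x3" and "s2 = x1 * x2 + x1 * x3 + x2 * x3" and "s3 = x1 * x2 * x3"
  define t1 t2 t3 where "t1 = y1 + y2 + y3" and "t2 = y1 * y2 + y1 * y3 + y2 * y3" and "t3 = y1 * y2 * y3"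
  define A B C where "A = t1 * (s2 + t2) + 9 * t3" and "B = s1 * t1 - 12 * t2" and "C = 9 * t1"
  define A' B' C' where "A' = s1 * (t2 + s2) + 9 * s3" and "B' = t1 * s1 - 12 * s2" and "C' = 9 * s1"
  note st = s1_def[symmetric] s2_def[symmetric] s3_def[symmetric] t1_def[symmetric] t2_def[symmetric] t3_def[symmetric]
  have perm: "x2 + x1 + x3 = s1" "x2 * x1 + x2 * x3 + x1 * x3 = s2"
    "x3 + x1 + x2 = s1" "x3 * x1 + x3 * x2 + x1 * x2 = s2"
    "y2 + y1 + y3 = t1" "y2 * y1 + y2 * y3 + y1 * y3 = t2"
    "y3 + y1 + y2 = t1" "y3 * y1 + y3 * y2 + y1 * y2 = t2"
    by (simp_all add: s1_def s2_def t1_def t2_def ac_simps)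
  have dx: "quartic_dx x1 x2 x3 y1 y2 y3 = A + B * (x2 + x3) + C * (x2 * x3)"
    "quartic_dx x2 x1 x3 y1 y2 y3 = A + B * (x1 + x3) + C * (x1 * x3)"
    "quartic_dx x3 x1 x2 y1 y2 y3 = A + B * (x1 + x2) + C * (x1 * x2)"
    "quartic_dx y1 y2 y3 x1 x2 x3 = A' + B' * (y2 + y3) + C' * (y2 * y3)"
    "quartic_dx y2 y1 y3 x1 x2 x3 = A' + B' * (y1 + y3) + C' * (y1 * y3)"
    "quartic_dx y3 y1 y2 x1 x2 x3 = A' + B' * (y1 + y2) + C' * (y1 * y2)"
    unfolding quartic_dx_def Let_def st perm A_def B_def C_def A'_def B'_def C'_def
    by (simp_all add: mult.assoc)
  have "quartic x1 x2 x3 y1 y2 y3 = s1 * t1 * (s2 + t2) + 9 * (s3 * t1 + s1 * t3) - 12 * s2 * t2"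
    unfolding quartic_def Let_def st ..
  also have "pdiff i \<dots> = pdiff i s1 * A + pdiff i s2 * B + pdiff i s3 * C
      + pdiff i t1 * A' + pdiff i t2 * B' + pdiff i t3 * C'"
    by (simp add: pdiff_simps A_def B_def C_def A'_def B'_def C'_def algebra_simps)
  also have "\<dots> = pdiff i x1 * (A + B * (x2 + x3) + C * (x2 * x3))
     + pdiff i x2 * (A + B * (x1 + x3) + C * (x1 * x3)) + pdiff i x3 * (A + B * (x1 + x2) + C * (x1 * x2))
     + pdiff i y1 * (A' + B' * (y2 + y3) + C' * (y2 * y3))
     + pdiff i y2 * (A' + B' * (y1 + y3) + C' * (y1 * y3)) + pdiff i y3 * (A' + B' * (y1 + y2) + C' * (y1 * y2))"
    unfolding s1_def s2_def s3_def t1_def t2_def t3_def by (simp add: pdiff_simps algebra_simps)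
  finally show ?thesis unfolding dx .
qed

lemma poly_eval_pdiff_F6:
  "poly_eval (pdiff 0 F6) p = quartic_dx (p$0) (p$1) (p$2) (p$3) (p$4) (p$5)"
  "poly_eval (pdiff 1 F6) p = quartic_dx (p$1) (p$0) (p$2) (p$3) (p$4) (p$5)"
  "poly_eval (pdiff 2 F6) p = quartic_dx (p$2) (p$0) (p$1) (p$3) (p$4) (p$5)"
  "poly_eval (pdiff 3 F6) p = quartic_dx (p$3) (p$4) (p$5) (p$0) (p$1) (p$2)"
  "poly_eval (pdiff 4 F6) p = quartic_dx (p$4) (p$3) (p$5) (p$0) (p$1) (p$2)"
  "poly_eval (pdiff 5 F6) p = quartic_dx (p$5) (p$3) (p$4) (p$0) (p$1) (p$2)"
  by (simp_all add: pdiff_quartic pdiff_Var hom_quartic_dx[OF poly_eval_hom] poly_eval_Var)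

section \<open>Critical points\<close>

text \<open>The gradient of \<open>F + m Q\<close> vanishes at a common zero of \<open>Q\<close> and \<open>F\<close>; the multiplier of \<open>F\<close>
  can be normalised to one because \<open>Q\<close> alone is singular only at the origin.\<close>

definition critical :: "complex \<Rightarrow> complex \<Rightarrow> complex \<Rightarrow> complex \<Rightarrow> complex \<Rightarrow> complex \<Rightarrow> complex \<Rightarrow> bool" where
  "critical m x1 x2 x3 y1 y2 y3 \<longleftrightarrow>
     quadric x1 x2 x3 y1 y2 y3 = 0 \<and> quartic x1 x2 x3 y1 y2 y3 = 0 \<and>
     m * (x2 + x3) + quartic_dx x1 x2 x3 y1 y2 y3 = 0 \<and>
     m * (x1 + x3) + quartic_dx x2 x1 x3 y1 y2 y3 = 0 \<and>
     m * (x1 + x2) + quartic_dx x3 x1 x2 y1 y2 y3 = 0 \<and>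
     - m * (y2 + y3) + quartic_dx y1 y2 y3 x1 x2 x3 = 0 \<and>
     - m * (y1 + y3) + quartic_dx y2 y1 y3 x1 x2 x3 = 0 \<and>
     - m * (y1 + y2) + quartic_dx y3 y1 y2 x1 x2 x3 = 0"

lemma quadric_perm:
  "quadric x2 x1 x3 y1 y2 y3 = quadric x1 x2 x3 y1 y2 y3" "quadric x1 x3 x2 y1 y2 y3 = quadric x1 x2 x3 y1 y2 y3"
  "quadric x1 x2 x3 y2 y1 y3 = quadric x1 x2 x3 y1 y2 y3" "quadric x1 x2 x3 y1 y3 y2 = quadric x1 x2 x3 y1 y2 y3"
  "quadric y1 y2 y3 x1 x2 x3 = - quadric x1 x2 x3 y1 y2 y3"
  by (simp_all add: quadric_def ac_simps)

lemma quartic_perm: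
  "quartic x2 x1 x3 y1 y2 y3 = quartic x1 x2 x3 y1 y2 y3" "quartic x1 x3 x2 y1 y2 y3 = quartic x1 x2 x3 y1 y2 y3"
  "quartic x1 x2 x3 y2 y1 y3 = quartic x1 x2 x3 y1 y2 y3" "quartic x1 x2 x3 y1 y3 y2 = quartic x1 x2 x3 y1 y2 y3"
  "quartic y1 y2 y3 x1 x2 x3 = quartic x1 x2 x3 y1 y2 y3"
  by (simp_all add: quartic_def Let_def algebra_simps)

lemma quartic_dx_perm:
  "quartic_dx x1 x3 x2 y1 y2 y3 = quartic_dx x1 x2 x3 y1 y2 y3"
  "quartic_dx x1 x2 x3 y2 y1 y3 = quartic_dx x1 x2 x3 y1 y2 y3"
  "quartic_dx x1 x2 x3 y1 y3 y2 = quartic_dx x1 x2 x3 y1 y2 y3"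
  by (simp_all add: quartic_dx_def Let_def ac_simps)

lemma critical_perm:
  assumes "critical m x1 x2 x3 y1 y2 y3"
  shows "critical m x2 x1 x3 y1 y2 y3" "critical m x1 x3 x2 y1 y2 y3"
    "critical m x1 x2 x3 y2 y1 y3" "critical m x1 x2 x3 y1 y3 y2"
proof -
  note c = assms[unfolded critical_def]
  show "critical m x2 x1 x3 y1 y2 y3"
    using c unfolding critical_def
    by (simp only: quadric_perm(1)[of x2 x1] quartic_perm(1)[of x2 x1] quartic_dx_perm(1)[of x3 x2 x1]
        quartic_dx_perm(2)[of _ _ _ x2 x1] add.commute[of x2 x1] simp_thms)
  show "critical m x1 x3 x2 y1 y2 y3"
    using c unfolding critical_def
    by (simp only: quadric_perm(2)[of x1 x3 x2] quartic_perm(2)[of x1 x3 x2] quartic_dx_perm(1)[of x1 x3 x2]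
        quartic_dx_perm(3)[of _ _ _ x1 x3 x2] add.commute[of x3 x2] simp_thms)
  show "critical m x1 x2 x3 y2 y1 y3"
    using c unfolding critical_def
    by (simp only: quadric_perm(3)[of _ _ _ y2 y1] quartic_perm(3)[of _ _ _ y2 y1] quartic_dx_perm(1)[of y3 y2 y1]
        quartic_dx_perm(2)[of _ _ _ y2 y1] add.commute[of y2 y1] simp_thms)
  show "critical m x1 x2 x3 y1 y3 y2"
    using c unfolding critical_def
    by (simp only: quadric_perm(4)[of _ _ _ y1 y3 y2] quartic_perm(4)[of _ _ _ y1 y3 y2] quartic_dx_perm(1)[of y1 y3 y2]
        quartic_dx_perm(3)[of _ _ _ y1 y3 y2] add.commute[of y3 y2] simp_thms)
qed

lemma critical_swap:
  assumes "critical m x1 x2 x3 y1 y2 y3"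
  shows "critical (- m) y1 y2 y3 x1 x2 x3"
  using assms unfolding critical_def quadric_perm(5)[of y1] quartic_perm(5)[of y1] by simp

text \<open>With \<open>s\<^sub>1\<close> and \<open>q = s\<^sub>2 = t\<^sub>2\<close> fixed, \<open>x\<^sub>2 + x\<^sub>3 = s\<^sub>1 - x\<^sub>1\<close> and
  \<open>x\<^sub>2 x\<^sub>3 = q - x\<^sub>1 (s\<^sub>1 - x\<^sub>1)\<close>. So the derivative with respect to \<open>x\<^sub>1\<close> is
  quadratic in \<open>x\<^sub>1\<close> with coefficients that do not distinguish the three coordinates.\<close>

lemma critical_quadratic:
  assumes "critical m x1 x2 x3 y1 y2 y3" "x \<in> {x1, x2, x3}"
  defines "s1 \<equiv> x1 + x2 + x3" and "t1 \<equiv> y1 + y2 + y3"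
    and "q \<equiv> y1 * y2 + y1 * y3 + y2 * y3" and "t3 \<equiv> y1 * y2 * y3"
  shows "9 * t1 * x ^ 2 - (m - 12 * q + 10 * s1 * t1) * x
     + (11 * q * t1 + 9 * t3 + (m - 12 * q + s1 * t1) * s1) = 0" (is "?P x = 0")
proof -
  have "?P x1 = m * (x2 + x3) + quartic_dx x1 x2 x3 y1 y2 y3 - 10 * t1 * quadric x1 x2 x3 y1 y2 y3"
    "?P x2 = m * (x1 + x3) + quartic_dx x2 x1 x3 y1 y2 y3 - 10 * t1 * quadric x1 x2 x3 y1 y2 y3"
    "?P x3 = m * (x1 + x2) + quartic_dx x3 x1 x2 y1 y2 y3 - 10 * t1 * quadric x1 x2 x3 y1 y2 y3"
    unfolding quartic_dx_def quadric_def Let_def s1_def t1_def t3_def q_def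
    by (simp_all add: algebra_simps power2_eq_square)
  then have "?P x1 = 0 \<and> ?P x2 = 0 \<and> ?P x3 = 0" using assms(1) by (simp add: critical_def)
  then show ?thesis using assms(2) by blast
qed

text \<open>A quadratic polynomial has at most two roots.\<close>

lemma critical_coincidence:
  assumes "critical m x1 x2 x3 y1 y2 y3" "y1 + y2 + y3 \<noteq> 0"
  shows "x1 = x2 \<or> x1 = x3 \<or> x2 = x3"
proof (rule ccontr)
  assume neq: "\<not> ?thesis"
  define k where "k = m - 12 * (y1 * y2 + y1 * y3 + y2 * y3) + 10 * (x1 + x2 + x3) * (y1 + y2 + y3)"
  define t where "t = y1 + y2 + y3"
  define e where "e = 11 * (y1 * y2 + y1 * y3 + y2 * y3) * t + 9 * (y1 * y2 * y3)
    + (m - 12 * (y1 * y2 + y1 * y3 + y2 * y3) + (x1 + x2 + x3) * t) * (x1 + x2 + x3)"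
  have quad: "9 * t * x ^ 2 - k * x + e = 0" if "x \<in> {x1, x2, x3}" for x
    using critical_quadratic[OF assms(1) that] unfolding k_def t_def e_def .
  have eqs: "9 * t * x1 ^ 2 - k * x1 + e = 0" "9 * t * x2 ^ 2 - k * x2 + e = 0"
    "9 * t * x3 ^ 2 - k * x3 + e = 0"
    by (rule quad; simp)+
  have "(x1 - x2) * (9 * t * (x1 + x2) - k) = (9 * t * x1 ^ 2 - k * x1 + e) - (9 * t * x2 ^ 2 - k * x2 + e)"
    "(x1 - x3) * (9 * t * (x1 + x3) - k) = (9 * t * x1 ^ 2 - k * x1 + e) - (9 * t * x3 ^ 2 - k * x3 + e)"
    by (simp_all add: algebra_simps power2_eq_square)
  then have "(x1 - x2) * (9 * t * (x1 + x2) - k) = 0" "(x1 - x3) * (9 * t * (x1 + x3) - k) = 0"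
    by (simp_all only: eqs) simp_all
  then have "9 * t * (x1 + x2) - k = 0" "9 * t * (x1 + x3) - k = 0"
    using neq by simp_all
  then have "9 * t * (x2 - x3) = 0" by algebra
  moreover have "t \<noteq> 0" using assms(2) by (simp only: t_def not_False_eq_True)
  ultimately show False using neq by simp
qed

text \<open>Here \<open>F = 0\<close> reduces to \<open>q\<^sup>2 = 0\<close>, and the derivatives become linear in each coordinate.\<close>

lemma critical_both_zero:
  assumes crit: "critical m x1 x2 x3 y1 y2 y3" and s: "x1 + x2 + x3 = 0" and t: "y1 + y2 + y3 = 0"
  shows "x1 = 0"
proof -
  define q where "q = y1 * y2 + y1 * y3 + y2 * y3"
  have q': "x1 * x2 + x1 * x3 + x2 * x3 = q"
    using crit by (simp add: critical_def quadric_def q_def)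
  have "quartic x1 x2 x3 y1 y2 y3 = 0" using crit by (simp add: critical_def)
  then have "q * q = 0" unfolding quartic_def Let_def s t q' q_def[symmetric] by simp
  then have q0: "q = 0" by simp
  have X: "m * x = 9 * (y1 * y2 * y3)" if "x \<in> {x1, x2, x3}" for x
    using critical_quadratic[OF crit that] unfolding s t q_def[symmetric] q0 by (simp add: algebra_simps)
  have Y: "m * y = - 9 * (x1 * x2 * x3)" if "y \<in> {y1, y2, y3}" for y
    using critical_quadratic[OF critical_swap[OF crit] that] unfolding s t q' q0
    by (simp add: algebra_simps eq_neg_iff_add_eq_0)
  have Xs: "m * x1 = 9 * (y1 * y2 * y3)" "m * x2 = 9 * (y1 * y2 * y3)" "m * x3 = 9 * (y1 * y2 * y3)"
    by (rule X; simp)+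
  have Ys: "m * y1 = - 9 * (x1 * x2 * x3)" by (rule Y; simp)
  show ?thesis
  proof (cases "m = 0")
    case True
    with Ys have "x1 * x2 * x3 = 0" by simp
    moreover have "x1 ^ 3 = x1 ^ 2 * (x1 + x2 + x3) - x1 * (x1 * x2 + x1 * x3 + x2 * x3) + x1 * x2 * x3"
      by (simp add: algebra_simps power2_eq_square power3_eq_cube)
    ultimately have "x1 ^ 3 = 0" by (simp add: s q' q0)
    then show ?thesis by simp
  next
    case False
    have "m * x1 = m * x2" "m * x1 = m * x3" by (simp_all only: Xs)
    with False have "x1 = x2" "x1 = x3" by simp_all
    with s show ?thesis by simp
  qed
qed

text \<open>The coinciding coordinates are put in the first two places, so that \<open>x = (a, a, - 2 a)\<close> and
  \<open>q = - 3 a\<^sup>2\<close>. The equation \<open>F = 0\<close> then leaves \<open>a = 0\<close> or \<open>t\<^sub>1 = - 6 a\<close>; in the second case all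
  \<open>y\<^sub>j\<close> are equal, which contradicts the value of \<open>q\<close>. In the first case \<open>y\<close> is a multiple of a
  coordinate vector.\<close>

lemma critical_one_zero_aux:
  assumes crit: "critical m a a x3 y1 y2 y3" and s: "a + a + x3 = 0" and t: "y1 + y2 + y3 \<noteq> 0"
  shows "a = 0 \<and> x3 = 0 \<and> y1 * y2 = 0 \<and> y1 * y3 = 0 \<and> y2 * y3 = 0"
proof -
  define q where "q = y1 * y2 + y1 * y3 + y2 * y3"
  define t1 where "t1 = y1 + y2 + y3"
  have "x3 = (a + a + x3) - 2 * a" by simp
  then have x3: "x3 = - 2 * a" unfolding s by simp
  have q': "q = - 3 * a ^ 2"
    using crit unfolding x3 by (simp add: critical_def quadric_def q_def power2_eq_square algebra_simps)
  have "quartic a a x3 y1 y2 y3 = - 18 * a ^ 3 * t1 + 36 * a ^ 2 * q"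
    unfolding quartic_def Let_def t1_def q_def x3
    by (simp add: algebra_simps power2_eq_square power3_eq_cube)
  also have "\<dots> = - 18 * (a ^ 3 * (t1 + 6 * a))"
    unfolding q' by (simp add: algebra_simps power2_eq_square power3_eq_cube)
  finally have F: "a ^ 3 * (t1 + 6 * a) = 0"
    using crit by (simp add: critical_def)
  have Y: "9 * (a * a * x3) + (- m - 12 * q) * (t1 - y) = 0" if "y \<in> {y1, y2, y3}" for y
  proof -
    have "a * a + a * x3 + a * x3 = q"
      by (simp add: x3 q' power2_eq_square algebra_simps)
    from critical_quadratic[OF critical_swap[OF crit] that] show ?thesis
      unfolding \<open>a * a + a * x3 + a * x3 = q\<close> s t1_def by (simp add: algebra_simps)
  qed
  have Ys: "9 * (a * a * x3) + (- m - 12 * q) * (t1 - y1) = 0"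
    "9 * (a * a * x3) + (- m - 12 * q) * (t1 - y2) = 0"
    "9 * (a * a * x3) + (- m - 12 * q) * (t1 - y3) = 0"
    by (rule Y; simp)+
  have a0: "a = 0"
  proof (rule ccontr)
    assume a: "a \<noteq> 0"
    with F have "t1 + 6 * a = 0" by simp
    then have t1: "t1 = - 6 * a" using eq_neg_iff_add_eq_0[of t1 "6 * a"] by simp
    have nz: "- m - 12 * q \<noteq> 0"
    proof
      assume "- m - 12 * q = 0"
      with Ys(1) a x3 show False by simp
    qed
    from Ys have "(- m - 12 * q) * (t1 - y1) = (- m - 12 * q) * (t1 - y2)"
      "(- m - 12 * q) * (t1 - y1) = (- m - 12 * q) * (t1 - y3)"
      by (simp_all only: add_left_cancel add_eq_0_iff)
    with nz have y: "y2 = y1" "y3 = y1" by simp_all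
    with t1 have y1: "y1 = - 2 * a" by (simp add: t1_def)
    have "15 * a ^ 2 = 0" using q' unfolding q_def y y1
      by (simp add: power2_eq_square algebra_simps)
    with a show False by simp
  qed
  then have q0: "q = 0" using q' by simp
  have "- m * (t1 - y) = 0" if "y \<in> {y1, y2, y3}" for y
    using Y[OF that] by (simp add: a0 q0)
  then have z: "- m * (t1 - y1) = 0" "- m * (t1 - y2) = 0" "- m * (t1 - y3) = 0"
    by blast+
  have "- 2 * m * t1 = - m * (t1 - y1) + - m * (t1 - y2) + - m * (t1 - y3)"
    by (simp add: t1_def algebra_simps)
  then have "- 2 * m * t1 = 0" unfolding z by simp
  moreover have "t1 \<noteq> 0" using t by (simp only: t1_def not_False_eq_True)
  ultimately have m: "m = 0" by simp
  have "a \<in> {a, a, x3}" by simp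
  from critical_quadratic[OF crit this] have "y1 * y2 * y3 = 0"
    by (simp add: a0 m x3 q0 flip: q_def)
  with q0 have "y1 * y2 = 0 \<and> y1 * y3 = 0 \<and> y2 * y3 = 0" unfolding q_def by auto
  with a0 x3 show ?thesis by simp
qed

lemma critical_one_zero:
  assumes crit: "critical m x1 x2 x3 y1 y2 y3" and s: "x1 + x2 + x3 = 0" and t: "y1 + y2 + y3 \<noteq> 0"
  shows "x1 = 0 \<and> x2 = 0 \<and> x3 = 0 \<and> y1 * y2 = 0 \<and> y1 * y3 = 0 \<and> y2 * y3 = 0"
  using critical_coincidence[OF crit t]
proof (elim disjE)
  assume eq: "x1 = x2"
  have "critical m x2 x2 x3 y1 y2 y3" "x2 + x2 + x3 = 0" using crit s unfolding eq .
  from critical_one_zero_aux[OF this t] eq show ?thesis by simp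
next
  assume eq: "x1 = x3"
  have "critical m x3 x3 x2 y1 y2 y3"
    using critical_perm(2)[OF crit] unfolding eq .
  moreover have "x3 + x3 + x2 = 0" using s unfolding eq by (simp add: ac_simps)
  ultimately show ?thesis using critical_one_zero_aux[of m x3 x2 y1 y2 y3] t eq by simp
next
  assume eq: "x2 = x3"
  have "critical m x3 x3 x1 y1 y2 y3"
    using critical_perm(2)[OF critical_perm(1)[OF crit]] unfolding eq .
  moreover have "x3 + x3 + x1 = 0" using s unfolding eq by (simp add: ac_simps)
  ultimately show ?thesis using critical_one_zero_aux[of m x3 x1 y1 y2 y3] t eq by simp
qed

text \<open>The quadratic polynomial of which \<open>a\<close> and \<open>b\<close> are the two roots: the sum of the roots
  determines the multiplier, and the multiplier can then be eliminated from the equation for \<open>a\<close>.\<close>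

lemma critical_pair_relations:
  assumes crit: "critical m a a b y1 y2 y3" and ab: "a \<noteq> b"
  defines "s1 \<equiv> 2 * a + b" and "t1 \<equiv> y1 + y2 + y3" and "q \<equiv> a * (a + 2 * b)"
  shows "m - 12 * q + 10 * s1 * t1 = 9 * t1 * (a + b)"
    and "t1 * (a * (7 * a - 4 * b)) = 9 * (y1 * y2 * y3)"
proof -
  define k where "k = m - 12 * q + 10 * s1 * t1"
  have q: "y1 * y2 + y1 * y3 + y2 * y3 = q"
    using crit by (simp add: critical_def quadric_def q_def algebra_simps)
  have s1: "a + a + b = s1" by (simp add: s1_def)
  have P: "9 * t1 * x ^ 2 - k * x + (11 * q * t1 + 9 * (y1 * y2 * y3) + (k - 9 * s1 * t1) * s1) = 0"
    if "x \<in> {a, a, b}" for x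
    using critical_quadratic[OF crit that] unfolding q s1 t1_def[symmetric] k_def
    by (simp add: algebra_simps)
  have Pa: "9 * t1 * a ^ 2 - k * a + (11 * q * t1 + 9 * (y1 * y2 * y3) + (k - 9 * s1 * t1) * s1) = 0"
    and Pb: "9 * t1 * b ^ 2 - k * b + (11 * q * t1 + 9 * (y1 * y2 * y3) + (k - 9 * s1 * t1) * s1) = 0"
    by (rule P; simp)+
  have "(a - b) * (9 * t1 * (a + b) - k) = 0"
    using Pa Pb by algebra
  with ab have k: "k = 9 * t1 * (a + b)" by simp
  then show "m - 12 * q + 10 * s1 * t1 = 9 * t1 * (a + b)" by (simp only: k_def)
  have "9 * (y1 * y2 * y3) - t1 * (a * (7 * a - 4 * b)) = 0"
    using Pa unfolding k s1_def q_def by (simp add: algebra_simps power2_eq_square)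
  then show "t1 * (a * (7 * a - 4 * b)) = 9 * (y1 * y2 * y3)" by simp
qed

text \<open>Eliminating \<open>b\<close> from \<open>Q = F = 0\<close> gives \<open>(a - c)\<^sup>3 (a + 3 c) = 0\<close>. The simple root belongs to the point
  \<open>[-3 : -3 : 1 : 1 : 1 : 1]\<close>, which lies on the threefold but is a smooth point of it.\<close>

lemma critical_pair_triple:
  assumes crit: "critical m a a b c c c" and c: "c \<noteq> 0"
  shows "a = b"
proof (rule ccontr)
  assume ab: "a \<noteq> b"
  have q: "2 * a * b = 3 * c ^ 2 - a ^ 2"
    using crit by (simp add: critical_def quadric_def algebra_simps power2_eq_square)
  have "quartic a a b c c c = 27 * c * (c ^ 2 * (2 * a + b) + a ^ 2 * b - 4 * c ^ 3)
      + (3 * c * (2 * a + b) - 36 * c ^ 2) * (a * a + 2 * a * b - 3 * c ^ 2)"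
    unfolding quartic_def Let_def by (simp add: algebra_simps power2_eq_square power3_eq_cube)
  also have "a * a + 2 * a * b - 3 * c ^ 2 = 0" using q by (simp add: power2_eq_square)
  finally have "c ^ 2 * (2 * a + b) + a ^ 2 * b - 4 * c ^ 3 = 0"
    using crit c by (simp add: critical_def)
  then have "2 * a * (c ^ 2 * (2 * a + b) + a ^ 2 * b - 4 * c ^ 3) = 0" by simp
  also have "2 * a * (c ^ 2 * (2 * a + b) + a ^ 2 * b - 4 * c ^ 3) =
      c ^ 2 * (4 * a ^ 2 + 2 * a * b) + a ^ 2 * (2 * a * b) - 8 * a * c ^ 3"
    by (simp add: algebra_simps power2_eq_square power3_eq_cube)
  also have "\<dots> = - ((a - c) ^ 3 * (a + 3 * c))"
    unfolding q by (simp add: algebra_simps power2_eq_square power3_eq_cube)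
  finally have "a = c \<or> a = - 3 * c" by (auto simp: eq_neg_iff_add_eq_0)
  then show False
  proof
    assume "a = c"
    with q c have "b = c" by (simp add: power2_eq_square)
    with \<open>a = c\<close> ab show False by simp
  next
    assume a: "a = - 3 * c"
    have "- 6 * c * b = - 6 * c * c" using q unfolding a by (simp add: power2_eq_square algebra_simps)
    with c have b: "b = c" by simp
    have "(c + c + c) * (a * (7 * a - 4 * b)) = 9 * (c * c * c)"
      by (rule critical_pair_relations(2)[OF crit ab])
    then have "c * c * c = 0" unfolding a b by (simp add: algebra_simps)
    with c show False by simp
  qed
qed

text \<open>The four relations have no common zero with \<open>a \<noteq> b\<close>, \<open>c \<noteq> d\<close> and \<open>c \<noteq> 0\<close>. The identity in the proof
  exhibits \<open>7992 (a - b) (c - d) c\<^sup>3\<close> as a combination of them.\<close>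

lemma pair_pair_certificate:
  fixes a b c d :: complex
  assumes "(2 * c + d) * (a * (7 * a - 4 * b)) - 9 * (c * c * d) = 0" (is "?E1 = 0")
    and "(2 * a + b) * (c * (7 * c - 4 * d)) - 9 * (a * a * b) = 0" (is "?E2 = 0")
    and "a * (a + 2 * b) - c * (c + 2 * d) = 0" (is "?E3 = 0")
    and "9 * (2 * c + d) * (a + b) + 9 * (2 * a + b) * (c + d) + 24 * (a * (a + 2 * b))
      - 20 * (2 * a + b) * (2 * c + d) = 0" (is "?E4 = 0")
  shows "(a - b) * (c - d) * c ^ 3 = 0"
proof -
  have "7992 * ((a - b) * (c - d) * c ^ 3) =
    (2082*c*d + 1041*c^2 + 22*b*d - 3883*b*c + 570*b^2 + 44*a*d - 1826*a*c + 1608*a*b) * ?E1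
    + (- 66*d^2 - 363*c*d - 462*c^2 - 418*b*d - 1862*b*c + 1114*a*d + 1715*a*c) * ?E2
    + (- 9369*c^2*d + 44*b*d^2 - 382*b*c*d + 12740*b*c^2 + 1140*b^2*d + 2280*b^2*c - 308*a*d^2
       - 2186*a*c*d + 12556*a*c^2 - 1230*a*b*d - 7077*a*b*c) * ?E3
    + (88*c*d^2 + 184*c^2*d - 614*c^3 - 304*b*c*d - 1178*b*c^2 + 598*a*c*d + 542*a*c^2) * ?E4"
    by (simp add: algebra_simps power2_eq_square power3_eq_cube)
  then have "7992 * ((a - b) * (c - d) * c ^ 3) = 0" by (simp only: assms) simp
  then show ?thesis by simp
qed

text \<open>If both blocks contain two different values, adding the two expressions for the multiplier
  (which enters the two blocks with opposite signs) eliminates it and gives the last relation that the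
  certificate needs.\<close>

lemma critical_two_pairs:
  assumes crit: "critical m a a b c c d" and s: "2 * a + b \<noteq> 0" and t: "2 * c + d \<noteq> 0"
  shows "a = b \<and> b = c \<and> c = d"
proof -
  have q: "a * (a + 2 * b) = c * (c + 2 * d)"
    using crit by (simp add: critical_def quadric_def algebra_simps)
  have swap: "critical (- m) c c d a a b" by (rule critical_swap[OF crit])
  show ?thesis
  proof (cases "a = b \<or> c = d")
    case True
    then have "a = b \<and> c = d"
    proof
      assume ab: "a = b"
      with s have "b \<noteq> 0" by auto
      moreover have "critical (- m) c c d b b b" using swap unfolding ab .
      ultimately show ?thesis using critical_pair_triple ab by blast
    next
      assume cd: "c = d"
      with t have "d \<noteq> 0" by auto
      moreover have "critical m a a b d d d" using crit unfolding cd .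
      ultimately show ?thesis using critical_pair_triple cd by blast
    qed
    then have eq: "b = a" "d = c" by simp_all
    have "(a - c) * (a + c) = 0" using q unfolding eq by (simp add: algebra_simps)
    then have "a = c \<or> c = - a" by (simp add: add_eq_0_iff)
    moreover have False if "c = - a"
    proof -
      have "quartic a a a (- a) (- a) (- a) = - 216 * a ^ 4"
        unfolding quartic_def Let_def by (simp add: algebra_simps power4_eq_xxxx)
      with crit s show False unfolding eq that critical_def by simp
    qed
    ultimately show ?thesis using eq by auto
  next
    case False
    then have ab: "a \<noteq> b" and cd: "c \<noteq> d" by auto
    have st: "c + c + d = 2 * c + d" "a + a + b = 2 * a + b" by simp_all
    note X = critical_pair_relations[OF crit ab, unfolded st]
    note Y = critical_pair_relations[OF swap cd, unfolded st]
    have "9 * (2 * c + d) * (a + b) + 9 * (2 * a + b) * (c + d) =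
       (m - 12 * (a * (a + 2 * b)) + 10 * (2 * a + b) * (2 * c + d))
       + (- m - 12 * (c * (c + 2 * d)) + 10 * (2 * c + d) * (2 * a + b))"
      by (simp only: X(1) Y(1))
    then have E4: "9 * (2 * c + d) * (a + b) + 9 * (2 * a + b) * (c + d) + 24 * (a * (a + 2 * b))
      - 20 * (2 * a + b) * (2 * c + d) = 0"
      unfolding q[symmetric] by (simp add: algebra_simps)
    have "(a - b) * (c - d) * c ^ 3 = 0"
      by (rule pair_pair_certificate[OF _ _ _ E4]) (simp_all only: X(2) Y(2) q, simp_all)
    with ab cd have c: "c = 0" by simp
    have "a * a * b = 0" using Y(2) c by simp
    moreover have "a * (a + 2 * b) = 0" using q c by simp
    ultimately have "a = 0" by auto
    then have "b * d = 0" using E4 c by simp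
    with s t \<open>a = 0\<close> c show ?thesis by simp
  qed
qed

lemma critical_classification:
  assumes crit: "critical m x1 x2 x3 y1 y2 y3"
  shows "x1 = x2 \<and> x2 = x3 \<and> x3 = y1 \<and> y1 = y2 \<and> y2 = y3 \<or>
    x1 = 0 \<and> x2 = 0 \<and> x3 = 0 \<and> y1 * y2 = 0 \<and> y1 * y3 = 0 \<and> y2 * y3 = 0 \<or>
    y1 = 0 \<and> y2 = 0 \<and> y3 = 0 \<and> x1 * x2 = 0 \<and> x1 * x3 = 0 \<and> x2 * x3 = 0"
proof -
  consider "x1 + x2 + x3 = 0" "y1 + y2 + y3 = 0" | "x1 + x2 + x3 = 0" "y1 + y2 + y3 \<noteq> 0"
    | "x1 + x2 + x3 \<noteq> 0" "y1 + y2 + y3 = 0" | "x1 + x2 + x3 \<noteq> 0" "y1 + y2 + y3 \<noteq> 0" by blast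
  then show ?thesis
  proof cases
    case 1
    have "x1 = 0" by (rule critical_both_zero[OF crit 1])
    moreover have "x2 = 0"
      by (rule critical_both_zero[OF critical_perm(1)[OF crit]]) (use 1 in \<open>simp_all add: ac_simps\<close>)
    moreover have "y1 = 0" by (rule critical_both_zero[OF critical_swap[OF crit] 1(2) 1(1)])
    moreover have "y2 = 0"
      by (rule critical_both_zero[OF critical_swap[OF critical_perm(3)[OF crit]]])
        (use 1 in \<open>simp_all add: ac_simps\<close>)
    ultimately show ?thesis using 1 by simp
  next
    case 2
    then show ?thesis using critical_one_zero[OF crit] by blast
  next
    case 3
    then show ?thesis using critical_one_zero[OF critical_swap[OF crit]] by blast
  next
    case 4
    \<comment> \<open>Sort the coordinates so that a coincidence occurs in the first two places of each block.\<close>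
    have "\<exists>a b. critical m a a b y1 y2 y3 \<and> {x1, x2, x3} = {a, b} \<and> 2 * a + b \<noteq> 0"
      using critical_coincidence[OF crit 4(2)]
    proof (elim disjE)
      assume eq: "x1 = x2"
      have "critical m x2 x2 x3 y1 y2 y3" using crit unfolding eq .
      then show ?thesis using 4(1) eq by (intro exI[of _ x2] exI[of _ x3]) auto
    next
      assume eq: "x1 = x3"
      have "critical m x3 x3 x2 y1 y2 y3" using critical_perm(2)[OF crit] unfolding eq .
      then show ?thesis using 4(1) eq by (intro exI[of _ x3] exI[of _ x2]) (auto simp: ac_simps)
    next
      assume eq: "x2 = x3"
      have "critical m x3 x3 x1 y1 y2 y3"
        using critical_perm(2)[OF critical_perm(1)[OF crit]] unfolding eq .
      then show ?thesis using 4(1) eq by (intro exI[of _ x3] exI[of _ x1]) (auto simp: ac_simps)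
    qed
    then obtain a b where ab: "critical m a a b y1 y2 y3" "{x1, x2, x3} = {a, b}" "2 * a + b \<noteq> 0"
      by blast
    have "\<exists>c d. critical m a a b c c d \<and> {y1, y2, y3} = {c, d} \<and> 2 * c + d \<noteq> 0"
      using critical_coincidence[OF critical_swap[OF crit] 4(1)]
    proof (elim disjE)
      assume eq: "y1 = y2"
      have "critical m a a b y2 y2 y3" using ab(1) unfolding eq .
      then show ?thesis using 4(2) eq by (intro exI[of _ y2] exI[of _ y3]) auto
    next
      assume eq: "y1 = y3"
      have "critical m a a b y3 y3 y2" using critical_perm(4)[OF ab(1)] unfolding eq .
      then show ?thesis using 4(2) eq by (intro exI[of _ y3] exI[of _ y2]) (auto simp: ac_simps)
    next
      assume eq: "y2 = y3"
      have "critical m a a b y3 y3 y1"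
        using critical_perm(4)[OF critical_perm(3)[OF ab(1)]] unfolding eq .
      then show ?thesis using 4(2) eq by (intro exI[of _ y3] exI[of _ y1]) (auto simp: ac_simps)
    qed
    then obtain c d where cd: "critical m a a b c c d" "{y1, y2, y3} = {c, d}" "2 * c + d \<noteq> 0"
      by blast
    have "a = b \<and> b = c \<and> c = d" by (rule critical_two_pairs[OF cd(1) ab(3) cd(3)])
    then have "{x1, x2, x3} = {a}" "{y1, y2, y3} = {a}" using ab(2) cd(2) by simp_all
    then show ?thesis by auto
  qed
qed

section \<open>Tangent spaces\<close>

text \<open>The gradients enter the definition of singular points only through the dimension of their common
  kernel; this lemma and the next say that it detects linear dependence.\<close>

lemma common_kernel_dim_ge:
  fixes u w :: "complex ^ 'n"
  assumes "(m, n) \<noteq> (0, 0)" "\<And>i. m * u $ i + n * w $ i = 0"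
  shows "CARD('n) \<le> vec.dim {v. (\<Sum>i\<in>UNIV. u $ i * v $ i) = 0 \<and> (\<Sum>i\<in>UNIV. w $ i * v $ i) = 0} + 1"
proof -
  let ?T = "{v. (\<Sum>i\<in>UNIV. u $ i * v $ i) = 0 \<and> (\<Sum>i\<in>UNIV. w $ i * v $ i) = 0}"
  have "\<exists>z :: complex ^ 'n. \<forall>v. (\<Sum>i\<in>UNIV. z $ i * v $ i) = 0 \<longrightarrow> v \<in> ?T"
  proof (cases "m = 0")
    case True
    with assms have "w $ i = 0" for i by (metis add_0 mult_eq_0_iff mult_zero_left)
    then show ?thesis by (intro exI[of _ u]) simp
  next
    case False
    have "u $ i = - n / m * w $ i" for i
      using assms(2)[of i] False by (simp add: field_simps eq_neg_iff_add_eq_0)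
    then have "(\<Sum>i\<in>UNIV. u $ i * v $ i) = - n / m * (\<Sum>i\<in>UNIV. w $ i * v $ i)" for v
      by (simp only: sum_distrib_left mult.assoc)
    then show ?thesis by (intro exI[of _ w]) simp
  qed
  then obtain z :: "complex ^ 'n" where z: "\<And>v. (\<Sum>i\<in>UNIV. z $ i * v $ i) = 0 \<Longrightarrow> v \<in> ?T" by blast
  let ?d = "\<lambda>v. \<Sum>i\<in>UNIV. z $ i * v $ i"
  show ?thesis
  proof (cases "\<exists>x. ?d x \<noteq> 0")
    case False
    then have "?T = UNIV" using z by blast
    then have "vec.dim ?T = CARD('n)" by (simp only: vec_dim_card)
    then show ?thesis by simp
  next
    case True
    then obtain x where x: "?d x \<noteq> 0" by blast
    have "v \<in> vec.span (insert x ?T)" for v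
    proof -
      define t where "t = v - (?d v / ?d x) *s x"
      have "?d (v - r *s x) = ?d v - r * ?d x" for r
        by (simp add: algebra_simps sum_subtractf sum_distrib_left)
      then have "?d t = ?d v - (?d v / ?d x) * ?d x" unfolding t_def .
      then have "?d t = 0" using x by simp
      then have "t \<in> vec.span (insert x ?T)" using z by (blast intro: vec.span_base)
      moreover have "x \<in> vec.span (insert x ?T)" by (blast intro: vec.span_base)
      ultimately have "t + (?d v / ?d x) *s x \<in> vec.span (insert x ?T)"
        by (intro vec.span_add vec.span_scale)
      then show ?thesis by (simp add: t_def)
    qed
    then have "vec.span (insert x ?T) = UNIV" by blast
    then have "CARD('n) = vec.dim (insert x ?T)"
      using vec_dim_card[where 'a = complex and 'n = 'n] vec.dim_span[of "insert x ?T"] by simp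
    also have "\<dots> \<le> vec.dim ?T + 1" by (simp add: vec.dim_insert)
    finally show ?thesis .
  qed
qed

lemma common_kernel_dim_le:
  fixes u w :: "complex ^ 'n"
  assumes indep: "\<And>m n. (\<And>i. m * u $ i + n * w $ i = 0) \<Longrightarrow> m = 0 \<and> n = 0"
  shows "vec.dim {v. (\<Sum>i\<in>UNIV. u $ i * v $ i) = 0 \<and> (\<Sum>i\<in>UNIV. w $ i * v $ i) = 0} + 2 \<le> CARD('n)"
proof -
  let ?T = "{v. (\<Sum>i\<in>UNIV. u $ i * v $ i) = 0 \<and> (\<Sum>i\<in>UNIV. w $ i * v $ i) = 0}"
  let ?u = "\<lambda>v. \<Sum>i\<in>UNIV. u $ i * v $ i" and ?w = "\<lambda>v. \<Sum>i\<in>UNIV. w $ i * v $ i"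
  obtain i where i: "u $ i \<noteq> 0" using indep[of 1 0] by auto
  obtain j where j: "w $ i * u $ j + - u $ i * w $ j \<noteq> 0"
    using indep[of "w $ i" "- u $ i"] i by (metis neg_equal_0_iff_equal)
  define D where "D = u $ i * w $ j - w $ i * u $ j"
  have D: "D \<noteq> 0" using j by (auto simp: D_def algebra_simps)
  define e where "e a b = axis i a + axis j (b::complex)" for a b
  have ax: "(\<Sum>k\<in>UNIV. f k * (if k = i then c else 0)) = f i * c" for f :: "'n \<Rightarrow> complex" and c i
    by (simp add: if_distrib cong: if_cong)
  have ue: "?u (e a b) = u $ i * a + u $ j * b" "?w (e a b) = w $ i * a + w $ j * b" for a b
    by (simp_all add: e_def axis_def distrib_left sum.distrib ax)
  \<comment> \<open>By Cramer's rule for the minor \<open>D\<close>, these vectors are dual to \<open>u\<close> and \<open>w\<close> up to the factor \<open>D\<close>.\<close>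
  define x where "x = e (w $ j) (- w $ i)"
  define y where "y = e (- u $ j) (u $ i)"
  have x: "?u x = D" "?w x = 0" and y: "?u y = 0" "?w y = D"
    by (simp_all add: x_def y_def ue D_def algebra_simps)
  have lin: "?u (a *s v + b *s v') = a * ?u v + b * ?u v'" "?w (a *s v + b *s v') = a * ?w v + b * ?w v'" for a b v v'
    by (simp_all add: algebra_simps sum.distrib sum_distrib_left)
  have sub: "vec.subspace ?T"
    using lin[of 1 _ 1] lin[of _ _ 0 0] by (auto simp: vec.subspace_def)
  have xT: "x \<notin> vec.span ?T" unfolding vec.span_eq_iff[THEN iffD2, OF sub] using x D by simp
  have yT: "y \<notin> vec.span (insert x ?T)"
  proof
    assume "y \<in> vec.span (insert x ?T)"
    then obtain k where "y - k *s x \<in> vec.span ?T" using vec.span_breakdown_eq by blast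
    then have "1 *s y + (- k) *s x \<in> ?T" unfolding vec.span_eq_iff[THEN iffD2, OF sub] by simp
    then have "?w (1 *s y + (- k) *s x) = 0" by blast
    then show False unfolding lin x y using D by simp
  qed
  have "vec.dim ?T + 2 = vec.dim (insert y (insert x ?T))"
    using xT yT by (simp add: vec.dim_insert)
  also have "\<dots> \<le> CARD('n)" by (rule dim_subset_UNIV_cart_gen)
  finally show ?thesis .
qed

lemma tangent_space_pair:
  assumes "poly_eval f p = 0" "poly_eval g p = 0"
  shows "tangent_space (ideal_gen {f, g}) p =
    {v. (\<Sum>i\<in>UNIV. poly_eval (pdiff i f) p * v $ i) = 0 \<and> (\<Sum>i\<in>UNIV. poly_eval (pdiff i g) p * v $ i) = 0}"
proof -
  have "(\<Sum>i\<in>UNIV. poly_eval (pdiff i (a * f + b * g)) p * v $ i) =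
      poly_eval a p * (\<Sum>i\<in>UNIV. poly_eval (pdiff i f) p * v $ i)
      + poly_eval b p * (\<Sum>i\<in>UNIV. poly_eval (pdiff i g) p * v $ i)" for a b v
    by (simp add: pdiff_simps poly_eval_simps assms sum_distrib_left sum.distrib[symmetric] algebra_simps)
  moreover have "f \<in> ideal_gen {f, g}" "g \<in> ideal_gen {f, g}" by (simp_all add: ideal_gen_base)
  moreover have "h \<in> ideal_gen {f, g} \<longleftrightarrow> (\<exists>a b. h = a * f + b * g)" for h
    by (auto simp: ideal_gen_pair)
  ultimately show ?thesis
    unfolding tangent_space_def by (intro Collect_cong iffI) (blast, force)
qed

lemma cone_points_pair:
  "p \<in> cone_points (ideal_gen {f, g}) \<longleftrightarrow> p \<noteq> 0 \<and> poly_eval f p = 0 \<and> poly_eval g p = 0"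
proof -
  have "f \<in> ideal_gen {f, g}" "g \<in> ideal_gen {f, g}" by (simp_all add: ideal_gen_base)
  moreover have "h \<in> ideal_gen {f, g} \<longleftrightarrow> (\<exists>a b. h = a * f + b * g)" for h
    by (auto simp: ideal_gen_pair)
  ultimately show ?thesis
    unfolding cone_points_def by (auto simp: poly_eval_simps)
qed

text \<open>The Jacobian criterion: the tangent space is the common kernel of the two gradients, and
  its dimension exceeds the expected one exactly if they are linearly dependent.\<close>

lemma singular_at_pair:
  fixes p :: "complex ^ 'n"
  assumes "proj_dim (ideal_gen {f, g}) = int CARD('n) - 3"
  shows "singular_at (ideal_gen {f, g}) p \<longleftrightarrow>
    p \<noteq> 0 \<and> poly_eval f p = 0 \<and> poly_eval g p = 0 \<and>
    (\<exists>m n. (m, n) \<noteq> (0, 0) \<and> (\<forall>i. m * poly_eval (pdiff i f) p + n * poly_eval (pdiff i g) p = 0))"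
proof (cases "p \<noteq> 0 \<and> poly_eval f p = 0 \<and> poly_eval g p = 0")
  case True
  define u w where "u = (\<chi> i. poly_eval (pdiff i f) p)" and "w = (\<chi> i. poly_eval (pdiff i g) p)"
  have T: "tangent_space (ideal_gen {f, g}) p =
    {v. (\<Sum>i\<in>UNIV. u $ i * v $ i) = 0 \<and> (\<Sum>i\<in>UNIV. w $ i * v $ i) = 0}"
    using tangent_space_pair[of f p g] True by (simp add: u_def w_def)
  have "singular_at (ideal_gen {f, g}) p \<longleftrightarrow>
      CARD('n) < vec.dim (tangent_space (ideal_gen {f, g}) p) + 2"
    unfolding singular_at_def cone_points_pair assms using True by linarith
  also have "\<dots> \<longleftrightarrow> (\<exists>m n. (m, n) \<noteq> (0, 0) \<and> (\<forall>i. m * u $ i + n * w $ i = 0))"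
  proof
    assume "CARD('n) < vec.dim (tangent_space (ideal_gen {f, g}) p) + 2"
    then have "\<not> (\<forall>m n. (\<forall>i. m * u $ i + n * w $ i = 0) \<longrightarrow> m = 0 \<and> n = 0)"
      using common_kernel_dim_le[of u w] unfolding T by (meson leD)
    then show "\<exists>m n. (m, n) \<noteq> (0, 0) \<and> (\<forall>i. m * u $ i + n * w $ i = 0)" by blast
  next
    assume "\<exists>m n. (m, n) \<noteq> (0, 0) \<and> (\<forall>i. m * u $ i + n * w $ i = 0)"
    then obtain m n where "(m, n) \<noteq> (0, 0)" "\<And>i. m * u $ i + n * w $ i = 0" by blast
    from common_kernel_dim_ge[OF this] show "CARD('n) < vec.dim (tangent_space (ideal_gen {f, g}) p) + 2"
      unfolding T by linarith
  qed
  finally show ?thesis using True by (simp add: u_def w_def)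
qed (auto simp: singular_at_def cone_points_pair)

section \<open>The singular points of the threefold\<close>

definition triple_point :: "6 option \<Rightarrow> complex ^ 6" where
  "triple_point k = (case k of None \<Rightarrow> (\<chi> i. 1) | Some i \<Rightarrow> axis i 1)"

lemma forall_6: "(\<forall>i::6. P i) \<longleftrightarrow> P 0 \<and> P 1 \<and> P 2 \<and> P 3 \<and> P 4 \<and> P 5"
proof -
  have "(\<forall>i::6. P i) \<longleftrightarrow> (\<forall>i\<in>{0, 1, 2, 3, 4, 5}. P i)" unfolding UNIV_6[symmetric] by simp
  then show ?thesis by simp
qed

lemma triple_point_nonzero: "triple_point k \<noteq> 0"
  by (auto simp: triple_point_def vec_eq_iff axis_def split: option.split)

lemma triple_point_proportional:
  assumes "triple_point k = c *s triple_point k'"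
  shows "k = k'"
proof (rule ccontr)
  assume neq: "k \<noteq> k'"
  have ex: "\<exists>j::6. j \<noteq> i" for i
    by (rule exI[of _ "if i = 0 then 1 else 0"]) simp
  have eq: "triple_point k $ j = c * triple_point k' $ j" for j using assms by simp
  show False
  proof (cases k)
    case None
    then obtain i where i: "k' = Some i" using neq by (cases k') auto
    obtain j where "j \<noteq> i" using ex by blast
    with None i eq[of j] show False by (simp add: triple_point_def axis_def)
  next
    case k: (Some i)
    show False
    proof (cases k')
      case None
      obtain j where "j \<noteq> i" using ex by blast
      with k None eq[of i] eq[of j] show False by (auto simp: triple_point_def axis_def)
    next
      case (Some j)
      with k neq have "i \<noteq> j" by auto
      with k Some eq[of i] show False by (simp add: triple_point_def axis_def)
    qed
  qed
qed

lemma span_triple_point_eq_iff: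
  "vec.span {triple_point k} = vec.span {triple_point k'} \<longleftrightarrow> k = k'"
proof
  assume "vec.span {triple_point k} = vec.span {triple_point k'}"
  then have "triple_point k \<in> vec.span {triple_point k'}" by (metis insertI1 vec.span_base)
  then obtain c where "triple_point k = c *s triple_point k'" by (auto simp: vec.span_singleton)
  then show "k = k'" by (rule triple_point_proportional)
qed simp

lemma span_scaled:
  assumes "c \<noteq> (0::complex)"
  shows "vec.span {c *s x} = vec.span {x}"
proof -
  have "x = (1 / c) *s (c *s x)" using assms by simp
  then have "x \<in> vec.span {c *s x}" by (metis insertI1 vec.span_base vec.span_scale)
  moreover have "c *s x \<in> vec.span {x}" by (simp add: vec.span_base vec.span_scale)
  ultimately show ?thesis
    by (intro antisym vec.span_minimal vec.subspace_span) auto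
qed

text \<open>All derivatives of the quartic vanish at the seven points, so the multiplier is zero there. Conversely
  a singular point is critical, and the classification applies.\<close>

lemma singular_at_threefold_iff:
  assumes "proj_dim (ideal_gen {Q6, F6}) = 3"
  shows "singular_at (ideal_gen {Q6, F6}) p \<longleftrightarrow> (\<exists>c k. c \<noteq> 0 \<and> p = c *s triple_point k)"
proof
  have dim: "proj_dim (ideal_gen {Q6, F6}) = int CARD(6) - 3" using assms by simp
  {
    assume "singular_at (ideal_gen {Q6, F6}) p"
    then obtain m n where p: "p \<noteq> 0" "poly_eval Q6 p = 0" "poly_eval F6 p = 0"
      and mn: "(m, n) \<noteq> (0, 0)" "\<And>i. m * poly_eval (pdiff i Q6) p + n * poly_eval (pdiff i F6) p = 0"
      unfolding singular_at_pair[OF dim] by blast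
    have n: "n \<noteq> 0"
    proof
      assume n: "n = 0"
      with mn have "m \<noteq> 0" "\<And>i. poly_eval (pdiff i Q6) p = 0" by simp_all
      from this(2)[of 0] this(2)[of 1] this(2)[of 2] this(2)[of 3] this(2)[of 4] this(2)[of 5]
      have s: "p$1 + p$2 = 0" "p$0 + p$2 = 0" "p$0 + p$1 = 0" "p$4 + p$5 = 0" "p$3 + p$5 = 0" "p$3 + p$4 = 0"
        unfolding poly_eval_pdiff_Q6 by simp_all
      have "2 * p$0 = (p$0 + p$2) + (p$0 + p$1) - (p$1 + p$2)"
        "2 * p$1 = (p$1 + p$2) + (p$0 + p$1) - (p$0 + p$2)"
        "2 * p$2 = (p$1 + p$2) + (p$0 + p$2) - (p$0 + p$1)"
        "2 * p$3 = (p$3 + p$5) + (p$3 + p$4) - (p$4 + p$5)"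
        "2 * p$4 = (p$4 + p$5) + (p$3 + p$4) - (p$3 + p$5)"
        "2 * p$5 = (p$4 + p$5) + (p$3 + p$5) - (p$3 + p$4)" by simp_all
      then have "p = 0" unfolding s by (simp add: vec_eq_iff forall_6)
      with p show False by simp
    qed
    have c: "m / n * poly_eval (pdiff i Q6) p + poly_eval (pdiff i F6) p = 0" for i
      using mn(2)[of i] n by (simp add: field_simps)
    have "critical (m / n) (p$0) (p$1) (p$2) (p$3) (p$4) (p$5)"
      unfolding critical_def
      using p(2,3) c[of 0] c[of 1] c[of 2] c[of 3] c[of 4] c[of 5]
      unfolding poly_eval_pdiff_Q6 poly_eval_pdiff_F6 poly_eval_Q6 poly_eval_F6
      by (simp only: mult_minus_left mult_minus_right simp_thms)
    from critical_classification[OF this]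
    consider "p = p $ 0 *s triple_point None" | i where "p = p $ i *s triple_point (Some i)"
    proof (elim disjE)
      assume "p$0 = p$1 \<and> p$1 = p$2 \<and> p$2 = p$3 \<and> p$3 = p$4 \<and> p$4 = p$5"
      then have "p = p $ 0 *s triple_point None"
        by (simp add: vec_eq_iff forall_6 triple_point_def)
      then show ?thesis by (rule that)
    next
      assume z: "p$0 = 0 \<and> p$1 = 0 \<and> p$2 = 0 \<and> p$3 * p$4 = 0 \<and> p$3 * p$5 = 0 \<and> p$4 * p$5 = 0"
      then consider "p$3 = 0 \<and> p$4 = 0" | "p$3 = 0 \<and> p$5 = 0" | "p$4 = 0 \<and> p$5 = 0" by auto
      then show ?thesis
        by cases (use z that(2)[of 3] that(2)[of 4] that(2)[of 5] in
            \<open>auto simp: vec_eq_iff forall_6 triple_point_def axis_def\<close>)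
    next
      assume z: "p$3 = 0 \<and> p$4 = 0 \<and> p$5 = 0 \<and> p$0 * p$1 = 0 \<and> p$0 * p$2 = 0 \<and> p$1 * p$2 = 0"
      then consider "p$0 = 0 \<and> p$1 = 0" | "p$0 = 0 \<and> p$2 = 0" | "p$1 = 0 \<and> p$2 = 0" by auto
      then show ?thesis
        by cases (use z that(2)[of 0] that(2)[of 1] that(2)[of 2] in
            \<open>auto simp: vec_eq_iff forall_6 triple_point_def axis_def\<close>)
    qed
    then obtain c k where co: "p = c *s triple_point k" by cases blast+
    with p have "c \<noteq> 0" by auto
    with co show "\<exists>c k. c \<noteq> 0 \<and> p = c *s triple_point k" by blast
  }
  {
    assume "\<exists>c k. c \<noteq> 0 \<and> p = c *s triple_point k"
    then obtain c k where co: "c \<noteq> 0" "p = c *s triple_point k" by blast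
    have p: "p \<noteq> 0" using co triple_point_nonzero by simp
    have "poly_eval Q6 p = 0 \<and> poly_eval F6 p = 0 \<and> (\<forall>i. poly_eval (pdiff i F6) p = 0)"
    proof (cases k)
      case None
      then have "p $ i = c" for i using co by (simp add: triple_point_def)
      then show ?thesis
        unfolding forall_6 poly_eval_pdiff_F6 poly_eval_Q6 poly_eval_F6
        by (simp add: quadric_def quartic_def quartic_dx_def Let_def algebra_simps)
    next
      case (Some j)
      then have pk: "p $ i = (if i = j then c else 0)" for i using co by (simp add: triple_point_def axis_def)
      have "j \<in> {0, 1, 2, 3, 4, 5}" unfolding UNIV_6[symmetric] by simp
      then show ?thesis
        unfolding forall_6 poly_eval_pdiff_F6 poly_eval_Q6 poly_eval_F6
        by (elim insertE) (simp_all add: pk quadric_def quartic_def quartic_dx_def)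
    qed
    then show "singular_at (ideal_gen {Q6, F6}) p"
      unfolding singular_at_pair[OF dim] using p by (intro conjI exI[of _ 0] exI[of _ 1]) simp_all
  }
qed

section \<open>Initial forms\<close>

definition vanishes_to_order :: "nat \<Rightarrow> 'v mpol \<Rightarrow> bool" where
  "vanishes_to_order n p \<longleftrightarrow> (\<forall>m\<in>keys p. n \<le> mdeg m)"

lemma mdeg_superset:
  assumes "finite S" "keys m \<subseteq> S"
  shows "mdeg m = (\<Sum>i\<in>S. lookup m i)"
  unfolding mdeg_def using assms by (intro sum.mono_neutral_left) (auto simp: in_keys_iff)

lemma mdeg_add: "mdeg (m + n) = mdeg m + mdeg n"
proof -
  have "keys (m + n) \<subseteq> keys m \<union> keys n" by (rule keys_add)
  then show ?thesis
    by (simp add: mdeg_superset[where S = "keys m \<union> keys n"] lookup_add sum.distrib)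
qed

lemma mdeg_0: "mdeg 0 = 0"
  by (simp add: mdeg_def)

lemma mdeg_single: "mdeg (single i n) = n"
  by (cases n) (simp_all add: mdeg_def)

lemma homogeneous_0: "homogeneous d 0"
  by (simp add: homogeneous_def)

lemma homogeneous_Const: "homogeneous 0 (Const c)"
  by (simp add: homogeneous_def Const_def mdeg_0)

lemma homogeneous_numeral: "homogeneous 0 (numeral k)"
  using homogeneous_Const[of "numeral k"] by (simp add: hom_simps[OF Const_hom])

lemma homogeneous_Var: "homogeneous 1 (Var i)"
  by (simp add: homogeneous_def Var_def mdeg_single)

lemma homogeneous_add: "homogeneous d p \<Longrightarrow> homogeneous d q \<Longrightarrow> homogeneous d (p + q)"
  using keys_add[of p q] by (auto simp: homogeneous_def)

lemma homogeneous_mult: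
  assumes "homogeneous d p" "homogeneous e q" "n = d + e"
  shows "homogeneous n (p * q)"
  unfolding homogeneous_def
proof
  fix m assume "m \<in> keys (p * q)"
  then obtain a b where "m = a + b" "a \<in> keys p" "b \<in> keys q" using keys_mult[of p q] by blast
  then show "mdeg m = n" using assms by (simp add: homogeneous_def mdeg_add)
qed

lemma homogeneous_uminus: "homogeneous d p \<Longrightarrow> homogeneous d (- p)"
  by (auto simp: homogeneous_def in_keys_iff)

lemma homogeneous_minus: "homogeneous d p \<Longrightarrow> homogeneous d q \<Longrightarrow> homogeneous d (p - q)"
  using homogeneous_add[of d p "- q"] homogeneous_uminus[of d q] by simp

lemma vanishes_homogeneous: "homogeneous d p \<Longrightarrow> n \<le> d \<Longrightarrow> vanishes_to_order n p"
  by (auto simp: homogeneous_def vanishes_to_order_def)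

lemma vanishes_add: "vanishes_to_order n p \<Longrightarrow> vanishes_to_order n q \<Longrightarrow> vanishes_to_order n (p + q)"
  using keys_add[of p q] by (auto simp: vanishes_to_order_def)

lemma vanishes_mult:
  assumes "vanishes_to_order a p" "vanishes_to_order b q" "n \<le> a + b"
  shows "vanishes_to_order n (p * q)"
  unfolding vanishes_to_order_def
proof
  fix m assume "m \<in> keys (p * q)"
  then obtain k j where m: "m = k + j" "k \<in> keys p" "j \<in> keys q" using keys_mult[of p q] by blast
  then have "a \<le> mdeg k" "b \<le> mdeg j" using assms by (simp_all add: vanishes_to_order_def)
  then show "n \<le> mdeg m" using m assms(3) by (simp add: mdeg_add)
qed

lemma vanishes_uminus: "vanishes_to_order n p \<Longrightarrow> vanishes_to_order n (- p)"
  by (auto simp: vanishes_to_order_def in_keys_iff)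

lemma vanishes_minus: "vanishes_to_order n p \<Longrightarrow> vanishes_to_order n q \<Longrightarrow> vanishes_to_order n (p - q)"
  using vanishes_add[of n p "- q"] vanishes_uminus[of n q] by simp

lemma vanishes_0: "vanishes_to_order 0 p"
  by (simp add: vanishes_to_order_def)

lemma vanishes_zero: "vanishes_to_order n 0"
  by (simp add: vanishes_to_order_def)

lemma vanishes_mono: "vanishes_to_order n p \<Longrightarrow> k \<le> n \<Longrightarrow> vanishes_to_order k p"
  by (auto simp: vanishes_to_order_def)

lemma lookup_hom_component: "lookup (hom_component d p) m = (if mdeg m = d then lookup p m else 0)"
proof -
  have "lookup (hom_component d p) m = (\<Sum>k\<in>{k \<in> keys p. mdeg k = d}. if k = m then lookup p k else 0)"
    by (simp add: hom_component_def lookup_sum lookup_single when_def)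
  also have "\<dots> = (if mdeg m = d then lookup p m else 0)"
    by (auto simp: sum.delta in_keys_iff)
  finally show ?thesis .
qed

lemma hom_component_homogeneous: "homogeneous d (hom_component d p)"
  by (auto simp: homogeneous_def in_keys_iff lookup_hom_component split: if_splits)

lemma hom_component_add: "hom_component d (p + q) = hom_component d p + hom_component d q"
  by (rule poly_mapping_eqI) (simp add: lookup_hom_component lookup_add)

lemma hom_component_of_homogeneous:
  assumes "homogeneous n p"
  shows "hom_component d p = (if d = n then p else 0)"
proof (rule poly_mapping_eqI)
  fix m
  have "lookup p m \<noteq> 0 \<Longrightarrow> mdeg m = n" using assms by (simp add: homogeneous_def in_keys_iff)
  then show "lookup (hom_component d p) m = lookup (if d = n then p else 0) m"
    by (auto simp: lookup_hom_component)
qed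

lemma hom_component_same: "homogeneous d p \<Longrightarrow> hom_component d p = p"
  by (simp add: hom_component_of_homogeneous)

lemma hom_component_vanishing: "vanishes_to_order n p \<Longrightarrow> d < n \<Longrightarrow> hom_component d p = 0"
proof (rule poly_mapping_eqI)
  fix m
  assume "vanishes_to_order n p" "d < n"
  then have "mdeg m = d \<Longrightarrow> m \<notin> keys p" by (auto simp: vanishes_to_order_def)
  then show "lookup (hom_component d p) m = lookup 0 m"
    by (simp add: lookup_hom_component in_keys_iff)
qed

lemma vanishes_Suc:
  assumes "vanishes_to_order n p" "hom_component n p = 0"
  shows "vanishes_to_order (Suc n) p"
  unfolding vanishes_to_order_def
proof
  fix m assume m: "m \<in> keys p"
  then have "n \<le> mdeg m" using assms(1) by (simp add: vanishes_to_order_def)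
  moreover have "mdeg m \<noteq> n"
    using m assms(2) lookup_hom_component[of n p m] by (auto simp: in_keys_iff)
  ultimately show "Suc n \<le> mdeg m" by simp
qed

lemma vanishes_minus_hom_component:
  assumes "vanishes_to_order n p"
  shows "vanishes_to_order (Suc n) (p - hom_component n p)"
proof (rule vanishes_Suc)
  show "vanishes_to_order n (p - hom_component n p)"
    by (intro vanishes_minus assms vanishes_homogeneous[OF hom_component_homogeneous] order_refl)
  show "hom_component n (p - hom_component n p) = 0"
    by (rule poly_mapping_eqI) (simp add: lookup_hom_component lookup_minus)
qed

text \<open>The lowest terms of a product come from the lowest terms of the factors.\<close>

lemma hom_component_mult:
  assumes p: "vanishes_to_order a p" and q: "vanishes_to_order b q"
  shows "hom_component (a + b) (p * q) = hom_component a p * hom_component b q"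
proof -
  let ?p = "p - hom_component a p" and ?q = "q - hom_component b q"
  have "p * q = hom_component a p * hom_component b q + (?p * q + hom_component a p * ?q)"
    by (simp add: algebra_simps)
  moreover have "vanishes_to_order (Suc (a + b)) (?p * q)"
    by (rule vanishes_mult[OF vanishes_minus_hom_component[OF p] q]) simp
  moreover have "vanishes_to_order (Suc (a + b)) (hom_component a p * ?q)"
    by (rule vanishes_mult[OF vanishes_homogeneous[OF hom_component_homogeneous order_refl]
          vanishes_minus_hom_component[OF q]]) simp
  ultimately have "hom_component (a + b) (p * q) =
      hom_component (a + b) (hom_component a p * hom_component b q) + 0"
    by (simp only: hom_component_add) (simp add: hom_component_vanishing)
  also have "\<dots> = hom_component a p * hom_component b q"
    by (simp add: hom_component_same homogeneous_mult[OF hom_component_homogeneous hom_component_homogeneous refl])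
  finally show ?thesis .
qed

lemma hom_component_mult_homogeneous:
  assumes "homogeneous e p"
  shows "hom_component d (p * q) = (if e \<le> d then p * hom_component (d - e) q else 0)"
proof (induction q rule: poly_mapping_single_induct)
  case (single m c)
  have "homogeneous (mdeg m) (single m c)"
    by (simp add: homogeneous_def)
  from homogeneous_mult[OF assms this refl] have "homogeneous (e + mdeg m) (p * single m c)" .
  note hom_component_of_homogeneous[OF this, of d]
    and hom_component_of_homogeneous[OF \<open>homogeneous (mdeg m) (single m c)\<close>, of "d - e"]
  then show ?case by auto
qed (auto simp: hom_component_add distrib_left)

lemma initial_form_eqI:
  assumes "vanishes_to_order d p" "hom_component d p \<noteq> 0"
  shows "initial_form p = hom_component d p"
proof -
  obtain m where "lookup (hom_component d p) m \<noteq> 0"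
    using assms(2) by (metis lookup_zero poly_mapping_eqI)
  then have "m \<in> keys p" "mdeg m = d" by (auto simp: lookup_hom_component in_keys_iff split: if_splits)
  then have "(LEAST d. \<exists>m\<in>keys p. mdeg m = d) = d"
    using assms(1) by (intro Least_equality) (auto simp: vanishes_to_order_def)
  then show ?thesis by (simp add: initial_form_def)
qed

lemma initial_form_0: "initial_form 0 = 0"
  by (simp add: initial_form_def hom_component_def)

lemma exists_order:
  assumes "p \<noteq> 0"
  obtains d where "vanishes_to_order d p" "hom_component d p \<noteq> 0"
proof -
  define d where "d = (LEAST d. \<exists>m\<in>keys p. mdeg m = d)"
  have "keys p \<noteq> {}" using assms by simp
  then have ex: "\<exists>d. \<exists>m\<in>keys p. mdeg m = d" by blast
  from LeastI_ex[OF ex] obtain m where m: "m \<in> keys p" "mdeg m = d" unfolding d_def by blast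
  have "vanishes_to_order d p"
    unfolding vanishes_to_order_def d_def by (auto intro: Least_le)
  moreover have "hom_component d p \<noteq> 0"
    using m lookup_hom_component[of d p m] by (auto simp: in_keys_iff)
  ultimately show thesis by (rule that)
qed

text \<open>In \<open>h = a * f + b * g\<close> the terms of lowest order of \<open>a * f\<close> and \<open>b * g\<close> may cancel. If they do,
  they form a relation between \<open>l\<close> and \<open>C\<close>. All such relations are multiples of the trivial one,
  so a suitable \<open>k\<close> makes the lowest terms of \<open>a + k * g\<close> and \<open>b - k * f\<close> vanish while \<open>h\<close> does not
  change. After finitely many steps the lowest terms do not cancel, and the initial form of
  \<open>h\<close> is a combination of \<open>l\<close> and \<open>C\<close>. Orders of \<open>b\<close> are written as \<open>n - 2\<close> because \<open>g\<close> starts two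
  degrees later than \<open>f\<close>; for \<open>n < 2\<close> only \<open>a * f\<close> contributes.\<close>

lemma initial_form_mem:
  fixes f g :: "'v::linorder mpol"
  assumes h: "h = a * f + b * g"
    and f: "vanishes_to_order 1 f" "hom_component 1 f = l"
    and g: "vanishes_to_order 3 g" "hom_component 3 g = C"
    and l: "l \<noteq> 0"
    and syz: "\<And>a b. l * a + C * b = 0 \<Longrightarrow> \<exists>k. b = l * k"
  shows "initial_form h \<in> ideal_gen {l, C}"
proof (cases "h = 0")
  case True
  then show ?thesis by (simp add: initial_form_0 is_idealD[OF ideal_gen_ideal])
next
  case False
  then obtain D where D: "vanishes_to_order D h" "hom_component D h \<noteq> 0" by (rule exists_order)
  have comp: "hom_component (Suc n) (a * f + b * g) =
      hom_component n a * l + (if n < 2 then 0 else hom_component (n - 2) b * C)"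
    if "vanishes_to_order n a" "vanishes_to_order (n - 2) b" for n a b
  proof -
    have "hom_component (Suc n) (a * f) = hom_component n a * l"
      using hom_component_mult[OF that(1) f(1)] f(2) by simp
    moreover have "hom_component (Suc n) (b * g) = (if n < 2 then 0 else hom_component (n - 2) b * C)"
    proof (cases "n < 2")
      case True
      have "vanishes_to_order 3 (b * g)" by (rule vanishes_mult[OF that(2) g(1)]) simp
      then show ?thesis using True by (simp add: hom_component_vanishing)
    next
      case False
      then have "n - 2 + 3 = Suc n" by simp
      then show ?thesis using hom_component_mult[OF that(2) g(1)] g(2) False by simp
    qed
    ultimately show ?thesis by (simp add: hom_component_add)
  qed
  have lh: "homogeneous 1 l" using hom_component_homogeneous[of 1 f] f(2) by simp
  \<comment> \<open>While the leading terms of \<open>a * f\<close> and \<open>b * g\<close> cancel, the syzygy raises their order.\<close>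
  have "\<exists>a b. h = a * f + b * g \<and> vanishes_to_order n a \<and> vanishes_to_order (n - 2) b" if "Suc n \<le> D \<or> n = 0" for n
    using that
  proof (induction n)
    case 0
    then show ?case using h vanishes_0 by auto
  next
    case (Suc n)
    then obtain a b where ab: "h = a * f + b * g" "vanishes_to_order n a" "vanishes_to_order (n - 2) b"
      by auto
    have z: "hom_component n a * l + (if n < 2 then 0 else hom_component (n - 2) b * C) = 0"
      using comp[OF ab(2,3)] ab(1) hom_component_vanishing[OF D(1), of "Suc n"] Suc.prems by simp
    show ?case
    proof (cases "n < 2")
      case True
      then have "hom_component n a = 0" using z l by simp
      then have "vanishes_to_order (Suc n) a" by (rule vanishes_Suc[OF ab(2)])
      moreover have "Suc n - 2 = 0" using True by simp
      ultimately show ?thesis using ab(1) vanishes_0 by metis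
    next
      case False
      then have z: "l * hom_component n a + C * hom_component (n - 2) b = 0"
        using z by (simp add: mult.commute)
      from syz[OF z] obtain k where k: "hom_component (n - 2) b = l * k" by blast
      have "\<exists>k. hom_component (n - 2) b = l * k \<and> (k = 0 \<or> n \<ge> 3 \<and> homogeneous (n - 3) k)"
      proof (cases "n = 2")
        case True
        have "l * k = hom_component 0 (l * k)"
          using k hom_component_same[OF hom_component_homogeneous[of 0 b]] True by simp
        also have "\<dots> = 0" by (simp add: hom_component_mult_homogeneous[OF lh])
        finally show ?thesis using k by (intro exI[of _ 0]) simp
      next
        case neq: False
        have "l * k = hom_component (n - 2) (l * k)"
          using k hom_component_same[OF hom_component_homogeneous[of "n - 2" b]] by simp
        also have "\<dots> = l * hom_component (n - 3) k"
          using False neq by (simp add: hom_component_mult_homogeneous[OF lh])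
        finally show ?thesis
          using k neq False by (intro exI[of _ "hom_component (n - 3) k"])
            (simp add: hom_component_homogeneous)
      qed
      then obtain k where k: "hom_component (n - 2) b = l * k" "k = 0 \<or> n \<ge> 3 \<and> homogeneous (n - 3) k"
        by blast
      have "l * (hom_component n a + C * k) = 0" using z k(1) by (simp add: algebra_simps)
      then have ka: "hom_component n a = - (C * k)" using l by (simp add: eq_neg_iff_add_eq_0)
      have vk: "vanishes_to_order (n - 3) k" "hom_component (n - 3) k = k"
        using k(2) by (auto simp: vanishes_homogeneous vanishes_zero hom_component_same homogeneous_0)
      have "vanishes_to_order n (k * g) \<and> hom_component n (k * g) = k * C \<and>
          vanishes_to_order (n - 2) (k * f) \<and> hom_component (n - 2) (k * f) = k * l"
        using k(2)
      proof
        assume "n \<ge> 3 \<and> homogeneous (n - 3) k"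
        then have "3 \<le> n" by simp
        then have n: "n = n - 3 + 3" "n - 2 = n - 3 + 1" by arith+
        show ?thesis
          using vanishes_mult[OF vk(1) g(1), of n] hom_component_mult[OF vk(1) g(1)]
            vanishes_mult[OF vk(1) f(1), of "n - 2"] hom_component_mult[OF vk(1) f(1)] n
          unfolding vk(2) f(2) g(2) by (metis order_refl)
      qed (simp add: vanishes_zero hom_component_same homogeneous_0)
      then have vkg: "vanishes_to_order n (k * g)" "hom_component n (k * g) = k * C"
        and vkf: "vanishes_to_order (n - 2) (k * f)" "hom_component (n - 2) (k * f) = k * l" by simp_all
      have "vanishes_to_order (Suc n) (a + k * g)"
      proof (rule vanishes_Suc)
        show "vanishes_to_order n (a + k * g)" by (intro vanishes_add ab vkg)
        show "hom_component n (a + k * g) = 0" by (simp add: hom_component_add vkg ka)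
      qed
      moreover have "vanishes_to_order (Suc (n - 2)) (b - k * f)"
      proof (rule vanishes_Suc)
        show "vanishes_to_order (n - 2) (b - k * f)" by (intro vanishes_minus ab vkf)
        have "hom_component (n - 2) (b - k * f) + hom_component (n - 2) (k * f) = hom_component (n - 2) b"
          by (simp flip: hom_component_add)
        then show "hom_component (n - 2) (b - k * f) = 0" by (simp only: vkf k(1) mult.commute[of k l] add_cancel_left_left)
      qed
      moreover have "Suc n - 2 = Suc (n - 2)" using False by simp
      moreover have "h = (a + k * g) * f + (b - k * f) * g" using ab(1) by (simp add: algebra_simps)
      ultimately show ?thesis by metis
    qed
  qed
  then obtain a b where ab: "h = a * f + b * g" "vanishes_to_order (D - 1) a" "vanishes_to_order (D - 1 - 2) b"
    by (metis One_nat_def Suc_pred less_eq_nat.simps(1) not_gr_zero order_refl zero_diff diff_0_eq_0)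
  have "D \<noteq> 0"
  proof
    assume "D = 0"
    have "vanishes_to_order 1 h" unfolding h
      by (intro vanishes_add vanishes_mult[OF vanishes_0 f(1)] vanishes_mult[OF vanishes_0 g(1)]) simp_all
    with D(2) \<open>D = 0\<close> show False by (simp add: hom_component_vanishing)
  qed
  have "initial_form h = hom_component D h" by (rule initial_form_eqI[OF D])
  also have "\<dots> = hom_component (D - 1) a * l + (if D - 1 < 2 then 0 else hom_component (D - 1 - 2) b) * C"
    using comp[OF ab(2,3)] ab(1) \<open>D \<noteq> 0\<close> by (cases D) auto
  finally show ?thesis unfolding ideal_gen_pair by blast
qed

section \<open>Cones over cubic surfaces\<close>

text \<open>Restriction to the hyperplane on which the first coordinate vanishes, and a section of it. The
  tangent hyperplane of the quadric is put into this position by the choice of the charts.\<close>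

definition drop_first :: "5 mpol \<Rightarrow> 4 mpol" where
  "drop_first = poly_subst (\<lambda>k. if k = 0 then 0 else if k = 1 then Var 0 else if k = 2 then Var 1
     else if k = 3 then Var 2 else Var 3)"

definition add_first :: "4 mpol \<Rightarrow> 5 mpol" where
  "add_first = poly_subst (\<lambda>k. if k = 0 then Var 1 else if k = 1 then Var 2 else if k = 2 then Var 3
     else Var 4)"

lemma drop_first_hom: "unital_ring_hom drop_first"
  unfolding drop_first_def by (rule poly_subst_hom)
lemma add_first_hom: "unital_ring_hom add_first"
  unfolding add_first_def by (rule poly_subst_hom)

lemma drop_first_simps:
  "drop_first (Var 0) = 0" "drop_first (Var 1) = Var 0" "drop_first (Var 2) = Var 1"
  "drop_first (Var 3) = Var 2" "drop_first (Var 4) = Var 3" "drop_first (Const c) = Const c"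
  by (simp_all add: drop_first_def poly_subst_Var poly_subst_Const)

lemma add_first_simps:
  "add_first (Var 0) = Var 1" "add_first (Var 1) = Var 2" "add_first (Var 2) = Var 3"
  "add_first (Var 3) = Var 4" "add_first (Const c) = Const c"
  by (simp_all add: add_first_def poly_subst_Var poly_subst_Const)

text \<open>Restriction to the hyperplane loses exactly the multiples of its equation.\<close>

lemma add_drop_first: "\<exists>k. p = add_first (drop_first p) + Var 0 * k"
proof (induction p rule: mpol_induct)
  case (Const c)
  show ?case by (rule exI[of _ 0]) (simp add: drop_first_simps add_first_simps)
next
  case (Var i)
  have "i \<in> {0, 1, 2, 3, 4}" unfolding UNIV_5[symmetric] by simp
  then show ?case
  proof (elim insertE)
    assume "i = 0"
    then show ?case by (intro exI[of _ 1]) (simp add: drop_first_simps hom_simps[OF add_first_hom])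
  qed (rule exI[of _ 0], simp add: drop_first_simps add_first_simps)+
next
  case (add p q)
  then obtain k j where kj: "p = add_first (drop_first p) + Var 0 * k" "q = add_first (drop_first q) + Var 0 * j"
    by blast
  define P R where "P = add_first (drop_first p)" and "R = add_first (drop_first q)"
  have "p = P + Var 0 * k" "q = R + Var 0 * j" unfolding P_def R_def by (fact kj)+
  then have "p + q = P + R + Var 0 * (k + j)" by (simp add: algebra_simps)
  also have "P + R = add_first (drop_first (p + q))"
    by (simp add: hom_simps[OF drop_first_hom] hom_simps[OF add_first_hom] P_def R_def)
  finally show ?case ..
next
  case (mult p q)
  then obtain k j where kj: "p = add_first (drop_first p) + Var 0 * k" "q = add_first (drop_first q) + Var 0 * j"
    by blast
  define P R where "P = add_first (drop_first p)" and "R = add_first (drop_first q)"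
  have "p = P + Var 0 * k" "q = R + Var 0 * j" unfolding P_def R_def by (fact kj)+
  then have "p * q = P * R + Var 0 * (k * R + P * j + Var 0 * k * j)"
    by (simp add: algebra_simps)
  also have "P * R = add_first (drop_first (p * q))"
    by (simp add: hom_simps[OF drop_first_hom] hom_simps[OF add_first_hom] P_def R_def)
  finally show ?case ..
qed

lemma drop_first_eq_0:
  assumes "drop_first p = 0"
  shows "\<exists>k. p = Var 0 * k"
proof -
  obtain k where "p = add_first (drop_first p) + Var 0 * k" using add_drop_first by blast
  then have "p = Var 0 * k" unfolding assms hom_simps[OF add_first_hom] by simp
  then show ?thesis ..
qed

lemma sum_4: "(\<Sum>l\<in>UNIV. f l) = f (0::4) + f 1 + f 2 + f 3"
  unfolding UNIV_4 by (simp add: add.assoc)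

definition coordinate_embedding :: "complex ^ 4 ^ 5" where
  "coordinate_embedding = (\<chi> k. if k = 1 then axis 0 1 else if k = 2 then axis 1 1
     else if k = 3 then axis 2 1 else if k = 4 then axis 3 1 else 0)"

lemma coordinate_embedding_rows:
  "coordinate_embedding $ 0 = 0" "coordinate_embedding $ 1 = axis 0 1"
  "coordinate_embedding $ 2 = axis 1 1" "coordinate_embedding $ 3 = axis 2 1"
  "coordinate_embedding $ 4 = axis 3 1"
  by (simp_all add: coordinate_embedding_def)

lemma coordinate_embedding_inj: "inj (\<lambda>y. coordinate_embedding *v y)"
proof (rule injI)
  fix x y :: "complex ^ 4"
  assume eq: "coordinate_embedding *v x = coordinate_embedding *v y"
  have row: "(coordinate_embedding *v z) $ 1 = z $ 0" "(coordinate_embedding *v z) $ 2 = z $ 1"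
    "(coordinate_embedding *v z) $ 3 = z $ 2" "(coordinate_embedding *v z) $ 4 = z $ 3" for z
    by (simp_all add: matrix_vector_mult_def sum_4 coordinate_embedding_rows) (simp_all add: axis_def)
  have "\<forall>l\<in>{0, 1, 2, 3}. x $ l = y $ l"
    using row[of x] row[of y] by (simp add: eq)
  then show "x = y" unfolding vec_eq_iff UNIV_4[symmetric] by simp
qed

lemma embedded_cone_coordinate:
  "embedded_cone_ideal coordinate_embedding c = {f. drop_first f \<in> ideal_gen {c}}"
proof -
  have "(\<Sum>l\<in>UNIV. Const (coordinate_embedding $ k $ l) * Var l) =
      (if k = 0 then 0 else if k = 1 then Var 0 else if k = 2 then Var 1
     else if k = 3 then Var 2 else (Var 3 :: 4 mpol))" for k
  proof -
    have "k \<in> {0, 1, 2, 3, 4}" unfolding UNIV_5[symmetric] by simp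
    moreover have "Const (axis i (1::complex) $ l) = (if l = i then 1 else 0 :: 4 mpol)" for i l :: 4
      by (simp add: axis_def hom_simps[OF Const_hom])
    ultimately show ?thesis
      by (elim insertE)
        (simp_all add: sum_4 coordinate_embedding_rows hom_simps[OF Const_hom])
  qed
  then show ?thesis by (simp add: embedded_cone_ideal_def drop_first_def)
qed

text \<open>If the restriction \<open>c\<close> of the cubic form \<open>C\<close> is not zero, a relation between the linear form and
  \<open>C\<close> restricts to \<open>c * q = 0\<close>, so that \<open>q\<close> is a multiple of the linear form. Hence the
  initial forms generate \<open>(l, C)\<close>, the ideal of the polynomials whose restriction is a multiple of \<open>c\<close>.\<close>

lemma tangent_cone_is_cubic_cone:
  fixes f2 g4 C :: "5 mpol"
  assumes a: "a \<noteq> 0" and f2: "vanishes_to_order 2 f2" and g4: "vanishes_to_order 4 g4"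
    and C: "homogeneous 3 C" and c: "drop_first C = c" "c \<noteq> 0"
  shows "tangent_cone_ideal (ideal_gen {Const a * Var 0 + f2, C + g4}) =
    embedded_cone_ideal coordinate_embedding c"
proof -
  define l where "l = Const a * Var (0::5)"
  have "Const (1 / a) * Const a = Const (1 / a * a)" by (simp only: hom_simps[OF Const_hom])
  then have unit: "Const (1 / a) * Const a = (1 :: 5 mpol)"
    using a by (simp add: hom_simps[OF Const_hom])
  have lh: "homogeneous 1 l" unfolding l_def
    by (rule homogeneous_mult[OF homogeneous_Const homogeneous_Var]) simp
  have Var_l: "Var 0 = Const (1 / a) * l"
    unfolding l_def mult.assoc[symmetric] unit by simp
  have l0: "l \<noteq> 0"
  proof
    assume "l = 0"
    then have "lookup (Var (0::5)) (single 0 1) = 0" using Var_l by simp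
    then show False by (simp add: Var_def)
  qed
  have C0: "C \<noteq> 0" using c by (auto simp: hom_simps[OF drop_first_hom])
  have f: "vanishes_to_order 1 (l + f2)" "hom_component 1 (l + f2) = l"
    using vanishes_add[of 1 l f2] vanishes_homogeneous[OF lh, of 1] vanishes_mono[OF f2, of 1]
      hom_component_same[OF lh] hom_component_vanishing[OF f2, of 1]
    by (simp_all add: hom_component_add)
  have g: "vanishes_to_order 3 (C + g4)" "hom_component 3 (C + g4) = C"
    using vanishes_add[of 3 C g4] vanishes_homogeneous[OF C, of 3] vanishes_mono[OF g4, of 3]
      hom_component_same[OF C] hom_component_vanishing[OF g4, of 3]
    by (simp_all add: hom_component_add)
  have dl: "drop_first l = 0" by (simp add: l_def hom_simps[OF drop_first_hom] drop_first_simps)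
  have syz: "\<exists>k. q = l * k" if "l * p + C * q = 0" for p q
  proof -
    have "drop_first (l * p + C * q) = 0" using that by (simp add: hom_simps[OF drop_first_hom])
    then have "drop_first q = 0" using c by (simp add: hom_simps[OF drop_first_hom] dl)
    then obtain k where "q = Var 0 * k" using drop_first_eq_0 by blast
    then have "q = l * (Const (1 / a) * k)" unfolding Var_l by (simp add: ac_simps)
    then show ?thesis ..
  qed
  have "tangent_cone_ideal (ideal_gen {l + f2, C + g4}) = ideal_gen {l, C}"
  proof
    show "tangent_cone_ideal (ideal_gen {l + f2, C + g4}) \<subseteq> ideal_gen {l, C}"
      unfolding tangent_cone_ideal_def
    proof (intro ideal_gen_least ideal_gen_ideal image_subsetI)
      fix h assume "h \<in> ideal_gen {l + f2, C + g4}"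
      then obtain p q where "h = p * (l + f2) + q * (C + g4)" by (auto simp: ideal_gen_pair)
      from initial_form_mem[OF this f g l0 syz] show "initial_form h \<in> ideal_gen {l, C}" .
    qed
    have "initial_form (l + f2) = l" "initial_form (C + g4) = C"
      using initial_form_eqI[OF f(1)] initial_form_eqI[OF g(1)] f(2) g(2) l0 C0 by simp_all
    then have "l \<in> initial_form ` ideal_gen {l + f2, C + g4}" "C \<in> initial_form ` ideal_gen {l + f2, C + g4}"
      by (metis image_eqI ideal_gen_base insertI1 insertI2)+
    then show "ideal_gen {l, C} \<subseteq> tangent_cone_ideal (ideal_gen {l + f2, C + g4})"
      unfolding tangent_cone_ideal_def
      by (intro ideal_gen_least ideal_gen_ideal) (auto intro: ideal_gen_base)
  qed
  also have "\<dots> = embedded_cone_ideal coordinate_embedding c"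
    unfolding embedded_cone_coordinate
  proof (intro antisym subsetI)
    fix h assume "h \<in> ideal_gen {l, C}"
    then obtain p q where "h = p * l + q * C" by (auto simp: ideal_gen_pair)
    then have "drop_first h = drop_first q * c" by (simp add: hom_simps[OF drop_first_hom] dl c)
    then show "h \<in> {f. drop_first f \<in> ideal_gen {c}}" by (auto simp: ideal_gen_singleton)
  next
    fix h assume "h \<in> {f. drop_first f \<in> ideal_gen {c}}"
    then obtain r where r: "drop_first h = r * c" by (auto simp: ideal_gen_singleton)
    obtain k where k: "h = add_first (drop_first h) + Var 0 * k" using add_drop_first by blast
    obtain j where j: "C = add_first c + Var 0 * j" using add_drop_first[of C] c by blast
    have "h = add_first r * add_first c + Var 0 * k"
      using k unfolding r hom_simps[OF add_first_hom] .
    also have "\<dots> = (k - add_first r * j) * Var 0 + add_first r * C"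
      using j by (simp add: algebra_simps)
    finally have "h = ((k - add_first r * j) * Const (1 / a)) * l + add_first r * C"
      unfolding Var_l by (simp add: mult.assoc)
    then show "h \<in> ideal_gen {l, C}" unfolding ideal_gen_pair by blast
  qed
  finally show ?thesis unfolding l_def .
qed

section \<open>The equations in charts at the singular points\<close>

lemma sum_5: "(\<Sum>k\<in>UNIV. f k) = f (0::5) + f 1 + f 2 + f 3 + f 4"
  unfolding UNIV_5 by (simp add: add.assoc)

lemma image_ideal_gen_pair:
  assumes h: "unital_ring_hom h" and surj: "surj h"
  shows "h ` ideal_gen {f, g} = ideal_gen {h f, h g}"
proof (intro antisym subsetI)
  fix x assume "x \<in> h ` ideal_gen {f, g}"
  then obtain a b where "x = h (a * f + b * g)" by (auto simp: ideal_gen_pair)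
  then have "x = h a * h f + h b * h g" by (simp add: hom_simps[OF h])
  then show "x \<in> ideal_gen {h f, h g}" unfolding ideal_gen_pair by blast
next
  fix x assume "x \<in> ideal_gen {h f, h g}"
  then obtain a b where x: "x = a * h f + b * h g" by (auto simp: ideal_gen_pair)
  obtain a' b' where "a = h a'" "b = h b'" using surj by (meson surjD)
  then have "x = h (a' * f + b' * g)" using x by (simp add: hom_simps[OF h])
  moreover have "a' * f + b' * g \<in> ideal_gen {f, g}" unfolding ideal_gen_pair by blast
  ultimately show "x \<in> h ` ideal_gen {f, g}" by blast
qed

text \<open>The image of an ideal under a substitution is an ideal if the substitution is surjective, for
  which the variables suffice.\<close>

lemma surj_poly_subst:
  assumes "\<And>k. Var k \<in> range (poly_subst f)"
  shows "surj (poly_subst f)"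
proof -
  have "p \<in> range (poly_subst f)" for p
  proof (induction p rule: mpol_induct)
    case (Const c)
    have "Const c = poly_subst f (Const c)" by (simp add: poly_subst_Const)
    then show ?case by blast
  next
    case (add p q)
    then show ?case by (auto simp flip: hom_simps(3)[OF poly_subst_hom])
  next
    case (mult p q)
    then show ?case by (auto simp flip: hom_simps(4)[OF poly_subst_hom])
  qed (rule assms)
  then show ?thesis by blast
qed

lemma ideal_gen_pairI: "x = a * f + b * g \<Longrightarrow> x \<in> ideal_gen {f, g}"
  unfolding ideal_gen_pair by blast

lemma ideal_gen_pair_change: "ideal_gen {f, g - u * f} = ideal_gen {f, g}"
proof (intro antisym ideal_gen_least ideal_gen_ideal)
  have "f \<in> ideal_gen {f, h}" for h by (rule ideal_gen_base) simp
  moreover have "g - u * f \<in> ideal_gen {f, g}" by (rule ideal_gen_pairI[of _ "- u" _ 1]) simp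
  moreover have "g \<in> ideal_gen {f, g - u * f}" by (rule ideal_gen_pairI[of _ u _ 1]) simp
  ultimately show "{f, g - u * f} \<subseteq> ideal_gen {f, g}" "{f, g} \<subseteq> ideal_gen {f, g - u * f}"
    by simp_all
qed

lemma vec_span_UNIV_I:
  fixes S :: "(complex ^ 'n) set"
  assumes "\<And>i. axis i 1 \<in> vec.span S"
  shows "vec.span S = UNIV"
proof -
  have "v \<in> vec.span S" for v
  proof -
    have "v = (\<Sum>i\<in>UNIV. v $ i *s axis i 1)"
      by (simp add: vec_eq_iff axis_def if_distrib cong: if_cong)
    moreover have "(\<Sum>i\<in>UNIV. v $ i *s axis i 1) \<in> vec.span S"
      by (intro vec.span_sum vec.span_scale assms)
    ultimately show ?thesis by simp
  qed
  then show ?thesis by blast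
qed

lemma quadric_at_coordinate_point:
  "quadric a (w0 - w1) w1 y1 y2 y3 = a * w0 + ((w0 - w1) * w1 - (y1 * y2 + y1 * y3 + y2 * y3))"
  by (simp add: quadric_def algebra_simps)

text \<open>The multiplier is \<open>u = s\<^sub>1 t\<^sub>1 - 12 t\<^sub>2\<close>: subtraction of \<open>u Q\<close> replaces \<open>s\<^sub>2\<close> by \<open>t\<^sub>2\<close>, and what
  remains has degree one in the coordinate \<open>a\<close>. The coordinates are \<open>w\<^sub>0 - w\<^sub>1\<close> and \<open>w\<^sub>1\<close> in order that
  the tangent hyperplane be \<open>w\<^sub>0 = 0\<close>.\<close>

lemma quartic_at_coordinate_point:
  "\<exists>u. quartic a (w0 - w1) w1 y1 y2 y3 - u * quadric a (w0 - w1) w1 y1 y2 y3 =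
     a * (2 * (y1 + y2 + y3) * (y1 * y2 + y1 * y3 + y2 * y3) + 9 * (y1 * y2 * y3)
       + 9 * ((w0 - w1) * w1) * (y1 + y2 + y3))
     + (w0 * (2 * (y1 + y2 + y3) * (y1 * y2 + y1 * y3 + y2 * y3) + 9 * (y1 * y2 * y3))
       - 12 * ((y1 * y2 + y1 * y3 + y2 * y3) * (y1 * y2 + y1 * y3 + y2 * y3)))"
proof -
  define t1 t2 t3 where "t1 = y1 + y2 + y3" and "t2 = y1 * y2 + y1 * y3 + y2 * y3" and "t3 = y1 * y2 * y3"
  define s1 s2 s3 where "s1 = a + w0" and "s2 = a * w0 + (w0 - w1) * w1" and "s3 = a * ((w0 - w1) * w1)"
  have "a + (w0 - w1) + w1 = s1" "a * (w0 - w1) + a * w1 + (w0 - w1) * w1 = s2" "a * (w0 - w1) * w1 = s3"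
    by (simp_all add: s1_def s2_def s3_def algebra_simps)
  then have F: "quartic a (w0 - w1) w1 y1 y2 y3 = s1 * t1 * (s2 + t2) + 9 * (s3 * t1 + s1 * t3) - 12 * s2 * t2"
    and Q: "quadric a (w0 - w1) w1 y1 y2 y3 = s2 - t2"
    unfolding quartic_def quadric_def Let_def t1_def t2_def t3_def by simp_all
  have "s1 * t1 * (s2 + t2) + 9 * (s3 * t1 + s1 * t3) - 12 * s2 * t2 - (s1 * t1 - 12 * t2) * (s2 - t2) =
     a * (2 * t1 * t2 + 9 * t3 + 9 * ((w0 - w1) * w1) * t1) + (w0 * (2 * t1 * t2 + 9 * t3) - 12 * (t2 * t2))"
    by (simp add: s1_def s3_def algebra_simps)
  then show ?thesis unfolding F Q t1_def t2_def t3_def by blast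
qed

lemma quadric_at_general_point:
  "quadric (k + w0 + w1) (k + w0 + w2) (k + w0 - w1 - w2) (k - w0 + w3) (k - w0 + w4) (k - w0 - w3 - w4) =
     (12 * k) * w0 + ((w3 * w3 + w3 * w4 + w4 * w4) - (w1 * w1 + w1 * w2 + w2 * w2))"
  by (simp add: quadric_def algebra_simps)

text \<open>In these coordinates the blocks have the means \<open>k + w\<^sub>0\<close> and \<open>k - w\<^sub>0\<close>, and the other
  coordinates measure the deviations from the means. The multiplier is \<open>u = 18 k w\<^sub>0\<close>; it cancels the quadratic
  terms of the quartic.\<close>

lemma quartic_at_general_point:
  "\<exists>u. quartic (k + w0 + w1) (k + w0 + w2) (k + w0 - w1 - w2) (k - w0 + w3) (k - w0 + w4) (k - w0 - w3 - w4)
     - u * quadric (k + w0 + w1) (k + w0 + w2) (k + w0 - w1 - w2) (k - w0 + w3) (k - w0 + w4) (k - w0 - w3 - w4) =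
     k * (54 * w0 * ((w3 * w3 + w3 * w4 + w4 * w4) - (w1 * w1 + w1 * w2 + w2 * w2))
       - 27 * (w1 * w2 * (w1 + w2) + w3 * w4 * (w3 + w4)))
     + (- 216 * (w0 * w0 * (w0 * w0))
        + 72 * (w0 * w0) * ((w1 * w1 + w1 * w2 + w2 * w2) + (w3 * w3 + w3 * w4 + w4 * w4))
        - 12 * ((w1 * w1 + w1 * w2 + w2 * w2) * (w3 * w3 + w3 * w4 + w4 * w4))
        + 27 * w0 * (w1 * w2 * (w1 + w2) - w3 * w4 * (w3 + w4)))"
proof -
  define A B where "A = k + w0" and "B = k - w0"
  define e d r p where "e = w1 * w1 + w1 * w2 + w2 * w2" and "d = w3 * w3 + w3 * w4 + w4 * w4"
    and "r = w1 * w2 * (w1 + w2)" and "p = w3 * w4 * (w3 + w4)"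
  have esym: "(A + u) + (A + v) + (A - u - v) = 3 * A"
    "(A + u) * (A + v) + (A + u) * (A - u - v) + (A + v) * (A - u - v) = 3 * (A * A) - (u * u + u * v + v * v)"
    "(A + u) * (A + v) * (A - u - v) = A * A * A - A * (u * u + u * v + v * v) - u * v * (u + v)" for A u v :: 'a
    by (simp_all add: algebra_simps)
  have F: "quartic (A + w1) (A + w2) (A - w1 - w2) (B + w3) (B + w4) (B - w3 - w4) =
     3 * A * (3 * B) * ((3 * (A * A) - e) + (3 * (B * B) - d))
     + 9 * ((A * A * A - A * e - r) * (3 * B) + 3 * A * (B * B * B - B * d - p))
     - 12 * (3 * (A * A) - e) * (3 * (B * B) - d)"
    and Q: "quadric (A + w1) (A + w2) (A - w1 - w2) (B + w3) (B + w4) (B - w3 - w4) =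
       (3 * (A * A) - e) - (3 * (B * B) - d)"
    unfolding quartic_def quadric_def Let_def esym e_def d_def r_def p_def by simp_all
  have "3 * A * (3 * B) * ((3 * (A * A) - e) + (3 * (B * B) - d))
     + 9 * ((A * A * A - A * e - r) * (3 * B) + 3 * A * (B * B * B - B * d - p))
     - 12 * (3 * (A * A) - e) * (3 * (B * B) - d) - (18 * k * w0) * ((3 * (A * A) - e) - (3 * (B * B) - d)) =
     k * (54 * w0 * (d - e) - 27 * (r + p))
     + (- 216 * (w0 * w0 * (w0 * w0)) + 72 * (w0 * w0) * (e + d) - 12 * (e * d) + 27 * w0 * (r - p))"
    unfolding A_def B_def by (simp add: algebra_simps)
  then show ?thesis
    unfolding A_def[symmetric] B_def[symmetric] F Q e_def[symmetric] d_def[symmetric]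
      r_def[symmetric] p_def[symmetric] by (intro exI[of _ "18 * k * w0"])
qed

section \<open>Smooth cubic surfaces\<close>

lemma homogeneous_products:
  "homogeneous 0 p \<Longrightarrow> homogeneous n q \<Longrightarrow> homogeneous n (p * q)"
  "homogeneous 1 p \<Longrightarrow> homogeneous 1 q \<Longrightarrow> homogeneous 2 (p * q)"
  "homogeneous 1 p \<Longrightarrow> homogeneous 2 q \<Longrightarrow> homogeneous 3 (p * q)"
  "homogeneous 2 p \<Longrightarrow> homogeneous 1 q \<Longrightarrow> homogeneous 3 (p * q)"
  "homogeneous 1 p \<Longrightarrow> homogeneous 3 q \<Longrightarrow> homogeneous 4 (p * q)"
  "homogeneous 3 p \<Longrightarrow> homogeneous 1 q \<Longrightarrow> homogeneous 4 (p * q)"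
  "homogeneous 2 p \<Longrightarrow> homogeneous 2 q \<Longrightarrow> homogeneous 4 (p * q)"
  by (erule (1) homogeneous_mult, simp)+

lemmas homogeneous_intros = homogeneous_products homogeneous_add homogeneous_minus homogeneous_uminus
  homogeneous_Var homogeneous_Const homogeneous_numeral homogeneous_0

definition coordinate_cubic :: "complex \<Rightarrow> 4 mpol" where
  "coordinate_cubic c = (let z = Var 0; y1 = Var 1; y2 = Var 2; y3 = Var 3 in
     Const c * (2 * (y1 + y2 + y3) * (y1 * y2 + y1 * y3 + y2 * y3) + 9 * (y1 * y2 * y3)
       + 9 * ((0 - z) * z) * (y1 + y2 + y3)))"

definition general_cubic :: "complex \<Rightarrow> 4 mpol" where
  "general_cubic c = (let w1 = Var 0; w2 = Var 1; w3 = Var 2; w4 = Var 3 in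
     Const c * (- (27 * (w1 * w2 * (w1 + w2) + w3 * w4 * (w3 + w4)))))"

lemma homogeneous_coordinate_cubic: "homogeneous 3 (coordinate_cubic c)"
  unfolding coordinate_cubic_def Let_def by (blast intro: homogeneous_intros)

lemma homogeneous_general_cubic: "homogeneous 3 (general_cubic c)"
  unfolding general_cubic_def Let_def by (blast intro: homogeneous_intros)

lemma vec_4_eq_0:
  assumes "v $ 0 = 0" "v $ 1 = 0" "v $ 2 = 0" "v $ 3 = 0"
  shows "v = (0 :: complex ^ 4)"
proof -
  have "\<forall>l\<in>{0, 1, 2, 3}. v $ l = 0" using assms by simp
  then show ?thesis unfolding vec_eq_iff UNIV_4[symmetric] by simp
qed

text \<open>Either \<open>t\<^sub>1 = 0\<close>, when all products \<open>y\<^sub>i y\<^sub>j\<close> agree, or \<open>z = 0\<close>. In the second case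
  the plane cubic \<open>2 t\<^sub>1 t\<^sub>2 + 9 t\<^sub>3\<close> is symmetric; two coordinates of a critical point agree, and the
  two equations that are left for \<open>(a, a, b)\<close> have only the trivial solution.\<close>

lemma coordinate_cubic_critical:
  fixes y1 y2 y3 z :: complex
  defines "t1 \<equiv> y1 + y2 + y3" and "t2 \<equiv> y1 * y2 + y1 * y3 + y2 * y3"
  assumes Z: "z * t1 = 0"
    and Y: "2 * t2 + 2 * t1 * (y2 + y3) + 9 * (y2 * y3) = 9 * z ^ 2"
      "2 * t2 + 2 * t1 * (y1 + y3) + 9 * (y1 * y3) = 9 * z ^ 2"
      "2 * t2 + 2 * t1 * (y1 + y2) + 9 * (y1 * y2) = 9 * z ^ 2"
  shows "z = 0 \<and> y1 = 0 \<and> y2 = 0 \<and> y3 = 0"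
proof (cases "t1 = 0")
  case True
  have Y': "2 * t2 + 9 * (y2 * y3) = 9 * z ^ 2" "2 * t2 + 9 * (y1 * y3) = 9 * z ^ 2"
      "2 * t2 + 9 * (y1 * y2) = 9 * z ^ 2"
    using Y True by simp_all
  have eq: "y2 * y3 = y1 * y3" "y1 * y3 = y1 * y2"
    using trans[OF Y'(1) Y'(2)[symmetric]] trans[OF Y'(2) Y'(3)[symmetric]]
    by (metis add_left_cancel mult_cancel_left zero_neq_numeral)+
  have y: "y1 * y2 = 0"
  proof (rule ccontr)
    assume nz: "y1 * y2 \<noteq> 0"
    then have "y1 * y3 \<noteq> 0" using eq(2) by simp
    then have "y2 = y1" "y3 = y2" using eq by simp_all
    with True nz show False by (simp add: t1_def)
  qed
  have "t2 = 0" unfolding t2_def eq y by simp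
  with Y(3) y True have "z = 0" by simp
  moreover have "y1 ^ 2 = y1 * t1 - y1 * y2 - y1 * y3" "y2 ^ 2 = y2 * t1 - y1 * y2 - y2 * y3"
    "y3 ^ 2 = y3 * t1 - y1 * y3 - y2 * y3"
    by (simp_all add: t1_def algebra_simps power2_eq_square)
  then have "y1 ^ 2 = 0" "y2 ^ 2 = 0" "y3 ^ 2 = 0" using y eq True by simp_all
  ultimately show ?thesis by simp
next
  case False
  with Z have z: "z = 0" by simp
  have two: "a = 0 \<and> b = 0"
    if "2 * (a * a + 2 * a * b) + 2 * (2 * a + b) * (a + b) + 9 * (a * b) = 0"
      "2 * (a * a + 2 * a * b) + 2 * (2 * a + b) * (2 * a) + 9 * (a * a) = 0" for a b :: complex
  proof -
    have A: "6 * a * a + 19 * a * b + 2 * b * b = 0" using that(1) by (simp add: algebra_simps)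
    have B: "a * (19 * a + 8 * b) = 0" using that(2) by (simp add: algebra_simps)
    show ?thesis
    proof (cases "a = 0")
      case False
      with B have b: "8 * b = - 19 * a" by (simp add: eq_neg_iff_add_eq_0 add.commute)
      have "64 * (6 * a * a + 19 * a * b + 2 * b * b) = 384 * a * a + 152 * a * (8 * b) + 2 * (8 * b) * (8 * b)"
        by (simp add: algebra_simps)
      also have "\<dots> = - 1782 * (a * a)" unfolding b by (simp add: algebra_simps)
      finally show ?thesis using A False by simp
    qed (use A in simp)
  qed
  have d: "(y1 - y2) * (2 * t1 + 9 * y3) = 0" "(y1 - y3) * (2 * t1 + 9 * y2) = 0"
    "(y2 - y3) * (2 * t1 + 9 * y1) = 0"
  proof -
    have "(y1 - y2) * (2 * t1 + 9 * y3) = (2 * t2 + 2 * t1 * (y1 + y3) + 9 * (y1 * y3)) - (2 * t2 + 2 * t1 * (y2 + y3) + 9 * (y2 * y3))"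
      "(y1 - y3) * (2 * t1 + 9 * y2) = (2 * t2 + 2 * t1 * (y1 + y2) + 9 * (y1 * y2)) - (2 * t2 + 2 * t1 * (y2 + y3) + 9 * (y2 * y3))"
      "(y2 - y3) * (2 * t1 + 9 * y1) = (2 * t2 + 2 * t1 * (y1 + y2) + 9 * (y1 * y2)) - (2 * t2 + 2 * t1 * (y1 + y3) + 9 * (y1 * y3))"
      by (simp_all add: algebra_simps)
    then show "(y1 - y2) * (2 * t1 + 9 * y3) = 0" "(y1 - y3) * (2 * t1 + 9 * y2) = 0"
      "(y2 - y3) * (2 * t1 + 9 * y1) = 0" by (simp_all only: Y) simp_all
  qed
  have "y1 = y2 \<or> y1 = y3 \<or> y2 = y3"
  proof (rule ccontr)
    assume "\<not> ?thesis"
    with d have "2 * t1 + 9 * y3 = 0" "2 * t1 + 9 * y2 = 0" "y2 \<noteq> y3" by auto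
    then show False by (metis add_left_cancel mult_left_cancel zero_neq_numeral)
  qed
  then show ?thesis
  proof (elim disjE)
    assume e: "y1 = y2"
    have "y2 = 0 \<and> y3 = 0" by (rule two) (use Y(1,3) in \<open>simp_all add: t1_def t2_def z e algebra_simps\<close>)
    with e z show ?thesis by simp
  next
    assume e: "y1 = y3"
    have "y3 = 0 \<and> y2 = 0" by (rule two) (use Y(1,2) in \<open>simp_all add: t1_def t2_def z e algebra_simps\<close>)
    with e z show ?thesis by simp
  next
    assume e: "y2 = y3"
    have "y3 = 0 \<and> y1 = 0" by (rule two) (use Y(1,2) in \<open>simp_all add: t1_def t2_def z e algebra_simps\<close>)
    with e z show ?thesis by simp
  qed
qed

lemma coordinate_cubic_gradient:
  fixes v :: "complex ^ 4"
  defines "t1 \<equiv> v$1 + v$2 + v$3" and "t2 \<equiv> v$1 * v$2 + v$1 * v$3 + v$2 * v$3"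
  shows "poly_eval (pdiff 0 (coordinate_cubic c)) v = - 18 * c * (v$0 * t1)"
    "poly_eval (pdiff 1 (coordinate_cubic c)) v = c * (2 * t2 + 2 * t1 * (v$2 + v$3) + 9 * (v$2 * v$3) - 9 * (v$0)^2)"
    "poly_eval (pdiff 2 (coordinate_cubic c)) v = c * (2 * t2 + 2 * t1 * (v$1 + v$3) + 9 * (v$1 * v$3) - 9 * (v$0)^2)"
    "poly_eval (pdiff 3 (coordinate_cubic c)) v = c * (2 * t2 + 2 * t1 * (v$1 + v$2) + 9 * (v$1 * v$2) - 9 * (v$0)^2)"
  unfolding coordinate_cubic_def Let_def t1_def t2_def
  by (simp_all add: pdiff_simps poly_eval_simps) (simp_all add: algebra_simps power2_eq_square)

lemma general_cubic_gradient:
  fixes v :: "complex ^ 4"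
  shows "poly_eval (pdiff 0 (general_cubic c)) v = - 27 * c * (v$1 * (2 * v$0 + v$1))"
    "poly_eval (pdiff 1 (general_cubic c)) v = - 27 * c * (v$0 * (2 * v$1 + v$0))"
    "poly_eval (pdiff 2 (general_cubic c)) v = - 27 * c * (v$3 * (2 * v$2 + v$3))"
    "poly_eval (pdiff 3 (general_cubic c)) v = - 27 * c * (v$2 * (2 * v$3 + v$2))"
  unfolding general_cubic_def Let_def
  by (simp_all add: pdiff_simps poly_eval_simps) (simp_all add: algebra_simps)

lemma smooth_hypersurfaceI:
  assumes "\<And>v. (\<And>i. poly_eval (pdiff i f) v = 0) \<Longrightarrow> v = 0"
  shows "smooth_hypersurface f"
  using assms unfolding smooth_hypersurface_def by blast

lemma smooth_coordinate_cubic: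
  assumes "c \<noteq> 0"
  shows "smooth_hypersurface (coordinate_cubic c)"
proof (rule smooth_hypersurfaceI)
  fix v :: "complex ^ 4"
  assume z: "poly_eval (pdiff i (coordinate_cubic c)) v = 0" for i
  have "v$0 = 0 \<and> v$1 = 0 \<and> v$2 = 0 \<and> v$3 = 0"
    using z[of 0] z[of 1] z[of 2] z[of 3] assms
    unfolding coordinate_cubic_gradient by (intro coordinate_cubic_critical) simp_all
  then show "v = 0" by (intro vec_4_eq_0) simp_all
qed

lemma smooth_general_cubic:
  assumes "c \<noteq> 0"
  shows "smooth_hypersurface (general_cubic c)"
proof (rule smooth_hypersurfaceI)
  fix v :: "complex ^ 4"
  assume z: "poly_eval (pdiff i (general_cubic c)) v = 0" for i
  have two: "a = 0 \<and> b = 0" if "b * (2 * a + b) = 0" "a * (2 * b + a) = 0" for a b :: complex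
  proof (cases "b = 0")
    case False
    with that(1) have "2 * a + b = 0" by simp
    then have b: "b = - (2 * a)" by (metis add.commute eq_neg_iff_add_eq_0)
    with that(2) have "a = 0" by simp
    with b show ?thesis by simp
  qed (use that in simp)
  have "v$0 = 0 \<and> v$1 = 0" "v$2 = 0 \<and> v$3 = 0"
    using z[of 0] z[of 1] z[of 2] z[of 3] assms unfolding general_cubic_gradient
    by (intro two; simp)+
  then show "v = 0" by (intro vec_4_eq_0) simp_all
qed

lemma coordinate_cubic_nonzero:
  assumes "c \<noteq> 0" shows "coordinate_cubic c \<noteq> 0"
proof
  assume "coordinate_cubic c = 0"
  then have "poly_eval (coordinate_cubic c) (\<chi> i. if i = 0 then 0 else 1) = 0"
    by (simp add: poly_eval_simps)
  with assms show False by (simp add: coordinate_cubic_def Let_def poly_eval_simps)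
qed

lemma general_cubic_nonzero:
  assumes "c \<noteq> 0" shows "general_cubic c \<noteq> 0"
proof
  assume "general_cubic c = 0"
  then have "poly_eval (general_cubic c) (\<chi> i. 1) = 0" by (simp add: poly_eval_simps)
  with assms show False by (simp add: general_cubic_def Let_def poly_eval_simps)
qed

section \<open>The tangent cones\<close>

definition chart_form :: "complex ^ 6 \<Rightarrow> (5 \<Rightarrow> complex ^ 6) \<Rightarrow> 6 \<Rightarrow> 5 mpol" where
  "chart_form p e j = Const (p $ j) + (\<Sum>k\<in>UNIV. Const (e k $ j) * Var k)"

lemma chart_ideal_pair:
  assumes "\<And>k. Var k \<in> range (poly_subst (chart_form p e))"
  shows "chart_ideal p e (ideal_gen {f, g}) =
    ideal_gen {poly_subst (chart_form p e) f, poly_subst (chart_form p e) g}"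
  unfolding chart_ideal_def chart_form_def[symmetric, abs_def]
  by (rule image_ideal_gen_pair[OF poly_subst_hom surj_poly_subst[OF assms]])

text \<open>The condition on the tangent cone of an ordinary triple point, separated from isolatedness.\<close>

definition has_cubic_tangent_cone :: "6 mpol set \<Rightarrow> complex ^ 6 \<Rightarrow> bool" where
  "has_cubic_tangent_cone I p \<longleftrightarrow>
     (\<exists>(e :: 5 \<Rightarrow> complex ^ 6) (L :: complex ^ 4 ^ 5) (c :: 4 mpol).
        centered_chart p e \<and> inj (\<lambda>y. L *v y) \<and>
        hypersurface_form 3 c \<and> smooth_hypersurface c \<and>
        tangent_cone_ideal (chart_ideal p e I) = embedded_cone_ideal L c)"

lemma has_cubic_tangent_coneI:
  fixes f2 g4 C :: "5 mpol"
  assumes span: "vec.span (insert p (range e)) = UNIV"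
    and surj: "\<And>k. Var k \<in> range (poly_subst (chart_form p e))"
    and f: "poly_subst (chart_form p e) f = Const a * Var 0 + f2"
    and g: "poly_subst (chart_form p e) g - u * poly_subst (chart_form p e) f = C + g4"
    and a: "a \<noteq> 0" and f2: "vanishes_to_order 2 f2" and g4: "vanishes_to_order 4 g4"
    and C: "homogeneous 3 C" and c: "drop_first C = c" "c \<noteq> 0" "homogeneous 3 c" "smooth_hypersurface c"
  shows "has_cubic_tangent_cone (ideal_gen {f, g}) p"
  unfolding has_cubic_tangent_cone_def
proof (intro exI conjI)
  show "centered_chart p e" using span by (simp add: centered_chart_def)
  show "inj (\<lambda>y. coordinate_embedding *v y)" by (rule coordinate_embedding_inj)
  show "hypersurface_form 3 c" "smooth_hypersurface c" using c by (simp_all add: hypersurface_form_def)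
  have "chart_ideal p e (ideal_gen {f, g}) = ideal_gen {Const a * Var 0 + f2, C + g4}"
    unfolding chart_ideal_pair[OF surj] f[symmetric] g[symmetric] ideal_gen_pair_change ..
  then show "tangent_cone_ideal (chart_ideal p e (ideal_gen {f, g})) = embedded_cone_ideal coordinate_embedding c"
    using tangent_cone_is_cubic_cone[OF a f2 g4 C c(1,2)] by simp
qed

lemma poly_subst_rangeI: "poly_subst f p = q \<Longrightarrow> q \<in> range (poly_subst f)"
  by blast

text \<open>The order of the variables is left open: the equations at the six coordinate points differ only
  by a permutation of the variables, and by the sign of the quadric if the blocks are exchanged.\<close>

lemma coordinate_point_tangent_cone:
  fixes i0 i1 i2 i3 i4 i5 :: 6
  assumes dist: "distinct [i0, i1, i2, i3, i4, i5]" and c: "c \<noteq> 0"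
  shows "has_cubic_tangent_cone
    (ideal_gen {quadric (Var i0) (Var i1) (Var i2) (Var i3) (Var i4) (Var i5),
                quartic (Var i0) (Var i1) (Var i2) (Var i3) (Var i4) (Var i5)}) (c *s axis i0 1)"
proof -
  define e :: "5 \<Rightarrow> complex ^ 6" where "e k = (if k = 0 then axis i1 1 else if k = 1 then axis i2 1 - axis i1 1
     else if k = 2 then axis i3 1 else if k = 3 then axis i4 1 else axis i5 1)" for k
  have e: "e 0 = axis i1 1" "e 1 = axis i2 1 - axis i1 1" "e 2 = axis i3 1" "e 3 = axis i4 1" "e 4 = axis i5 1"
    by (simp_all add: e_def)
  let ?p = "c *s axis i0 1"
  have CH: "Const 0 = (0 :: 5 mpol)" "Const 1 = (1 :: 5 mpol)" "Const (- 1) = (- 1 :: 5 mpol)"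
    by (simp_all add: hom_simps[OF Const_hom])
  have x: "chart_form ?p e i0 = Const c" "chart_form ?p e i1 = Var 0 - Var 1" "chart_form ?p e i2 = Var 1"
    "chart_form ?p e i3 = Var 2" "chart_form ?p e i4 = Var 3" "chart_form ?p e i5 = Var 4"
    using dist by (auto simp: chart_form_def sum_5 e axis_def CH)
  note S = poly_subst_Var[of "chart_form ?p e"] x hom_simps[OF poly_subst_hom]
  have "card {i0, i1, i2, i3, i4, i5} = CARD(6)" using dist by simp
  then have all: "UNIV = {i0, i1, i2, i3, i4, i5}" by (intro card_subset_eq[symmetric]) simp_all
  have f: "poly_subst (chart_form ?p e) (quadric (Var i0) (Var i1) (Var i2) (Var i3) (Var i4) (Var i5)) =
      Const c * Var 0 + ((Var 0 - Var 1) * Var 1 - (Var 2 * Var 3 + Var 2 * Var 4 + Var 3 * Var 4))"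
    by (simp only: hom_quadric[OF poly_subst_hom] S quadric_at_coordinate_point)
  obtain u where g: "poly_subst (chart_form ?p e) (quartic (Var i0) (Var i1) (Var i2) (Var i3) (Var i4) (Var i5))
      - u * poly_subst (chart_form ?p e) (quadric (Var i0) (Var i1) (Var i2) (Var i3) (Var i4) (Var i5)) =
     Const c * (2 * (Var 2 + Var 3 + Var 4) * (Var 2 * Var 3 + Var 2 * Var 4 + Var 3 * Var 4) + 9 * (Var 2 * Var 3 * Var 4)
       + 9 * ((Var 0 - Var 1) * Var 1) * (Var 2 + Var 3 + Var 4))
     + (Var 0 * (2 * (Var 2 + Var 3 + Var 4) * (Var 2 * Var 3 + Var 2 * Var 4 + Var 3 * Var 4) + 9 * (Var 2 * Var 3 * Var 4))
       - 12 * ((Var 2 * Var 3 + Var 2 * Var 4 + Var 3 * Var 4) * (Var 2 * Var 3 + Var 2 * Var 4 + Var 3 * Var 4)))"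
    unfolding hom_quadric[OF poly_subst_hom] hom_quartic[OF poly_subst_hom] S
    using quartic_at_coordinate_point by blast
  show ?thesis
  proof (rule has_cubic_tangent_coneI[OF _ _ f g c])
    let ?S = "vec.span (insert ?p (range e))"
    have base: "?p \<in> ?S" "e k \<in> ?S" for k by (simp_all add: vec.span_base)
    show "?S = UNIV"
    proof (rule vec_span_UNIV_I)
      fix i
      have "axis i0 1 = (1 / c) *s ?p" using c by simp
      then have "axis i0 1 \<in> ?S" by (metis base(1) vec.span_scale)
      moreover have "axis i1 1 \<in> ?S" "axis i3 1 \<in> ?S" "axis i4 1 \<in> ?S" "axis i5 1 \<in> ?S"
        using base(2)[of 0] base(2)[of 2] base(2)[of 3] base(2)[of 4] by (simp_all only: e)
      moreover have "axis i2 1 \<in> ?S"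
        using vec.span_add[OF base(2)[of 0] base(2)[of 1]] by (simp add: e)
      moreover have "i \<in> {i0, i1, i2, i3, i4, i5}" unfolding all[symmetric] by simp
      ultimately show "axis i 1 \<in> ?S" by blast
    qed
    show "Var k \<in> range (poly_subst (chart_form ?p e))" for k
    proof -
      have "k \<in> {0, 1, 2, 3, 4}" unfolding UNIV_5[symmetric] by simp
      moreover have "poly_subst (chart_form ?p e) (Var i1 + Var i2) = Var 0"
        "poly_subst (chart_form ?p e) (Var i2) = Var 1" "poly_subst (chart_form ?p e) (Var i3) = Var 2"
        "poly_subst (chart_form ?p e) (Var i4) = Var 3" "poly_subst (chart_form ?p e) (Var i5) = Var 4"
        by (simp_all add: S)
      note this[THEN poly_subst_rangeI]
      ultimately show ?thesis by (elim insertE) (simp_all only: empty_iff)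
    qed
    show "drop_first (Const c * (2 * (Var 2 + Var 3 + Var 4) * (Var 2 * Var 3 + Var 2 * Var 4 + Var 3 * Var 4) + 9 * (Var 2 * Var 3 * Var 4)
       + 9 * ((Var 0 - Var 1) * Var 1) * (Var 2 + Var 3 + Var 4))) = coordinate_cubic c"
      by (simp only: hom_simps[OF drop_first_hom] drop_first_simps coordinate_cubic_def Let_def)
  qed (rule vanishes_homogeneous[OF _ order_refl] smooth_coordinate_cubic[OF c] coordinate_cubic_nonzero[OF c]
      homogeneous_coordinate_cubic | blast intro: homogeneous_intros)+
qed

lemma general_point_tangent_cone:
  assumes c: "c \<noteq> 0"
  shows "has_cubic_tangent_cone (ideal_gen {Q6, F6}) (c *s (\<chi> i. 1))"
proof -
  \<comment> \<open>The first vector is transversal to the tangent hyperplane of the quadric; the four others preserve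
    the sum of each block.\<close>
  define e0 :: "complex ^ 6" where "e0 = (\<chi> i. if i = 0 \<or> i = 1 \<or> i = 2 then 1 else - 1)"
  define e :: "5 \<Rightarrow> complex ^ 6" where "e k = (if k = 0 then e0 else if k = 1 then axis 0 1 - axis 2 1
     else if k = 2 then axis 1 1 - axis 2 1 else if k = 3 then axis 3 1 - axis 5 1 else axis 4 1 - axis 5 1)" for k
  have e: "e 0 = e0" "e 1 = axis 0 1 - axis 2 1" "e 2 = axis 1 1 - axis 2 1"
    "e 3 = axis 3 1 - axis 5 1" "e 4 = axis 4 1 - axis 5 1"
    by (simp_all add: e_def)
  let ?p = "c *s (\<chi> i. 1) :: complex ^ 6"
  have CH: "Const 0 = (0 :: 5 mpol)" "Const 1 = (1 :: 5 mpol)" "Const (- 1) = (- 1 :: 5 mpol)"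
    by (simp_all add: hom_simps[OF Const_hom])
  have x: "chart_form ?p e 0 = Const c + Var 0 + Var 1" "chart_form ?p e 1 = Const c + Var 0 + Var 2"
    "chart_form ?p e 2 = Const c + Var 0 - Var 1 - Var 2" "chart_form ?p e 3 = Const c - Var 0 + Var 3"
    "chart_form ?p e 4 = Const c - Var 0 + Var 4" "chart_form ?p e 5 = Const c - Var 0 - Var 3 - Var 4"
    by (simp_all add: chart_form_def sum_5 e e0_def axis_def CH)
  note S = poly_subst_Var[of "chart_form ?p e"] x hom_simps[OF poly_subst_hom] poly_subst_Const
  have C12: "12 * Const c = Const (12 * c)" by (simp add: hom_simps[OF Const_hom])
  have f: "poly_subst (chart_form ?p e) Q6 = Const (12 * c) * Var 0
      + ((Var 3 * Var 3 + Var 3 * Var 4 + Var 4 * Var 4) - (Var 1 * Var 1 + Var 1 * Var 2 + Var 2 * Var 2))"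
    by (simp only: hom_quadric[OF poly_subst_hom] S quadric_at_general_point C12)
  obtain u where g: "poly_subst (chart_form ?p e) F6 - u * poly_subst (chart_form ?p e) Q6 =
     Const c * (54 * Var 0 * ((Var 3 * Var 3 + Var 3 * Var 4 + Var 4 * Var 4) - (Var 1 * Var 1 + Var 1 * Var 2 + Var 2 * Var 2))
       - 27 * (Var 1 * Var 2 * (Var 1 + Var 2) + Var 3 * Var 4 * (Var 3 + Var 4)))
     + (- 216 * (Var 0 * Var 0 * (Var 0 * Var 0))
        + 72 * (Var 0 * Var 0) * ((Var 1 * Var 1 + Var 1 * Var 2 + Var 2 * Var 2) + (Var 3 * Var 3 + Var 3 * Var 4 + Var 4 * Var 4))
        - 12 * ((Var 1 * Var 1 + Var 1 * Var 2 + Var 2 * Var 2) * (Var 3 * Var 3 + Var 3 * Var 4 + Var 4 * Var 4))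
        + 27 * Var 0 * (Var 1 * Var 2 * (Var 1 + Var 2) - Var 3 * Var 4 * (Var 3 + Var 4)))"
    unfolding hom_quadric[OF poly_subst_hom] hom_quartic[OF poly_subst_hom] S
    using quartic_at_general_point by blast
  have c12: "12 * c \<noteq> 0" using c by simp
  show ?thesis
  proof (rule has_cubic_tangent_coneI[OF _ _ f g c12])
    let ?S = "vec.span (insert ?p (range e))"
    have base: "?p \<in> ?S" "e k \<in> ?S" for k by (simp_all add: vec.span_base)
    note sp = vec.span_add vec.span_scale vec.span_diff base
    show "?S = UNIV"
    proof (rule vec_span_UNIV_I)
      fix i :: 6
      have "axis 0 1 = (1 / (6 * c)) *s ?p + (1 / 6) *s e 0 + (2 / 3) *s e 1 - (1 / 3) *s e 2"
        "axis 1 1 = (1 / (6 * c)) *s ?p + (1 / 6) *s e 0 + (2 / 3) *s e 2 - (1 / 3) *s e 1"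
        "axis 2 1 = (1 / (6 * c)) *s ?p + (1 / 6) *s e 0 - (1 / 3) *s e 1 - (1 / 3) *s e 2"
        "axis 3 1 = (1 / (6 * c)) *s ?p - (1 / 6) *s e 0 + (2 / 3) *s e 3 - (1 / 3) *s e 4"
        "axis 4 1 = (1 / (6 * c)) *s ?p - (1 / 6) *s e 0 + (2 / 3) *s e 4 - (1 / 3) *s e 3"
        "axis 5 1 = (1 / (6 * c)) *s ?p - (1 / 6) *s e 0 - (1 / 3) *s e 3 - (1 / 3) *s e 4"
        using c by (simp_all add: vec_eq_iff forall_6 e e0_def axis_def)
      then have "axis 0 1 \<in> ?S" "axis 1 1 \<in> ?S" "axis 2 1 \<in> ?S" "axis 3 1 \<in> ?S" "axis 4 1 \<in> ?S" "axis 5 1 \<in> ?S"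
        by (simp_all only:) (intro sp)+
      moreover have "i \<in> {0, 1, 2, 3, 4, 5}" unfolding UNIV_6[symmetric] by simp
      ultimately show "axis i 1 \<in> ?S" by blast
    qed
    have "Const (1 / 6) * Const 6 = (Const (1 / 6 * 6) :: 5 mpol)" "Const (1 / 3) * Const 3 = (Const (1 / 3 * 3) :: 5 mpol)"
      by (simp_all only: hom_simps(4)[OF Const_hom])
    then have sixth: "Const (1 / 6) * 6 = (1 :: 5 mpol)" "Const (1 / 3) * 3 = (1 :: 5 mpol)"
      by (simp_all add: hom_simps[OF Const_hom])
    show "Var k \<in> range (poly_subst (chart_form ?p e))" for k
    proof -
      have "k \<in> {0, 1, 2, 3, 4}" unfolding UNIV_5[symmetric] by simp
      moreover have "poly_subst (chart_form ?p e) (Const (1 / 6) * (Var 0 + Var 1 + Var 2 - Var 3 - Var 4 - Var 5)) = Const (1 / 6) * 6 * Var 0"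
        "poly_subst (chart_form ?p e) (Const (1 / 3) * (2 * Var 0 - Var 1 - Var 2)) = Const (1 / 3) * 3 * Var 1"
        "poly_subst (chart_form ?p e) (Const (1 / 3) * (2 * Var 1 - Var 0 - Var 2)) = Const (1 / 3) * 3 * Var 2"
        "poly_subst (chart_form ?p e) (Const (1 / 3) * (2 * Var 3 - Var 4 - Var 5)) = Const (1 / 3) * 3 * Var 3"
        "poly_subst (chart_form ?p e) (Const (1 / 3) * (2 * Var 4 - Var 3 - Var 5)) = Const (1 / 3) * 3 * Var 4"
        unfolding S by (simp_all only: mult.assoc) (simp_all add: algebra_simps)
      note this[unfolded sixth mult_1_left, THEN poly_subst_rangeI]
      ultimately show ?thesis by (elim insertE) (simp_all only: empty_iff)
    qed
    show "drop_first (Const c * (54 * Var 0 * ((Var 3 * Var 3 + Var 3 * Var 4 + Var 4 * Var 4) - (Var 1 * Var 1 + Var 1 * Var 2 + Var 2 * Var 2))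
       - 27 * (Var 1 * Var 2 * (Var 1 + Var 2) + Var 3 * Var 4 * (Var 3 + Var 4)))) = general_cubic c"
      unfolding hom_simps[OF drop_first_hom] drop_first_simps general_cubic_def Let_def by simp
  qed (rule vanishes_homogeneous[OF _ order_refl] smooth_general_cubic[OF c] general_cubic_nonzero[OF c]
      homogeneous_general_cubic | blast intro: homogeneous_intros)+
qed

lemma triple_point_tangent_cone:
  assumes "c \<noteq> 0"
  shows "has_cubic_tangent_cone (ideal_gen {Q6, F6}) (c *s triple_point k)"
proof (cases k)
  case None
  then show ?thesis using general_point_tangent_cone[OF assms] by (simp add: triple_point_def)
next
  case (Some i)
  have neg: "ideal_gen {- q, f} = ideal_gen {q, f}" for q f :: "6 mpol"
  proof (intro antisym ideal_gen_least ideal_gen_ideal)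
    have "- q \<in> ideal_gen {q, f}" by (rule ideal_gen_pairI[of _ "- 1" _ 0]) simp
    moreover have "q \<in> ideal_gen {- q, f}" by (rule ideal_gen_pairI[of _ "- 1" _ 0]) simp
    ultimately show "{- q, f} \<subseteq> ideal_gen {q, f}" "{q, f} \<subseteq> ideal_gen {- q, f}"
      by (simp_all add: ideal_gen_base)
  qed
  have x: "has_cubic_tangent_cone (ideal_gen {Q6, F6}) (c *s axis i 1)"
    if "distinct [i, i1, i2, i3, i4, i5]" "quadric (Var i) (Var i1) (Var i2) (Var i3) (Var i4) (Var i5) \<in> {Q6, - Q6}"
      "quartic (Var i) (Var i1) (Var i2) (Var i3) (Var i4) (Var i5) = F6" for i1 i2 i3 i4 i5
    using coordinate_point_tangent_cone[OF that(1) assms] that(2,3) neg by auto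
  have "has_cubic_tangent_cone (ideal_gen {Q6, F6}) (c *s axis i 1)"
  proof -
    have "i \<in> {0, 1, 2, 3, 4, 5}" unfolding UNIV_6[symmetric] by simp
    then show ?thesis
    proof (elim insertE)
      assume [simp]: "i = 0" show ?thesis by (rule x[of 1 2 3 4 5]) simp_all
    next
      assume [simp]: "i = 1" show ?thesis
        by (rule x[of 0 2 3 4 5]) (simp_all add: quadric_perm(1)[of "Var 1" "Var 0"] quartic_perm(1)[of "Var 1" "Var 0"])
    next
      assume [simp]: "i = 2" show ?thesis
        by (rule x[of 1 0 3 4 5]) (simp, simp_all add: quadric_def quartic_def Let_def ac_simps)
    next
      assume [simp]: "i = 3" show ?thesis
        by (rule x[of 4 5 0 1 2]) (simp, simp_all add: quadric_perm(5)[of "Var 3"] quartic_perm(5)[of "Var 3"])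
    next
      assume [simp]: "i = 4" show ?thesis
        by (rule x[of 3 5 0 1 2]) (simp, simp_all add: quadric_perm(1)[of "Var 4" "Var 3"] quartic_perm(1)[of "Var 4" "Var 3"]
            quadric_perm(5)[of "Var 3"] quartic_perm(5)[of "Var 3"])
    next
      assume [simp]: "i = 5"
      have "quadric (Var 5) (Var 4) (Var 3) (Var 0) (Var 1) (Var 2) = - Q6"
        by (simp add: quadric_def ac_simps)
      moreover have "quartic (Var 5) (Var 4) (Var 3) (Var 0) (Var 1) (Var 2) = quartic (Var 3) (Var 4) (Var 5) (Var 0) (Var 1) (Var (2::6))"
        by (simp add: quartic_def Let_def ac_simps)
      ultimately show ?thesis
        by (intro x[of 4 3 0 1 2]) (simp, simp_all add: quartic_perm(5)[of "Var 3"])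
    qed simp
  qed
  then show ?thesis by (simp add: Some triple_point_def)
qed

section \<open>Evaluation of polynomials over a ring\<close>

text \<open>The homomorphism on \<open>R[X]\<close> that extends \<open>h\<close> and sends \<open>X\<close> to \<open>s\<close>.\<close>

definition extend_hom :: "('a::comm_ring_1 \<Rightarrow> 'b::comm_ring_1) \<Rightarrow> 'b \<Rightarrow> 'a poly \<Rightarrow> 'b" where
  "extend_hom h s p = poly (map_poly h p) s"

lemma extend_hom_pCons:
  assumes "unital_ring_hom h"
  shows "extend_hom h s (pCons c p) = h c + s * extend_hom h s p"
  by (simp add: extend_hom_def map_poly_pCons hom_simps[OF assms])

lemma extend_hom_0: "extend_hom h s 0 = 0"
  by (simp add: extend_hom_def)

lemma extend_hom_hom:
  assumes h: "unital_ring_hom h"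
  shows "unital_ring_hom (extend_hom h s)"
proof (rule unital_ring_homI)
  note simps = extend_hom_pCons[OF h] extend_hom_0 hom_simps[OF h]
  show "extend_hom h s 1 = 1" by (simp add: one_pCons simps)
  show add: "extend_hom h s (p + q) = extend_hom h s p + extend_hom h s q" for p q
    by (induction p q rule: poly_induct2) (simp_all add: simps algebra_simps)
  have smult: "extend_hom h s (smult c p) = h c * extend_hom h s p" for c p
    by (induction p) (simp_all add: simps algebra_simps)
  show "extend_hom h s (p * q) = extend_hom h s p * extend_hom h s q" for p q
    by (induction p) (simp_all add: simps add smult algebra_simps)
qed

text \<open>A univariate polynomial over an infinite field that has only the value zero is zero, so every
  homomorphism of the family annihilates the coefficients.\<close>

lemma poly_map_separating:
  fixes p :: "'a::comm_ring_1 poly" and hs :: "('a \<Rightarrow> complex) set"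
  assumes hs: "\<And>h. h \<in> hs \<Longrightarrow> unital_ring_hom h" and sep: "\<And>r. (\<And>h. h \<in> hs \<Longrightarrow> h r = 0) \<Longrightarrow> r = 0"
    and p: "\<And>h s. h \<in> hs \<Longrightarrow> extend_hom h s p = 0"
  shows "p = 0"
proof (rule poly_eqI)
  fix n
  have "h (coeff p n) = 0" if "h \<in> hs" for h
  proof -
    have "map_poly h p = 0"
      using p[OF that] poly_all_0_iff_0[of "map_poly h p"] by (simp add: extend_hom_def)
    then have "coeff (map_poly h p) n = 0" by simp
    then show ?thesis by (simp add: coeff_map_poly hom_simps[OF hs[OF that]])
  qed
  then show "coeff p n = coeff 0 n" using sep by simp
qed

section \<open>A birational model\<close>

text \<open>The polynomial ring in \<open>a, b, c, d = x\<^sub>2, x\<^sub>3, y\<^sub>2, y\<^sub>3\<close>. Iterated univariate polynomials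
  over a field form a factorial ring (Gauss), in which irreducible elements are prime. With \<open>q = s\<^sub>2\<close> as a
  fifth variable this ring and the homogeneous coordinate ring of the quadric agree after inversion of
  \<open>(a + b) (c + d)\<close>.\<close>

type_synonym base = "complex poly poly poly poly"

definition base_hom :: "(complex \<Rightarrow> 'a::comm_ring_1) \<Rightarrow> 'a \<Rightarrow> 'a \<Rightarrow> 'a \<Rightarrow> 'a \<Rightarrow> base \<Rightarrow> 'a" where
  "base_hom h a b c d = extend_hom (extend_hom (extend_hom (extend_hom h a) b) c) d"

definition base_a :: base where "base_a = [:[:[:[:0, 1:]:]:]:]"
definition base_b :: base where "base_b = [:[:[:0, 1:]:]:]"
definition base_c :: base where "base_c = [:[:0, 1:]:]"
definition base_d :: base where "base_d = [:0, 1:]"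

lemma base_hom_hom: "unital_ring_hom h \<Longrightarrow> unital_ring_hom (base_hom h a b c d)"
  unfolding base_hom_def by (intro extend_hom_hom)

lemma base_hom_simps:
  assumes h: "unital_ring_hom h"
  shows "base_hom h a b c d base_a = a" "base_hom h a b c d base_b = b"
    "base_hom h a b c d base_c = c" "base_hom h a b c d base_d = d"
    "base_hom h a b c d [:[:[:[:z:]:]:]:] = h z"
proof -
  have 1: "unital_ring_hom (extend_hom h a)" by (rule extend_hom_hom[OF h])
  have 2: "unital_ring_hom (extend_hom (extend_hom h a) b)" by (rule extend_hom_hom[OF 1])
  have 3: "unital_ring_hom (extend_hom (extend_hom (extend_hom h a) b) c)" by (rule extend_hom_hom[OF 2])
  show "base_hom h a b c d base_a = a" "base_hom h a b c d base_b = b"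
    "base_hom h a b c d base_c = c" "base_hom h a b c d base_d = d"
    "base_hom h a b c d [:[:[:[:z:]:]:]:] = h z"
    unfolding base_hom_def base_a_def base_b_def base_c_def base_d_def
    by (simp_all add: extend_hom_pCons[OF h] extend_hom_pCons[OF 1] extend_hom_pCons[OF 2] extend_hom_pCons[OF 3]
        extend_hom_0 hom_simps[OF h] hom_simps[OF 1] hom_simps[OF 2] hom_simps[OF 3])
qed

lemma base_separating:
  assumes "\<And>a b c d. base_hom id a b c d r = (0 :: complex)"
  shows "r = 0"
proof -
  let ?h1 = "{extend_hom id a | a :: complex. True}"
  let ?h2 = "{extend_hom h b | h b. h \<in> ?h1}"
  let ?h3 = "{extend_hom h c | h c. h \<in> ?h2}"
  note id = unital_ring_hom_id[where 'a = complex]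
  have h1: "unital_ring_hom h" if "h \<in> ?h1" for h using that extend_hom_hom[OF id] by blast
  have h2: "unital_ring_hom h" if "h \<in> ?h2" for h using that extend_hom_hom[OF h1] by blast
  have h3: "unital_ring_hom h" if "h \<in> ?h3" for h using that extend_hom_hom[OF h2] by blast
  have s1: "r = 0" if "\<And>h. h \<in> ?h1 \<Longrightarrow> h r = 0" for r
    by (rule poly_map_separating[of "{id}"]) (use id that in auto)
  have s2: "r = 0" if "\<And>h. h \<in> ?h2 \<Longrightarrow> h r = 0" for r
    by (rule poly_map_separating[of ?h1]) (fact h1, rule s1, assumption, use that in blast)
  have s3: "r = 0" if "\<And>h. h \<in> ?h3 \<Longrightarrow> h r = 0" for r
    by (rule poly_map_separating[of ?h2]) (fact h2, rule s2, assumption, use that in blast)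
  show ?thesis
    by (rule poly_map_separating[of ?h3])
      (fact h3, rule s3, assumption, use assms in \<open>auto simp: base_hom_def\<close>)
qed

text \<open>Substituting \<open>x\<^sub>1 = (q - a b) / (a + b)\<close> and \<open>y\<^sub>1 = (q - c d) / (c + d)\<close> into
  \<open>(a + b) (c + d) F\<close> gives \<open>2 q\<^sup>3 + h\<^sub>2 q\<^sup>2 + h\<^sub>1 q + h\<^sub>0\<close> with these coefficients.\<close>

definition model_coeffs :: "'a::comm_ring_1 \<Rightarrow> 'a \<Rightarrow> 'a \<Rightarrow> 'a \<Rightarrow> 'a \<times> 'a \<times> 'a" where
  "model_coeffs a b c d =
    (let p1 = a + b; p2 = a * b; r1 = c + d; r2 = c * d; M = p1 * p1 - p2; N = r1 * r1 - r2 in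
     (- 9 * (p2 * p2 * N + r2 * r2 * M),
      2 * M * N + 9 * (p2 * (N - p2) + r2 * (M - r2)),
      2 * (M + N) - 12 * p1 * r1 + 9 * (p2 + r2)))"

definition model_cubic :: "base poly" where
  "model_cubic = (case model_coeffs base_a base_b base_c base_d of (h0, h1, h2) \<Rightarrow> [:h0, h1, h2, 2:])"

lemma hom_model_coeffs:
  "unital_ring_hom h \<Longrightarrow> model_coeffs (h a) (h b) (h c) (h d) = map_prod h (map_prod h h) (model_coeffs a b c d)"
  by (simp add: model_coeffs_def Let_def hom_simps)

lemma degree_model_cubic: "degree model_cubic = 3" "lead_coeff model_cubic = 2"
  by (simp_all add: model_cubic_def split: prod.split)

text \<open>The cubic for \<open>a = 1\<close>, \<open>b = t\<close>, \<open>c = 1\<close>, \<open>d = 0\<close>. A root divides the constant coefficient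
  \<open>- 9 t\<^sup>2\<close>, so it has degree at most two, and comparison of coefficients excludes every such polynomial.\<close>

lemma specialised_cubic_no_root:
  fixes w :: "complex poly"
  shows "2 * w ^ 3 + [:- 8, - 1, 2:] * w ^ 2 + [:2, 11, - 7:] * w + [:0, 0, - 9:] \<noteq> 0"
proof
  assume eq: "2 * w ^ 3 + [:- 8, - 1, 2:] * w ^ 2 + [:2, 11, - 7:] * w + [:0, 0, - 9:] = 0"
  have "2 * w ^ 3 + A * w ^ 2 + B * w = w * (2 * w ^ 2 + A * w + B)" for A B
    by (simp add: algebra_simps power2_eq_square power3_eq_cube)
  with eq have "w * (2 * w ^ 2 + [:- 8, - 1, 2:] * w + [:2, 11, - 7:]) + [:0, 0, - 9:] = 0" by metis
  then have "w * (2 * w ^ 2 + [:- 8, - 1, 2:] * w + [:2, 11, - 7:]) = - [:0, 0, - 9:]"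
    by (simp only: eq_neg_iff_add_eq_0)
  then have "[:0, 0, 9:] = w * (2 * w ^ 2 + [:- 8, - 1, 2:] * w + [:2, 11, - 7:])" by simp
  then have "w dvd [:0, 0, 9:]" by (rule dvdI)
  then have "degree w \<le> degree [:0, 0, 9 :: complex:]" by (rule dvd_imp_degree_le) simp
  then have deg: "degree w \<le> 2" by simp
  define w0 w1 w2 where "w0 = coeff w 0" and "w1 = coeff w 1" and "w2 = coeff w 2"
  have w: "w = [:w0, w1, w2:]"
  proof (rule poly_eqI)
    fix n
    show "coeff w n = coeff [:w0, w1, w2:] n"
      using deg by (cases "n \<le> 2")
        (auto simp: w0_def w1_def w2_def coeff_pCons coeff_eq_0 numeral_2_eq_2 le_Suc_eq split: nat.split)
  qed
  let ?E = "2 * w ^ 3 + [:- 8, - 1, 2:] * w ^ 2 + [:2, 11, - 7:] * w + [:0, 0, - 9:]"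
  have E: "?E = [:2 * w0 ^ 3 - 8 * w0 ^ 2 + 2 * w0,
      6 * w0 ^ 2 * w1 - 16 * w0 * w1 - w0 ^ 2 + 2 * w1 + 11 * w0,
      6 * w0 ^ 2 * w2 + 6 * w0 * w1 ^ 2 - 8 * (w1 ^ 2 + 2 * w0 * w2) - 2 * w0 * w1 + 2 * w0 ^ 2 + 2 * w2 + 11 * w1 - 7 * w0 - 9,
      12 * w0 * w1 * w2 + 2 * w1 ^ 3 - 16 * w1 * w2 - (w1 ^ 2 + 2 * w0 * w2) + 4 * w0 * w1 + 11 * w2 - 7 * w1,
      6 * w0 * w2 ^ 2 + 6 * w1 ^ 2 * w2 - 8 * w2 ^ 2 - 2 * w1 * w2 + 2 * (w1 ^ 2 + 2 * w0 * w2) - 7 * w2,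
      6 * w1 * w2 ^ 2 - w2 ^ 2 + 4 * w1 * w2, 2 * w2 ^ 3 + 2 * w2 ^ 2:]"
    unfolding w power2_eq_square power3_eq_cube numeral_poly by (simp add: algebra_simps)
  have e: "2 * w0 ^ 3 - 8 * w0 ^ 2 + 2 * w0 = 0"
      "6 * w0 ^ 2 * w1 - 16 * w0 * w1 - w0 ^ 2 + 2 * w1 + 11 * w0 = 0"
      "6 * w0 ^ 2 * w2 + 6 * w0 * w1 ^ 2 - 8 * (w1 ^ 2 + 2 * w0 * w2) - 2 * w0 * w1 + 2 * w0 ^ 2 + 2 * w2 + 11 * w1 - 7 * w0 - 9 = 0"
      "6 * w0 * w2 ^ 2 + 6 * w1 ^ 2 * w2 - 8 * w2 ^ 2 - 2 * w1 * w2 + 2 * (w1 ^ 2 + 2 * w0 * w2) - 7 * w2 = 0"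
      "6 * w1 * w2 ^ 2 - w2 ^ 2 + 4 * w1 * w2 = 0" "2 * w2 ^ 3 + 2 * w2 ^ 2 = 0"
    using eq unfolding E by (simp_all only: pCons_eq_0_iff)
  have "2 * (w2 * w2) * (w2 + 1) = 0" using e(6) by (simp add: power2_eq_square power3_eq_cube algebra_simps)
  then consider "w2 = 0" | "w2 = - 1" by (auto simp: eq_neg_iff_add_eq_0)
  then show False
  proof cases
    case 1
    with e(4) have w1: "w1 = 0" by simp
    have "w0 * (11 - w0) = 0" using e(2) 1 w1 by (simp add: power2_eq_square algebra_simps)
    then have "w0 = 0 \<or> w0 = 11" by auto
    with e(3) 1 w1 show False by auto
  next
    case 2
    with e(5) have "2 * w1 = 1" by simp
    then have w1: "w1 = 1 / 2" by (simp add: field_simps)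
    with e(4) 2 have "2 * w0 = 1" by (simp add: power2_eq_square)
    then have "w0 = 1 / 2" by (simp add: field_simps)
    with e(1) show False by (simp add: power2_eq_square power3_eq_cube)
  qed
qed

lemma model_cubic_no_root: "poly model_cubic r \<noteq> 0"
proof
  assume root: "poly model_cubic r = 0"
  \<comment> \<open>Specialisation to \<open>a = 1, b = t, c = 1, d = 0\<close>.\<close>
  define s where "s = base_hom (\<lambda>z. [:z:]) 1 [:0, 1:] 1 (0 :: complex poly)"
  have h: "unital_ring_hom (\<lambda>z :: complex. [:z:])"
    by (rule unital_ring_homI) (simp_all add: one_pCons)
  have s: "unital_ring_hom s" unfolding s_def by (rule base_hom_hom[OF h])
  obtain h0 h1 h2 where H: "model_coeffs base_a base_b base_c base_d = (h0, h1, h2)" by (metis prod_cases3)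
  have "(s h0, s h1, s h2) = model_coeffs (s base_a) (s base_b) (s base_c) (s base_d)"
    by (simp add: hom_model_coeffs[OF s] H)
  also have "\<dots> = model_coeffs 1 [:0, 1:] 1 0" by (simp add: s_def base_hom_simps[OF h])
  also have "\<dots> = ([:0, 0, - 9:], [:2, 11, - 7:], [:- 8, - 1, 2:])"
    by (simp add: model_coeffs_def Let_def one_pCons numeral_poly)
  finally have sh: "s h0 = [:0, 0, - 9:]" "s h1 = [:2, 11, - 7:]" "s h2 = [:- 8, - 1, 2:]" by simp_all
  have "h0 + r * (h1 + r * (h2 + r * 2)) = 0" using root by (simp add: model_cubic_def H)
  then have "s (h0 + r * (h1 + r * (h2 + r * 2))) = s 0" by simp
  then have "s h0 + s r * (s h1 + s r * (s h2 + s r * 2)) = 0" by (simp only: hom_simps[OF s])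
  then show False
    using specialised_cubic_no_root[of "s r"] unfolding sh
    by (simp add: algebra_simps power2_eq_square power3_eq_cube)
qed

lemma base_two_unit: "(2 :: base) dvd 1"
proof
  have "([:[:[:[:2:]:]:]:] :: base) = 2" by (simp add: numeral_poly)
  then show "1 = (2 :: base) * [:[:[:[:1 / 2:]:]:]:]" by (simp add: one_pCons numeral_poly)
qed

lemma degree_one_root:
  fixes f :: "'a::idom poly"
  assumes "degree f = 1" "lead_coeff f dvd 1"
  shows "\<exists>r. poly f r = 0"
proof -
  obtain v where v: "1 = lead_coeff f * v" using assms(2) by (rule dvdE)
  have f: "f = [:coeff f 0, lead_coeff f:]"
    using assms(1) by (intro poly_eqI) (auto simp: coeff_pCons coeff_eq_0 split: nat.split)
  have "poly f (- coeff f 0 * v) = coeff f 0 - coeff f 0 * (lead_coeff f * v)"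
    by (subst f) (simp add: algebra_simps)
  then show ?thesis using v by auto
qed

text \<open>A proper factorisation of a cubic polynomial with invertible leading coefficient contains a factor of
  degree one, hence a root.\<close>

lemma prime_model_cubic: "prime_elem model_cubic"
proof (rule irreducible_imp_prime_elem)
  have lc: "lead_coeff f dvd 1 \<and> lead_coeff g dvd 1" if "model_cubic = f * g" for f g
  proof -
    have "lead_coeff f * lead_coeff g dvd (1 :: base)"
      using base_two_unit degree_model_cubic(2) unfolding that lead_coeff_mult by (simp only:)
    then show ?thesis by (metis dvd_mult_left dvd_mult_right)
  qed
  have unit: "f dvd 1" if fg: "model_cubic = f * g" and deg: "degree f = 0" for f g
  proof -
    obtain k where k: "f = [:k:]" using deg by (rule degree_eq_zeroE)
    have "k dvd 1" using lc[OF fg] by (simp add: k)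
    then show ?thesis by (simp add: k is_unit_const_poly_iff)
  qed
  have noroot: False if fg: "model_cubic = f * g" and deg: "degree f = 1" for f g
  proof -
    obtain r where "poly f r = 0" using degree_one_root[OF deg] lc[OF fg] by blast
    moreover have "poly model_cubic r = poly f r * poly g r" by (simp only: fg poly_mult)
    ultimately show False using model_cubic_no_root[of r] by simp
  qed
  show "irreducible model_cubic"
  proof (rule irreducibleI)
    show nz: "model_cubic \<noteq> 0" using degree_model_cubic by auto
    show "\<not> model_cubic dvd 1"
    proof
      assume "model_cubic dvd 1"
      then have "degree model_cubic \<le> degree (1 :: base poly)" by (rule dvd_imp_degree_le) simp
      then show False using degree_model_cubic by simp
    qed
    fix f g assume fg: "model_cubic = f * g"
    then have "f \<noteq> 0" "g \<noteq> 0" using nz by auto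
    then have "degree (f * g) = degree f + degree g" by (rule degree_mult_eq)
    then have "degree f + degree g = 3" using degree_model_cubic(1) unfolding fg by simp
    then consider "degree f = 0" | "degree f = 1" | "degree g = 1" | "degree g = 0" by arith
    then show "f dvd 1 \<or> g dvd 1"
      by cases (use unit[OF fg] noroot[OF fg] unit[of g f] noroot[of g f] fg in \<open>auto simp: mult.commute\<close>)
  qed
qed

section \<open>The threefold is integral\<close>

text \<open>The variable \<open>q\<close> is represented by \<open>s\<^sub>2\<close>; modulo the quadric this is also \<open>t\<^sub>2\<close>.\<close>

definition lift :: "base poly \<Rightarrow> 6 mpol" where
  "lift = extend_hom (base_hom Const (Var 1) (Var 2) (Var 4) (Var 5))
     (Var 0 * Var 1 + Var 0 * Var 2 + Var 1 * Var 2)"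

definition base_denom :: base where "base_denom = (base_a + base_b) * (base_c + base_d)"

abbreviation denom6 :: "6 mpol" where "denom6 \<equiv> (Var 1 + Var 2) * (Var 4 + Var 5)"

lemma lift_hom: "unital_ring_hom lift"
  unfolding lift_def by (intro extend_hom_hom base_hom_hom Const_hom)

lemma lift_const: "lift [:r:] = base_hom Const (Var 1) (Var 2) (Var 4) (Var 5) r"
  by (simp add: lift_def extend_hom_pCons[OF base_hom_hom[OF Const_hom]] extend_hom_0)

lemma lift_simps:
  "lift [:base_a:] = Var 1" "lift [:base_b:] = Var 2" "lift [:base_c:] = Var 4" "lift [:base_d:] = Var 5"
  "lift [:base_denom:] = denom6" "lift [:[:[:[:[:z:]:]:]:]:] = Const z"
  "lift [:0, 1:] = Var 0 * Var 1 + Var 0 * Var 2 + Var 1 * Var 2"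
proof -
  have h: "unital_ring_hom (base_hom Const (Var 1) (Var 2) (Var 4) (Var (5::6)))"
    by (rule base_hom_hom[OF Const_hom])
  show "lift [:base_a:] = Var 1" "lift [:base_b:] = Var 2" "lift [:base_c:] = Var 4" "lift [:base_d:] = Var 5"
    "lift [:base_denom:] = denom6" "lift [:[:[:[:[:z:]:]:]:]:] = Const z"
    by (simp_all add: lift_const base_denom_def hom_simps[OF h] base_hom_simps[OF Const_hom])
  show "lift [:0, 1:] = Var 0 * Var 1 + Var 0 * Var 2 + Var 1 * Var 2"
    by (simp add: lift_def extend_hom_pCons[OF h] extend_hom_0 hom_simps[OF h])
qed

lemma lift_model_cubic:
  "lift model_cubic = (let q = Var 0 * Var 1 + Var 0 * Var 2 + Var 1 * Var 2 in
     case model_coeffs (Var 1) (Var 2) (Var 4) (Var 5) of (h0, h1, h2) \<Rightarrow> h0 + q * (h1 + q * (h2 + q * 2)))"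
proof -
  let ?h = "base_hom Const (Var 1) (Var 2) (Var 4) (Var (5::6))"
  have h: "unital_ring_hom ?h" by (rule base_hom_hom[OF Const_hom])
  have "model_coeffs (?h base_a) (?h base_b) (?h base_c) (?h base_d) =
      map_prod ?h (map_prod ?h ?h) (model_coeffs base_a base_b base_c base_d)"
    by (rule hom_model_coeffs[OF h])
  then have "model_coeffs (Var 1) (Var 2) (Var 4) (Var 5) =
      map_prod ?h (map_prod ?h ?h) (model_coeffs base_a base_b base_c base_d)"
    by (simp only: base_hom_simps[OF Const_hom])
  then show ?thesis
    by (simp add: lift_def model_cubic_def extend_hom_pCons[OF h] extend_hom_0 hom_simps[OF h] Let_def split: prod.split)
qed

lemma ideal_gen_singletonI: "x = a * f \<Longrightarrow> x \<in> ideal_gen {f}"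
  by (simp add: ideal_gen_singleton)

text \<open>With \<open>p\<^sub>1 = x\<^sub>2 + x\<^sub>3\<close>, \<open>r\<^sub>1 = y\<^sub>2 + y\<^sub>3\<close> and so on, the products \<open>p\<^sub>1 s\<^sub>1\<close>, \<open>p\<^sub>1 s\<^sub>3\<close>,
  \<open>r\<^sub>1 t\<^sub>1\<close>, \<open>r\<^sub>1 t\<^sub>3\<close> are polynomials in \<open>q\<close> and the last two coordinates of each block, up to
  multiples of the quadric.\<close>

lemma model_identity:
  fixes x1 x2 x3 y1 y2 y3 :: "'a::comm_ring_1"
  defines "q \<equiv> x1 * x2 + x1 * x3 + x2 * x3"
  shows "\<exists>u. (x2 + x3) * (y2 + y3) * quartic x1 x2 x3 y1 y2 y3
    - (case model_coeffs x2 x3 y2 y3 of (h0, h1, h2) \<Rightarrow> h0 + q * (h1 + q * (h2 + q * 2)))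
    = u * quadric x1 x2 x3 y1 y2 y3"
proof -
  define p1 p2 r1 r2 where "p1 = x2 + x3" and "p2 = x2 * x3" and "r1 = y2 + y3" and "r2 = y2 * y3"
  define z where "z = quadric x1 x2 x3 y1 y2 y3"
  define A B where "A = q + p1 * p1 - p2" and "B = q + r1 * r1 - r2"
  have s: "p1 * (x1 + x2 + x3) = A" "p1 * (x1 * x2 * x3) = p2 * (q - p2)"
    by (simp_all add: p1_def p2_def A_def q_def algebra_simps)
  have t: "r1 * (y1 + y2 + y3) = B - z" "r1 * (y1 * y2 * y3) = r2 * (q - r2 - z)"
    by (simp_all add: r1_def r2_def B_def q_def z_def quadric_def algebra_simps)
  have t2: "y1 * y2 + y1 * y3 + y2 * y3 = q - z" by (simp add: q_def z_def quadric_def)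
  have "p1 * r1 * quartic x1 x2 x3 y1 y2 y3 =
     (p1 * (x1 + x2 + x3)) * (r1 * (y1 + y2 + y3)) * (q + (y1 * y2 + y1 * y3 + y2 * y3))
     + 9 * ((p1 * (x1 * x2 * x3)) * (r1 * (y1 + y2 + y3)) + (p1 * (x1 + x2 + x3)) * (r1 * (y1 * y2 * y3)))
     - 12 * p1 * r1 * q * (y1 * y2 + y1 * y3 + y2 * y3)"
  proof -
    define s1 s3 t1 t2 t3 where "s1 = x1 + x2 + x3" and "s3 = x1 * x2 * x3" and "t1 = y1 + y2 + y3"
      and "t2 = y1 * y2 + y1 * y3 + y2 * y3" and "t3 = y1 * y2 * y3"
    show ?thesis unfolding quartic_def Let_def q_def[symmetric] s1_def[symmetric] s3_def[symmetric]
        t1_def[symmetric] t2_def[symmetric] t3_def[symmetric] by (simp add: algebra_simps)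
  qed
  also have "\<dots> = A * (B - z) * (q + (q - z)) + 9 * (p2 * (q - p2) * (B - z) + A * (r2 * (q - r2 - z)))
      - 12 * p1 * r1 * q * (q - z)"
    by (simp only: s t t2)
  finally have F: "p1 * r1 * quartic x1 x2 x3 y1 y2 y3 = \<dots>" .
  have H: "(case model_coeffs x2 x3 y2 y3 of (h0, h1, h2) \<Rightarrow> h0 + q * (h1 + q * (h2 + q * 2))) =
     2 * A * B * q + 9 * (p2 * (q - p2) * B + A * (r2 * (q - r2))) - 12 * p1 * r1 * q * q"
    unfolding model_coeffs_def Let_def p1_def[symmetric] p2_def[symmetric] r1_def[symmetric] r2_def[symmetric]
    by (simp add: A_def B_def algebra_simps)
  have "p1 * r1 * quartic x1 x2 x3 y1 y2 y3
    - (case model_coeffs x2 x3 y2 y3 of (h0, h1, h2) \<Rightarrow> h0 + q * (h1 + q * (h2 + q * 2))) =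
    (- 2 * A * q - A * B + A * z - 9 * (p2 * (q - p2)) - 9 * A * r2 + 12 * p1 * r1 * q) * z"
    unfolding F H by (simp add: algebra_simps)
  then show ?thesis unfolding p1_def r1_def z_def by blast
qed

lemma denom_quartic_cong: "denom6 * F6 - lift model_cubic \<in> ideal_gen {Q6}"
proof -
  obtain u where "denom6 * F6 - lift model_cubic = u * Q6"
    using model_identity[of "Var 1" "Var 2" "Var 4" "Var 5" "Var 0" "Var 3"]
    unfolding lift_model_cubic Let_def by blast
  then show ?thesis by (rule ideal_gen_singletonI)
qed

lemma ideal_cong_mult:
  assumes I: "is_ideal I" and "a - b \<in> I" "c - d \<in> I"
  shows "a * c - b * d \<in> I"
proof -
  have "a * c - b * d = (a - b) * c + b * (c - d)" by (simp add: algebra_simps)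
  then show ?thesis using assms by (simp only: is_idealD[OF I])
qed

text \<open>Multiplication by the denominators removes \<open>x\<^sub>1\<close> and \<open>y\<^sub>1\<close> modulo the quadric.\<close>

lemma lift_exists: "\<exists>n b. denom6 ^ n * f - lift b \<in> ideal_gen {Q6}"
proof (induction f rule: mpol_induct)
  note I = ideal_gen_ideal[of "{Q6}"]
  {
    case (Const c)
    have "denom6 ^ 0 * Const c - lift [:[:[:[:[:c:]:]:]:]:] = 0" by (simp add: lift_simps)
    then show ?case by (metis is_idealD(1)[OF I])
  next
    case (Var i)
    note L = hom_simps[OF lift_hom] lift_simps
    have "i \<in> {0, 1, 2, 3, 4, 5}" unfolding UNIV_6[symmetric] by simp
    then show ?case
    proof (elim insertE)
      assume [simp]: "i = 0"
      have "denom6 ^ 1 * Var 0 - lift (([:base_c:] + [:base_d:]) * ([:0, 1:] - [:base_a:] * [:base_b:])) = 0"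
        unfolding L by (simp add: algebra_simps)
      then show ?case unfolding \<open>i = 0\<close> by (metis is_idealD(1)[OF I])
    next
      assume [simp]: "i = 3"
      have "denom6 ^ 1 * Var 3 - lift (([:base_a:] + [:base_b:]) * ([:0, 1:] - [:base_c:] * [:base_d:])) = (- (Var 1 + Var 2)) * Q6"
        unfolding L quadric_def by (simp add: algebra_simps)
      then show ?case unfolding \<open>i = 3\<close> by (metis ideal_gen_singletonI)
    next
      assume [simp]: "i = 1"
      have "denom6 ^ 0 * Var 1 - lift [:base_a:] = 0" by (simp add: lift_simps)
      then show ?case unfolding \<open>i = 1\<close> by (metis is_idealD(1)[OF I])
    next
      assume [simp]: "i = 2"
      have "denom6 ^ 0 * Var 2 - lift [:base_b:] = 0" by (simp add: lift_simps)
      then show ?case unfolding \<open>i = 2\<close> by (metis is_idealD(1)[OF I])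
    next
      assume [simp]: "i = 4"
      have "denom6 ^ 0 * Var 4 - lift [:base_c:] = 0" by (simp add: lift_simps)
      then show ?case unfolding \<open>i = 4\<close> by (metis is_idealD(1)[OF I])
    next
      assume [simp]: "i = 5"
      have "denom6 ^ 0 * Var 5 - lift [:base_d:] = 0" by (simp add: lift_simps)
      then show ?case unfolding \<open>i = 5\<close> by (metis is_idealD(1)[OF I])
    qed simp
  next
    case (add f g)
    then obtain n b m c where nb: "denom6 ^ n * f - lift b \<in> ideal_gen {Q6}"
      and mc: "denom6 ^ m * g - lift c \<in> ideal_gen {Q6}" by blast
    have "denom6 ^ (n + m) * (f + g) - lift ([:base_denom:] ^ m * b + [:base_denom:] ^ n * c)
      = denom6 ^ m * (denom6 ^ n * f - lift b) + denom6 ^ n * (denom6 ^ m * g - lift c)"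
      unfolding hom_simps[OF lift_hom] lift_simps by (simp only: power_add ring_distribs ac_simps) (simp add: algebra_simps)
    also have "\<dots> \<in> ideal_gen {Q6}" by (intro is_idealD(2,3)[OF I] nb mc)
    finally show ?case by blast
  next
    case (mult f g)
    then obtain n b m c where nb: "denom6 ^ n * f - lift b \<in> ideal_gen {Q6}"
      and mc: "denom6 ^ m * g - lift c \<in> ideal_gen {Q6}" by blast
    have "denom6 ^ (n + m) * (f * g) - lift (b * c) = (denom6 ^ n * f) * (denom6 ^ m * g) - lift b * lift c"
      unfolding hom_simps[OF lift_hom] by (simp add: power_add ac_simps)
    also have "\<dots> \<in> ideal_gen {Q6}" by (rule ideal_cong_mult[OF I nb mc])
    finally show ?case by blast
  }
qed

text \<open>The point of the quadric with given \<open>q, x\<^sub>2, x\<^sub>3, y\<^sub>2, y\<^sub>3\<close>, provided that the denominators are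
  not zero; there are enough such points to decide whether a lift vanishes.\<close>

definition model_point :: "complex \<Rightarrow> complex \<Rightarrow> complex \<Rightarrow> complex \<Rightarrow> complex \<Rightarrow> complex ^ 6" where
  "model_point q a b c d = (\<chi> i. if i = 0 then (q - a * b) / (a + b) else if i = 1 then a else if i = 2 then b
     else if i = 3 then (q - c * d) / (c + d) else if i = 4 then c else d)"

lemma model_point_simps:
  "model_point q a b c d $ 0 = (q - a * b) / (a + b)" "model_point q a b c d $ 1 = a" "model_point q a b c d $ 2 = b"
  "model_point q a b c d $ 3 = (q - c * d) / (c + d)" "model_point q a b c d $ 4 = c" "model_point q a b c d $ 5 = d"
  by (simp_all add: model_point_def)

lemma model_point_eq:
  assumes "a + b \<noteq> 0" "c + d \<noteq> 0"
  shows "model_point q a b c d $ 0 * a + model_point q a b c d $ 0 * b + a * b = q"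
    "model_point q a b c d $ 3 * c + model_point q a b c d $ 3 * d + c * d = q"
proof -
  have "model_point q a b c d $ 0 * a + model_point q a b c d $ 0 * b + a * b = (q - a * b) / (a + b) * (a + b) + a * b"
    "model_point q a b c d $ 3 * c + model_point q a b c d $ 3 * d + c * d = (q - c * d) / (c + d) * (c + d) + c * d"
    by (simp_all only: model_point_simps distrib_left)
  then show "model_point q a b c d $ 0 * a + model_point q a b c d $ 0 * b + a * b = q"
    "model_point q a b c d $ 3 * c + model_point q a b c d $ 3 * d + c * d = q"
    using assms by simp_all
qed

lemma quadric_model_point:
  assumes "a + b \<noteq> 0" "c + d \<noteq> 0"
  shows "poly_eval Q6 (model_point q a b c d) = 0"
  unfolding poly_eval_Q6
  unfolding quadric_def model_point_simps(2,3,5,6) model_point_eq[OF assms] by simp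

lemma lift_model_point:
  assumes "a + b \<noteq> 0" "c + d \<noteq> 0"
  shows "poly_eval (lift r) (model_point q a b c d) = extend_hom (base_hom id a b c d) q r"
proof -
  let ?p = "model_point q a b c d"
  have ce: "poly_eval (base_hom Const (Var 1) (Var 2) (Var 4) (Var 5) s) ?p = base_hom id a b c d s" for s
  proof -
    have *: "poly_eval (extend_hom h t u) ?p = extend_hom (\<lambda>r. poly_eval (h r) ?p) (poly_eval t ?p) u"
      if h: "unital_ring_hom h" for h :: "'z::comm_ring_1 \<Rightarrow> 6 mpol" and t u
    proof -
      have h': "unital_ring_hom (\<lambda>r. poly_eval (h r) ?p)"
        by (rule unital_ring_hom_comp[OF poly_eval_hom h])
      show ?thesis by (induction u) (simp_all add: extend_hom_pCons[OF h] extend_hom_pCons[OF h'] extend_hom_0 poly_eval_simps)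
    qed
    show ?thesis
      unfolding base_hom_def
      by (simp add: * extend_hom_hom Const_hom poly_eval_simps model_point_simps id_def)
  qed
  have h: "unital_ring_hom (base_hom Const (Var 1) (Var 2) (Var 4) (Var (5::6)))"
    by (rule base_hom_hom[OF Const_hom])
  define g where "g = base_hom id a b c d"
  have h': "unital_ring_hom g" unfolding g_def by (rule base_hom_hom[OF unital_ring_hom_id])
  note ce = ce[folded g_def]
  show ?thesis
    unfolding lift_def g_def[symmetric]
    by (induction r) (simp_all add: extend_hom_pCons[OF h] extend_hom_pCons[OF h'] extend_hom_0 poly_eval_simps ce
        model_point_simps(2,3) model_point_eq[OF assms])
qed

lemma base_denom_nonzero: "base_denom \<noteq> 0"
proof
  assume "base_denom = 0"
  then have "base_hom id 1 0 1 (0::complex) base_denom = 0"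
    by (simp add: hom_simps[OF base_hom_hom[OF unital_ring_hom_id]])
  then show False
    unfolding base_denom_def hom_simps[OF base_hom_hom[OF unital_ring_hom_id]] base_hom_simps[OF unital_ring_hom_id]
    by simp
qed

lemma lift_injective:
  assumes "lift r \<in> ideal_gen {Q6}"
  shows "r = 0"
proof -
  let ?hs = "{base_hom id a b c d | a b c d :: complex. True}"
  have hom: "unital_ring_hom h" if "h \<in> ?hs" for h
    using that base_hom_hom[OF unital_ring_hom_id] by blast
  have "[:base_denom:] * r = 0"
  proof (rule poly_map_separating[of ?hs, OF hom])
    show "r = 0" if "\<And>h. h \<in> ?hs \<Longrightarrow> h r = 0" for r
      by (rule base_separating) (use that in blast)
    fix h s assume "h \<in> ?hs"
    then obtain a b c d where h: "h = base_hom id a b c d" by blast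
    have hh: "unital_ring_hom h" using \<open>h \<in> ?hs\<close> by (rule hom)
    have den: "h base_denom = (a + b) * (c + d)"
      by (simp add: base_denom_def hom_simps[OF hh]) (simp add: h base_hom_simps[OF unital_ring_hom_id])
    show "extend_hom h s ([:base_denom:] * r) = 0"
    proof (cases "a + b = 0 \<or> c + d = 0")
      case True
      then have "extend_hom h s [:base_denom:] = 0" by (auto simp: extend_hom_pCons[OF hh] extend_hom_0 den)
      then show ?thesis by (simp only: hom_simps[OF extend_hom_hom[OF hh]] mult_zero_left)
    next
      case False
      obtain u where "lift r = u * Q6" using assms by (auto simp: ideal_gen_singleton)
      then have "poly_eval (lift r) (model_point s a b c d) = 0"
        using quadric_model_point False by (simp add: poly_eval_simps)
      then have "extend_hom h s r = 0" using lift_model_point False by (simp add: h)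
      then show ?thesis by (simp only: hom_simps[OF extend_hom_hom[OF hh]] mult_zero_right)
    qed
  qed
  then show ?thesis using base_denom_nonzero by simp
qed

text \<open>Clear denominators in \<open>lift b = u * Q6 + v * F6\<close>. Modulo the quadric the right-hand side becomes
  a multiple of the lifted cubic, and lifting is injective modulo the quadric. So the cubic divides \<open>b\<close> times a
  power of the denominator, to which it is prime because the denominator has degree zero in \<open>q\<close>.\<close>

lemma model_cubic_dvd:
  assumes "lift b \<in> ideal_gen {Q6, F6}"
  shows "model_cubic dvd b"
proof -
  note I = ideal_gen_ideal[of "{Q6}"]
  obtain u v where uv: "lift b = u * Q6 + v * F6" using assms by (auto simp: ideal_gen_pair)
  obtain n w where nw: "denom6 ^ n * v - lift w \<in> ideal_gen {Q6}" using lift_exists by blast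
  have "(denom6 ^ n * v) * (denom6 * F6) - lift w * lift model_cubic \<in> ideal_gen {Q6}"
    by (rule ideal_cong_mult[OF I nw denom_quartic_cong])
  moreover have "denom6 ^ (Suc n) * u * Q6 \<in> ideal_gen {Q6}" by (rule ideal_gen_singletonI[OF refl])
  ultimately have "denom6 ^ (Suc n) * u * Q6 + ((denom6 ^ n * v) * (denom6 * F6) - lift w * lift model_cubic) \<in> ideal_gen {Q6}"
    by (rule is_idealD(2)[OF I, rotated])
  also have "denom6 ^ (Suc n) * u * Q6 + ((denom6 ^ n * v) * (denom6 * F6) - lift w * lift model_cubic)
      = denom6 ^ Suc n * (u * Q6 + v * F6) - lift w * lift model_cubic"
  proof -
    have "D ^ Suc n * u * q + ((D ^ n * v) * (D * f) - x) = D ^ Suc n * (u * q + v * f) - x" for D q f x :: "6 mpol"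
      by (simp add: algebra_simps)
    then show ?thesis .
  qed
  also have "\<dots> = lift ([:base_denom:] ^ Suc n * b - w * model_cubic)"
    unfolding uv[symmetric] hom_simps[OF lift_hom] lift_simps ..
  finally have "[:base_denom:] ^ Suc n * b - w * model_cubic = 0" by (rule lift_injective)
  then have "model_cubic dvd [:base_denom:] ^ Suc n * b" by (simp add: dvd_def mult.commute)
  then have "model_cubic dvd [:base_denom:] ^ Suc n \<or> model_cubic dvd b"
    using prime_model_cubic by (rule prime_elem_dvd_multD[rotated])
  moreover have "\<not> model_cubic dvd [:base_denom:] ^ Suc n"
  proof
    assume "model_cubic dvd [:base_denom:] ^ Suc n"
    then have "model_cubic dvd [:base_denom:]" using prime_model_cubic by (rule prime_elem_dvd_power[rotated])
    moreover have "[:base_denom:] \<noteq> 0" by (simp add: base_denom_nonzero)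
    ultimately have "degree model_cubic \<le> degree [:base_denom:]" by (rule dvd_imp_degree_le)
    then show False using degree_model_cubic by simp
  qed
  ultimately show ?thesis by blast
qed

section \<open>The denominator is not a zero divisor\<close>

text \<open>Restriction to the hyperplane \<open>x\<^sub>2 + x\<^sub>3 = 0\<close>.\<close>

definition restrict_hom :: "6 mpol \<Rightarrow> 6 mpol" where
  "restrict_hom = poly_subst (\<lambda>i. if i = 2 then - Var 1 else Var i)"

lemma restrict_hom: "unital_ring_hom restrict_hom"
  unfolding restrict_hom_def by (rule poly_subst_hom)

lemma restrict_simps: "restrict_hom (Var i) = (if i = 2 then - Var 1 else Var i)" "restrict_hom (Const c) = Const c"
  by (simp_all add: restrict_hom_def poly_subst_Var poly_subst_Const)

lemma restrict_cong: "f - restrict_hom f \<in> ideal_gen {Var 1 + Var 2}"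
proof (induction f rule: mpol_induct)
  note I = ideal_gen_ideal[of "{Var 1 + Var 2 :: 6 mpol}"]
  {
    case (Const c)
    then show ?case using is_idealD(1)[OF I] by (simp add: restrict_simps)
  next
    case (Var i)
    show ?case
    proof (cases "i = 2")
      case True
      then have "Var i - restrict_hom (Var i) = 1 * (Var 1 + Var 2)" by (simp add: restrict_simps)
      then show ?thesis by (rule ideal_gen_singletonI)
    next
      case False
      then show ?thesis using is_idealD(1)[OF I] by (simp add: restrict_simps)
    qed
  next
    case (add f g)
    have "f + g - restrict_hom (f + g) = (f - restrict_hom f) + (g - restrict_hom g)"
      by (simp add: hom_simps[OF restrict_hom])
    then show ?case using is_idealD(2)[OF I add] by (simp only:)
  next
    case (mult f g)
    show ?case unfolding hom_simps[OF restrict_hom] by (rule ideal_cong_mult[OF I mult])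
  }
qed

text \<open>The coordinate \<open>x\<^sub>2\<close>, with index \<open>1\<close>, does not occur. This is expressed by values because it is used only
  for evaluation at points that differ in this coordinate.\<close>

definition free_of_1 :: "6 mpol \<Rightarrow> bool" where
  "free_of_1 f \<longleftrightarrow> (\<forall>p q. (\<forall>i. i \<noteq> 1 \<longrightarrow> p $ i = q $ i) \<longrightarrow> poly_eval f p = poly_eval f q)"

text \<open>Division with remainder by a polynomial that is monic in \<open>x\<^sub>2\<close>.\<close>

lemma divide_by_monic_quadratic:
  assumes t: "free_of_1 t"
  shows "\<exists>k x y. f = (Var 1 * Var 1 + t) * k + x + y * Var 1 \<and> free_of_1 x \<and> free_of_1 y"
proof (induction f rule: mpol_induct)
  have free: "free_of_1 0" "free_of_1 1" "free_of_1 (Const c)" "i \<noteq> 1 \<Longrightarrow> free_of_1 (Var i)" for c i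
    by (simp_all add: free_of_1_def poly_eval_simps)
  have free_op: "free_of_1 (f + g)" "free_of_1 (f * g)" "free_of_1 (f - g)" if fg: "free_of_1 f" "free_of_1 g" for f g
  proof -
    have "poly_eval f p = poly_eval f q \<and> poly_eval g p = poly_eval g q" if "\<forall>i. i \<noteq> 1 \<longrightarrow> p $ i = q $ i" for p q
      using fg that unfolding free_of_1_def by blast
    note fg' = this
    show "free_of_1 (f + g)" "free_of_1 (f * g)" "free_of_1 (f - g)"
      unfolding free_of_1_def poly_eval_simps using fg' by metis+
  qed
  have rep: "\<exists>k x y. f = (Var 1 * Var 1 + t) * k + x + y * Var 1 \<and> free_of_1 x \<and> free_of_1 y"
    if "f = (Var 1 * Var 1 + t) * k + x + y * Var 1" "free_of_1 x" "free_of_1 y" for f k x y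
    using that by blast
  {
    case (Const c)
    show ?case by (rule rep[of _ 0 "Const c" 0]) (simp_all add: free)
  next
    case (Var i)
    show ?case
    proof (cases "i = 1")
      case True
      show ?thesis by (rule rep[of _ 0 0 1]) (simp_all add: free True)
    next
      case False
      show ?thesis by (rule rep[of _ 0 "Var i" 0]) (simp_all add: free False)
    qed
  next
    case (add f g)
    then obtain k x y l z w where
      f: "f = (Var 1 * Var 1 + t) * k + x + y * Var 1" "free_of_1 x" "free_of_1 y" and
      g: "g = (Var 1 * Var 1 + t) * l + z + w * Var 1" "free_of_1 z" "free_of_1 w" by blast
    have "f + g = (Var 1 * Var 1 + t) * (k + l) + (x + z) + (y + w) * Var 1"
      unfolding f(1) g(1) by (simp add: algebra_simps)
    then show ?case by (rule rep) (intro free_op f g)+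
  next
    case (mult f g)
    then obtain k x y l z w where
      f: "f = (Var 1 * Var 1 + t) * k + x + y * Var 1" "free_of_1 x" "free_of_1 y" and
      g: "g = (Var 1 * Var 1 + t) * l + z + w * Var 1" "free_of_1 z" "free_of_1 w" by blast
    define m where "m = Var 1 * Var 1 + t"
    have "(m * k + (x + y * Var 1)) * (m * l + (z + w * Var 1)) =
        m * (k * (m * l + (z + w * Var 1)) + l * (x + y * Var 1)) + (x + y * Var 1) * (z + w * Var 1)"
      by (simp add: algebra_simps)
    moreover have "(x + y * Var 1) * (z + w * Var 1) = m * (y * w) + (x * z - t * (y * w)) + (x * w + y * z) * Var 1"
      by (simp add: m_def algebra_simps)
    moreover have "f * g = (m * k + (x + y * Var 1)) * (m * l + (z + w * Var 1))"
      by (simp only: f(1) g(1) m_def add.assoc)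
    ultimately have "f * g = m * (k * (m * l + (z + w * Var 1)) + l * (x + y * Var 1) + y * w)
        + (x * z - t * (y * w)) + (x * w + y * z) * Var 1"
      by (simp add: distrib_left add.assoc)
    then show ?case unfolding m_def by (rule rep) (intro free_op f g t)+
  }
qed

text \<open>Let \<open>x + y * Var 1\<close> be the remainder of \<open>f\<close>. Where the monic polynomial vanishes, at the two square
  roots \<open>\<plusminus> r\<close> of \<open>- t\<close>, so does \<open>(x \<plusminus> y r) g\<close>. Addition and subtraction show that \<open>x\<close> and \<open>y\<close> vanish wherever
  \<open>t\<close> and \<open>g\<close> do not, hence identically.\<close>

lemma monic_quadratic_coprime:
  assumes t: "free_of_1 t" "t \<noteq> 0" and g: "free_of_1 g" "g \<noteq> 0"
    and dvd: "f * g = (Var 1 * Var 1 + t) * k"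
  shows "\<exists>k. f = (Var 1 * Var 1 + t) * k"
proof -
  obtain l x y where f: "f = (Var 1 * Var 1 + t) * l + x + y * Var 1" "free_of_1 x" "free_of_1 y"
    using divide_by_monic_quadratic[OF t(1)] by blast
  have "poly_eval (x * (g * t)) p = 0 \<and> poly_eval (y * (g * t)) p = 0" for p
  proof (cases "poly_eval t p = 0")
    case False
    define r where "r = csqrt (- poly_eval t p)"
    have r: "r * r = - poly_eval t p" using power2_csqrt[of "- poly_eval t p"] by (simp add: r_def power2_eq_square)
    then have r0: "r \<noteq> 0" using False by auto
    have eq: "(poly_eval x p + poly_eval y p * s) * poly_eval g p = 0" if s: "s * s = - poly_eval t p" for s
    proof -
      define q where "q = (\<chi> i. if i = 1 then s else p $ i)"
      have "\<forall>i. i \<noteq> 1 \<longrightarrow> q $ i = p $ i" by (simp add: q_def)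
      then have q: "poly_eval u q = poly_eval u p" if "free_of_1 u" for u
        using that unfolding free_of_1_def by blast
      have m: "poly_eval (Var 1 * Var 1 + t) q = 0"
        by (simp add: poly_eval_simps q[OF t(1)]) (simp add: q_def s)
      have "poly_eval (f * g) q = 0" unfolding dvd using m by (simp only: hom_simps[OF poly_eval_hom] mult_zero_left)
      moreover have "poly_eval f q = poly_eval x q + poly_eval y q * q $ 1"
        unfolding f(1) using m by (simp add: hom_simps(3,4)[OF poly_eval_hom] poly_eval_Var)
      ultimately show ?thesis using q f(2,3) g(1) by (simp add: poly_eval_simps) (simp add: q_def)
    qed
    show ?thesis
    proof (cases "poly_eval g p = 0")
      case False
      with eq[of r] eq[of "- r"] r have z: "poly_eval x p + poly_eval y p * r = 0" "poly_eval x p - poly_eval y p * r = 0"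
        by simp_all
      have "2 * poly_eval x p = (poly_eval x p + poly_eval y p * r) + (poly_eval x p - poly_eval y p * r)"
        "2 * (poly_eval y p * r) = (poly_eval x p + poly_eval y p * r) - (poly_eval x p - poly_eval y p * r)" by simp_all
      then have "2 * poly_eval x p = 0" "2 * (poly_eval y p * r) = 0" unfolding z by simp_all
      with r0 show ?thesis by (simp add: poly_eval_simps)
    qed (simp add: poly_eval_simps)
  qed (simp add: poly_eval_simps)
  then have "x * (g * t) = 0" "y * (g * t) = 0" by (intro mpol_eq_0_poly_evalI; simp)+
  with t g have "x = 0" "y = 0" by simp_all
  with f show ?thesis by auto
qed

text \<open>On the hyperplane \<open>x\<^sub>2 + x\<^sub>3 = 0\<close> the quadric becomes \<open>- m\<close> with \<open>m = x\<^sub>2\<^sup>2 + t\<^sub>2\<close>, and the quartic is congruent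
  modulo \<open>m\<close> to the polynomial \<open>g\<close>, in which \<open>x\<^sub>2\<close> does not occur. By the previous lemma the two
  restrictions have only the trivial relation. So from \<open>(x\<^sub>2 + x\<^sub>3) f = u Q + v F\<close> it follows that \<open>u\<close> and
  \<open>v\<close> agree, up to multiples of \<open>x\<^sub>2 + x\<^sub>3\<close>, with \<open>k F\<close> and \<open>- k Q\<close>, and the factor can be cancelled.\<close>

lemma first_denominator_regular:
  assumes "(Var 1 + Var 2) * f \<in> ideal_gen {Q6, F6}"
  shows "f \<in> ideal_gen {Q6, F6}"
proof -
  define p where "p = Var 1 + Var (2::6)"
  obtain u v where uv: "p * f = u * Q6 + v * F6" using assms by (auto simp: ideal_gen_pair p_def)
  note R = hom_simps[OF restrict_hom]
  define t1 t2 t3 where "t1 = Var 3 + Var 4 + Var (5::6)"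
    and "t2 = Var 3 * Var 4 + Var 3 * Var 5 + Var 4 * Var (5::6)" and "t3 = Var 3 * Var 4 * Var (5::6)"
  define m where "m = Var 1 * Var 1 + t2"
  define g where "g = Var 0 * (11 * (t1 * t2) + 9 * t3) - 12 * (t2 * t2)"
  define z where "z = 10 * (Var 0 * t1) - 12 * t2"
  have RQ: "restrict_hom Q6 = - m"
    unfolding hom_quadric[OF restrict_hom] restrict_simps
    by (simp add: quadric_def m_def t2_def algebra_simps)
  have RF: "restrict_hom F6 = g - m * z"
  proof -
    have "Var 0 + Var 1 + - Var 1 = Var (0::6)" "Var 0 * Var 1 + Var 0 * - Var 1 + Var 1 * - Var 1 = t2 - m"
      "Var 0 * Var 1 * - Var 1 = Var 0 * (t2 - m)"
      by (simp_all add: m_def algebra_simps)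
    moreover have "restrict_hom F6 = quartic (Var 0) (Var 1) (- Var 1) (Var 3) (Var 4) (Var 5)"
      by (simp add: hom_quartic[OF restrict_hom] restrict_simps)
    ultimately have "restrict_hom F6 = Var 0 * t1 * ((t2 - m) + t2) + 9 * (Var 0 * (t2 - m) * t1 + Var 0 * t3) - 12 * (t2 - m) * t2"
      by (simp only: quartic_def Let_def t1_def[symmetric] t2_def[symmetric] t3_def[symmetric])
    then show ?thesis by (simp add: g_def z_def algebra_simps)
  qed
  have "restrict_hom p = 0" by (simp add: p_def R restrict_simps)
  then have "restrict_hom u * (- m) + restrict_hom v * (g - m * z) = 0"
    using arg_cong[OF uv, of restrict_hom] unfolding R RQ RF by simp
  then have "restrict_hom v * g = m * (restrict_hom u + restrict_hom v * z)"
    by (simp add: algebra_simps)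
  moreover have "free_of_1 t2" "free_of_1 g"
    by (simp_all add: free_of_1_def g_def t1_def t2_def t3_def poly_eval_simps)
  moreover have "t2 \<noteq> 0" "g \<noteq> 0"
  proof -
    have "poly_eval t2 (\<chi> i. if i = 0 then 0 else 1) = 3" "poly_eval g (\<chi> i. if i = 0 then 0 else 1) = - 108"
      by (simp_all add: g_def t1_def t2_def t3_def poly_eval_simps)
    then show "t2 \<noteq> 0" "g \<noteq> 0" by (auto simp: poly_eval_simps)
  qed
  ultimately obtain k where k: "restrict_hom v = m * k"
    using monic_quadratic_coprime[of t2 g] unfolding m_def by blast
  have cong: "\<exists>w. f = restrict_hom f + p * w" for f
  proof -
    obtain w where "f - restrict_hom f = w * p" using restrict_cong[of f] by (auto simp: ideal_gen_singleton p_def)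
    then have "f = restrict_hom f + p * w" by (simp add: algebra_simps)
    then show ?thesis ..
  qed
  obtain v2 where v2: "v = m * k + p * v2" using cong[of v] k by auto
  obtain w where w: "Q6 = - m + p * w" using cong[of Q6] RQ by auto
  have vk: "v = p * (w * k + v2) - Q6 * k" unfolding v2 w by (simp add: algebra_simps)
  have pf: "p * f = (u - k * F6) * Q6 + p * ((w * k + v2) * F6)"
    unfolding uv vk by (simp add: algebra_simps)
  have "restrict_hom (u - k * F6) * m = 0"
    using arg_cong[OF pf, of restrict_hom] \<open>restrict_hom p = 0\<close> unfolding R RQ by simp
  moreover have "m \<noteq> 0"
  proof -
    have "poly_eval m (\<chi> i. 1) = 4" by (simp add: m_def t2_def poly_eval_simps)
    then show ?thesis by (auto simp: poly_eval_simps)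
  qed
  ultimately have "restrict_hom (u - k * F6) = 0" by simp
  then obtain s where s: "u - k * F6 = p * s" using cong[of "u - k * F6"] by auto
  have "p * (f - (s * Q6 + (w * k + v2) * F6)) = 0"
    using pf unfolding s by (simp add: algebra_simps)
  moreover have "p \<noteq> 0"
  proof -
    have "poly_eval p (\<chi> i. 1) = 2" by (simp add: p_def poly_eval_simps)
    then show ?thesis by (auto simp: poly_eval_simps)
  qed
  ultimately have "f = s * Q6 + (w * k + v2) * F6" by simp
  then show ?thesis unfolding ideal_gen_pair by blast
qed

text \<open>The exchange of the blocks transfers the result from one denominator to the other.\<close>

definition swap_hom :: "6 mpol \<Rightarrow> 6 mpol" where
  "swap_hom = poly_subst (\<lambda>i. if i = 0 then Var 3 else if i = 1 then Var 4 else if i = 2 then Var 5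
     else if i = 3 then Var 0 else if i = 4 then Var 1 else Var 2)"

lemma swap_hom: "unital_ring_hom swap_hom"
  unfolding swap_hom_def by (rule poly_subst_hom)

lemma swap_Var: "swap_hom (Var 0) = Var 3" "swap_hom (Var 1) = Var 4" "swap_hom (Var 2) = Var 5"
  "swap_hom (Var 3) = Var 0" "swap_hom (Var 4) = Var 1" "swap_hom (Var 5) = Var 2"
  "swap_hom (Const c) = Const c"
  by (simp_all add: swap_hom_def poly_subst_Var poly_subst_Const)

lemma swap_swap: "swap_hom (swap_hom f) = f"
proof (rule mpol_hom_eqI[OF unital_ring_hom_comp[OF swap_hom swap_hom] unital_ring_hom_id, unfolded id_apply])
  fix i :: 6
  have "i \<in> {0, 1, 2, 3, 4, 5}" unfolding UNIV_6[symmetric] by simp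
  then show "swap_hom (swap_hom (Var i)) = Var i"
    by (elim insertE) (simp_all add: swap_Var)
qed (simp add: swap_Var)

lemma swap_ideal:
  assumes "f \<in> ideal_gen {Q6, F6}"
  shows "swap_hom f \<in> ideal_gen {Q6, F6}"
proof -
  obtain u v where uv: "f = u * Q6 + v * F6" using assms by (auto simp: ideal_gen_pair)
  have "swap_hom Q6 = - Q6"
    by (simp add: hom_quadric[OF swap_hom] swap_Var quadric_perm(5)[of "Var 3"])
  moreover have "swap_hom F6 = F6"
    by (simp add: hom_quartic[OF swap_hom] swap_Var quartic_perm(5)[of "Var 3"])
  ultimately have "swap_hom f = (- swap_hom u) * Q6 + swap_hom v * F6"
    unfolding uv hom_simps[OF swap_hom] by simp
  then show ?thesis unfolding ideal_gen_pair by blast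
qed

lemma denominator_regular:
  assumes "denom6 ^ n * f \<in> ideal_gen {Q6, F6}"
  shows "f \<in> ideal_gen {Q6, F6}"
proof -
  have second: "f \<in> ideal_gen {Q6, F6}" if "(Var 4 + Var 5) * f \<in> ideal_gen {Q6, F6}" for f
  proof -
    have "swap_hom ((Var 4 + Var 5) * f) = (Var 1 + Var 2) * swap_hom f"
      by (simp add: hom_simps[OF swap_hom] swap_Var)
    then have "swap_hom f \<in> ideal_gen {Q6, F6}"
      using swap_ideal[OF that] first_denominator_regular by simp
    from swap_ideal[OF this] show ?thesis by (simp add: swap_swap)
  qed
  show ?thesis using assms
  proof (induction n)
    case (Suc n)
    have "denom6 ^ Suc n * f = (Var 1 + Var 2) * ((Var 4 + Var 5) * (denom6 ^ n * f))"
      by (simp add: mult.assoc)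
    then show ?case using Suc first_denominator_regular second by metis
  qed simp
qed

lemma quadric_ideal_subset:
  assumes "f \<in> ideal_gen {Q6}"
  shows "f \<in> ideal_gen {Q6, F6}"
proof -
  obtain u where "f = u * Q6" using assms by (auto simp: ideal_gen_singleton)
  then have "f = u * Q6 + 0 * F6" by simp
  then show ?thesis unfolding ideal_gen_pair by blast
qed

lemma lift_model_cubic_mem: "lift model_cubic \<in> ideal_gen {Q6, F6}"
proof -
  note I = ideal_gen_ideal[of "{Q6, F6}"]
  have "denom6 * F6 - (denom6 * F6 - lift model_cubic) \<in> ideal_gen {Q6, F6}"
    by (intro is_idealD(6)[OF I] quadric_ideal_subset denom_quartic_cong is_idealD(3)[OF I] ideal_gen_base) simp
  then show ?thesis by simp
qed

text \<open>After multiplication by denominators the factors become lifts; the prime cubic divides one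
  of them, and then the corresponding factor lies in the ideal up to a denominator, which can be cancelled.\<close>

theorem prime_threefold_ideal: "is_prime_ideal (ideal_gen {Q6, F6})"
  unfolding is_prime_ideal_def
proof (intro conjI allI impI)
  note I = ideal_gen_ideal[of "{Q6, F6}"]
  show "is_ideal (ideal_gen {Q6, F6})" by (rule I)
  have "poly_eval f (axis 0 1) = 0" if "f \<in> ideal_gen {Q6, F6}" for f
  proof -
    obtain u v where "f = u * Q6 + v * F6" using \<open>f \<in> _\<close> by (auto simp: ideal_gen_pair)
    moreover have "poly_eval Q6 (axis 0 1) = 0" "poly_eval F6 (axis 0 1) = 0"
      unfolding poly_eval_Q6 poly_eval_F6 by (simp_all add: axis_def quadric_def quartic_def)
    ultimately show ?thesis by (simp add: poly_eval_simps)
  qed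
  then show "1 \<notin> ideal_gen {Q6, F6}" by (force simp: poly_eval_simps)
  fix a b assume ab: "a * b \<in> ideal_gen {Q6, F6}"
  note sub = quadric_ideal_subset
  obtain n r where r: "denom6 ^ n * a - lift r \<in> ideal_gen {Q6}" using lift_exists by blast
  obtain m t where t: "denom6 ^ m * b - lift t \<in> ideal_gen {Q6}" using lift_exists by blast
  have "(denom6 ^ n * a) * (denom6 ^ m * b) - lift r * lift t \<in> ideal_gen {Q6, F6}"
    by (rule sub, rule ideal_cong_mult[OF ideal_gen_ideal r t])
  moreover have "(denom6 ^ n * a) * (denom6 ^ m * b) \<in> ideal_gen {Q6, F6}"
  proof -
    have "(denom6 ^ n * a) * (denom6 ^ m * b) = (denom6 ^ n * denom6 ^ m) * (a * b)" by (simp only: ac_simps)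
    then show ?thesis using is_idealD(3)[OF I ab] by metis
  qed
  ultimately have "(denom6 ^ n * a) * (denom6 ^ m * b) - ((denom6 ^ n * a) * (denom6 ^ m * b) - lift r * lift t) \<in> ideal_gen {Q6, F6}"
    by (rule is_idealD(6)[OF I, rotated])
  then have "lift (r * t) \<in> ideal_gen {Q6, F6}" by (simp add: hom_simps[OF lift_hom])
  then have "model_cubic dvd r * t" by (rule model_cubic_dvd)
  then have "model_cubic dvd r \<or> model_cubic dvd t"
    using prime_model_cubic by (rule prime_elem_dvd_multD[rotated])
  moreover have "f \<in> ideal_gen {Q6, F6}"
    if f: "denom6 ^ n * f - lift r \<in> ideal_gen {Q6}" and dvd: "model_cubic dvd r" for n f r
  proof -
    obtain k where k: "r = model_cubic * k" using dvd by (rule dvdE)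
    have "lift model_cubic \<in> ideal_gen {Q6, F6}" by (rule lift_model_cubic_mem)
    then have "lift r \<in> ideal_gen {Q6, F6}" unfolding k hom_simps[OF lift_hom] by (rule is_idealD(4)[OF I])
    with sub[OF f] have "(denom6 ^ n * f - lift r) + lift r \<in> ideal_gen {Q6, F6}"
      by (rule is_idealD(2)[OF I])
    then have "denom6 ^ n * f \<in> ideal_gen {Q6, F6}" by simp
    then show ?thesis by (rule denominator_regular)
  qed
  ultimately show "a \<in> ideal_gen {Q6, F6} \<or> b \<in> ideal_gen {Q6, F6}" using r t by blast
qed

section \<open>Dimension: four independent functions\<close>

lemma poly_subst_as_values:
  "poly_eval (poly_subst f P) p = insertion id (\<lambda>v. poly_eval (f v) p) P"
proof (rule mpol_hom_eqI)
  show "unital_ring_hom (\<lambda>P. poly_eval (poly_subst f P) p)"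
    by (rule unital_ring_hom_comp[OF poly_eval_hom poly_subst_hom])
  show "unital_ring_hom (insertion id (\<lambda>v. poly_eval (f v) p))"
    by (rule insertion_hom[OF unital_ring_hom_id])
qed ((subst insertion_Const[OF unital_ring_hom_id] | subst insertion_Var[OF unital_ring_hom_id]),
    simp add: poly_subst_Const poly_subst_Var poly_eval_Const)+

lemma insertion_cong:
  assumes "\<And>m. m \<in> keys P \<Longrightarrow> keys m \<subseteq> A" "\<And>v. v \<in> A \<Longrightarrow> f v = g v"
  shows "insertion h f P = insertion h g P"
  unfolding insertion_def
  by (intro sum.cong refl arg_cong2[of _ _ _ _ "(*)"] prod.cong) (use assms in \<open>auto simp: subset_iff\<close>)

text \<open>The cubic in \<open>q\<close> has a complex root for all values of the four other coordinates.\<close>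

lemma model_point_on_threefold:
  assumes den: "a + b \<noteq> 0" "c + d \<noteq> 0"
  shows "\<exists>q. \<forall>f\<in>ideal_gen {Q6, F6}. poly_eval f (model_point q a b c d) = 0"
proof -
  let ?h = "base_hom id a b c (d :: complex)"
  have h: "unital_ring_hom ?h" by (rule base_hom_hom[OF unital_ring_hom_id])
  have "degree (map_poly ?h model_cubic) = 3"
  proof -
    obtain h0 h1 h2 where "model_coeffs base_a base_b base_c base_d = (h0, h1, h2)" by (metis prod_cases3)
    then have "model_cubic = [:h0, h1, h2, 2:]" by (simp add: model_cubic_def)
    then have "map_poly ?h model_cubic = map_poly ?h [:h0, h1, h2, 2:]" by (rule arg_cong)
    then show ?thesis by (simp add: map_poly_pCons hom_simps[OF h])
  qed
  then have "\<not> constant (poly (map_poly ?h model_cubic))" by (simp add: constant_degree)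
  then obtain q where "poly (map_poly ?h model_cubic) q = 0"
    using fundamental_theorem_of_algebra by blast
  then have "extend_hom ?h q model_cubic = 0" by (simp add: extend_hom_def)
  then have L: "poly_eval (lift model_cubic) (model_point q a b c d) = 0"
    using lift_model_point[OF den] by simp
  have Q: "poly_eval Q6 (model_point q a b c d) = 0" by (rule quadric_model_point[OF den])
  obtain u where "denom6 * F6 - lift model_cubic = u * Q6"
    using denom_quartic_cong by (auto simp: ideal_gen_singleton)
  then have "poly_eval (denom6 * F6 - lift model_cubic) (model_point q a b c d) = 0"
    using Q by (simp only: hom_simps[OF poly_eval_hom] mult_zero_right)
  then have "(a + b) * (c + d) * poly_eval F6 (model_point q a b c d) = 0"
    using L by (simp only: hom_simps[OF poly_eval_hom] poly_eval_Var model_point_simps diff_zero)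
  then have "poly_eval F6 (model_point q a b c d) = 0" using den by simp
  then have "poly_eval f (model_point q a b c d) = 0" if "f \<in> ideal_gen {Q6, F6}" for f
  proof -
    obtain u v where "f = u * Q6 + v * F6" using \<open>f \<in> ideal_gen {Q6, F6}\<close> by (auto simp: ideal_gen_pair)
    then show ?thesis using Q \<open>poly_eval F6 (model_point q a b c d) = 0\<close>
      by (simp only: hom_simps[OF poly_eval_hom] mult_zero_right add_0)
  qed
  then show ?thesis by blast
qed

text \<open>A relation vanishes at all values of the four coordinates with nonzero denominators,
  because these occur on the threefold.\<close>

lemma four_independent: "alg_indep_mod (ideal_gen {Q6, F6}) {Var 1, Var 2, Var 4, Var 5}"
  unfolding alg_indep_mod_def
proof (intro allI impI)
  fix P :: "6 mpol mpol"
  let ?A = "{Var 1, Var 2, Var 4, Var 5} :: 6 mpol set"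
  assume P: "(\<forall>m\<in>keys P. keys m \<subseteq> ?A) \<and> poly_subst id P \<in> ideal_gen {Q6, F6}"
  have van: "insertion id f P = 0" if den: "f (Var 1) + f (Var 2) \<noteq> 0" "f (Var 4) + f (Var 5) \<noteq> 0" for f
  proof -
    obtain q where q: "\<forall>g\<in>ideal_gen {Q6, F6}. poly_eval g (model_point q (f (Var 1)) (f (Var 2)) (f (Var 4)) (f (Var 5))) = 0"
      using model_point_on_threefold[OF den] by blast
    let ?p = "model_point q (f (Var 1)) (f (Var 2)) (f (Var 4)) (f (Var 5))"
    have "insertion id f P = insertion id (\<lambda>v. poly_eval (id v) ?p) P"
      by (rule insertion_cong[of _ ?A]) (use P in \<open>auto simp: poly_eval_Var model_point_simps\<close>)
    also have "\<dots> = poly_eval (poly_subst id P) ?p" by (rule poly_subst_as_values[symmetric])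
    also have "\<dots> = 0" using P q by blast
    finally show ?thesis .
  qed
  show "P = 0"
  proof (rule mpol_eq_0I)
    fix f
    \<comment> \<open>Restrict to a line through \<open>f\<close> on which the two denominators do not vanish identically.\<close>
    have c: "unital_ring_hom (\<lambda>z :: complex. [:z:])"
      by (rule unital_ring_homI) (simp_all add: one_pCons)
    define r where "r = insertion (\<lambda>z. [:z:]) (\<lambda>v. [:f v, 1:]) P"
    have r: "poly r s = insertion id (\<lambda>v. f v + s) P" for s
    proof -
      have e: "unital_ring_hom (\<lambda>g. poly g s)" by (rule unital_ring_homI) simp_all
      have "(\<lambda>P. poly (insertion (\<lambda>z. [:z:]) (\<lambda>v. [:f v, 1:]) P) s) P = insertion id (\<lambda>v. f v + s) P"
        by (rule mpol_hom_eqI[OF unital_ring_hom_comp[OF e insertion_hom[OF c]] insertion_hom[OF unital_ring_hom_id]])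
          (simp_all only: insertion_Const[OF c] insertion_Var[OF c] insertion_Const[OF unital_ring_hom_id]
            insertion_Var[OF unital_ring_hom_id] id_apply poly_pCons poly_0 mult_zero_right add_0_right mult_1_right)
      then show ?thesis by (simp add: r_def)
    qed
    define g where "g = [:f (Var 1) + f (Var 2), 2:] * [:f (Var 4) + f (Var 5), 2 :: complex:]"
    have "poly (r * g) s = 0" for s
    proof (cases "poly g s = 0")
      case False
      moreover have "poly g s = (f (Var 1) + s + (f (Var 2) + s)) * (f (Var 4) + s + (f (Var 5) + s))"
        by (simp add: g_def algebra_simps)
      ultimately have "f (Var 1) + s + (f (Var 2) + s) \<noteq> 0" "f (Var 4) + s + (f (Var 5) + s) \<noteq> 0"
        by auto
      then show ?thesis using van[of "\<lambda>v. f v + s"] by (simp add: r)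
    qed simp
    then have "r * g = 0" using poly_all_0_iff_0 by blast
    moreover have "g \<noteq> 0" by (simp add: g_def)
    ultimately have "r = 0" by simp
    then show "insertion id f P = 0" using r[of 0] by simp
  qed
qed

lemma card_four_variables: "card {Var 1, Var 2, Var 4, Var (5::6)} = 4"
proof -
  have "Var i = Var j \<longleftrightarrow> i = j" for i j :: 6
  proof
    assume "Var i = Var j"
    then have "poly_eval (Var i) (axis i 1) = poly_eval (Var j) (axis i 1)" by simp
    then show "i = j" by (auto simp: poly_eval_Var axis_def split: if_splits)
  qed simp
  then show ?thesis by simp
qed

section \<open>Dimension: any five functions are dependent\<close>

text \<open>Each equation eliminates one unknown.\<close>

lemma homogeneous_system_solution:
  fixes y :: "'x \<Rightarrow> 'j \<Rightarrow> 'k::field"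
  assumes "finite J" "finite X" "card J < card X"
  shows "\<exists>l. (\<exists>x\<in>X. l x \<noteq> 0) \<and> (\<forall>j\<in>J. (\<Sum>x\<in>X. l x * y x j) = 0)"
  using assms
proof (induction J arbitrary: X y rule: finite_induct)
  case empty
  then obtain x where "x \<in> X" by (metis card.empty less_nat_zero_code ex_in_conv)
  then show ?case by (intro exI[of _ "\<lambda>_. 1"]) auto
next
  case (insert j J)
  show ?case
  proof (cases "\<forall>x\<in>X. y x j = 0")
    case True
    have "card J < card X" using insert by simp
    from insert.IH[OF insert.prems(1) this] obtain l where
      "\<exists>x\<in>X. l x \<noteq> 0" "\<forall>j\<in>J. (\<Sum>x\<in>X. l x * y x j) = 0" by blast
    then show ?thesis using True by (intro exI[of _ l]) simp
  next
    case False
    then obtain z where z: "z \<in> X" "y z j \<noteq> 0" by blast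
    define w where "w x i = y x i - y x j / y z j * y z i" for x i
    have "card J < card (X - {z})" using insert z by simp
    from insert.IH[OF _ this, of w] insert.prems(1) obtain l where
      l: "\<exists>x\<in>X - {z}. l x \<noteq> 0" "\<forall>i\<in>J. (\<Sum>x\<in>X - {z}. l x * w x i) = 0" by blast
    \<comment> \<open>Equation \<open>j\<close> determines the unknown \<open>z\<close> from the others.\<close>
    define l' where "l' x = (if x = z then - (\<Sum>x\<in>X - {z}. l x * y x j) / y z j else l x)" for x
    have sum: "(\<Sum>x\<in>X. l' x * y x i) = (\<Sum>x\<in>X - {z}. l x * w x i)" for i
    proof -
      have "(\<Sum>x\<in>X. l' x * y x i) = l' z * y z i + (\<Sum>x\<in>X - {z}. l' x * y x i)"
        using insert.prems(1) z(1) by (rule sum.remove)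
      also have "(\<Sum>x\<in>X - {z}. l' x * y x i) = (\<Sum>x\<in>X - {z}. l x * y x i)"
        by (rule sum.cong) (simp_all add: l'_def)
      also have "l' z * y z i = - (\<Sum>x\<in>X - {z}. l x * (y x j / y z j * y z i))"
        by (simp add: l'_def sum_distrib_right sum_divide_distrib mult.assoc)
      finally show ?thesis
        by (simp add: w_def algebra_simps sum_subtractf)
    qed
    have "(\<Sum>x\<in>X. l' x * y x j) = 0"
      unfolding sum using z(2) by (simp add: w_def)
    moreover have "\<exists>x\<in>X. l' x \<noteq> 0" using l(1) by (auto simp: l'_def)
    ultimately show ?thesis using l(2) sum by (intro exI[of _ l']) simp
  qed
qed

text \<open>The indices \<open>1, 2, 4, 5\<close> are those of the independent coordinates \<open>x\<^sub>2, x\<^sub>3, y\<^sub>2, y\<^sub>3\<close>.\<close>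

definition base_polys :: "nat \<Rightarrow> 6 mpol set" where
  "base_polys D = {f. \<forall>m\<in>keys f. keys m \<subseteq> {1, 2, 4, 5} \<and> mdeg m \<le> D}"

lemma base_polys_mono: "f \<in> base_polys D \<Longrightarrow> D \<le> E \<Longrightarrow> f \<in> base_polys E"
  by (fastforce simp: base_polys_def)

lemma base_polys_add: "f \<in> base_polys D \<Longrightarrow> g \<in> base_polys D \<Longrightarrow> f + g \<in> base_polys D"
  using keys_add[of f g] by (fastforce simp: base_polys_def)

lemma base_polys_uminus: "f \<in> base_polys D \<Longrightarrow> - f \<in> base_polys D"
  by (simp add: base_polys_def in_keys_iff)

lemma base_polys_minus: "f \<in> base_polys D \<Longrightarrow> g \<in> base_polys D \<Longrightarrow> f - g \<in> base_polys D"
  using base_polys_add[of f D "- g"] base_polys_uminus by simp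

lemma base_polys_mult:
  assumes f: "f \<in> base_polys D" and g: "g \<in> base_polys E"
  shows "f * g \<in> base_polys (D + E)"
  unfolding base_polys_def
proof (intro CollectI ballI)
  fix m assume "m \<in> keys (f * g)"
  then obtain a b where m: "m = a + b" "a \<in> keys f" "b \<in> keys g" using keys_mult[of f g] by blast
  have "keys (a + b) \<subseteq> keys a \<union> keys b" by (rule keys_add)
  moreover have "keys a \<subseteq> {1, 2, 4, 5}" "mdeg a \<le> D" "keys b \<subseteq> {1, 2, 4, 5}" "mdeg b \<le> E"
    using f g m by (simp_all add: base_polys_def)
  ultimately show "keys m \<subseteq> {1, 2, 4, 5} \<and> mdeg m \<le> D + E"
    unfolding m(1) mdeg_add by (meson Un_least add_mono subset_trans)
qed

lemma base_polys_Const: "Const z \<in> base_polys 0"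
  by (auto simp: base_polys_def Const_def mdeg_0)

lemma base_polys_consts: "0 \<in> base_polys D" "1 \<in> base_polys 0" "numeral k \<in> base_polys 0"
  using base_polys_Const[of "numeral k"]
  by (auto simp: base_polys_def mdeg_0 hom_simps[OF Const_hom])

lemma base_polys_Var: "i \<in> {1, 2, 4, 5} \<Longrightarrow> Var i \<in> base_polys 1"
  by (simp add: base_polys_def Var_def mdeg_single)

lemma base_polys_Vars:
  "Var 1 \<in> base_polys 1" "Var 2 \<in> base_polys 1" "Var 4 \<in> base_polys 1" "Var 5 \<in> base_polys 1"
  by (rule base_polys_Var, simp)+

definition base_monomials :: "nat \<Rightarrow> (6 \<Rightarrow>\<^sub>0 nat) set" where
  "base_monomials D = {m. keys m \<subseteq> {1, 2, 4, 5} \<and> mdeg m \<le> D}"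

lemma card_base_monomials: "finite (base_monomials D) \<and> card (base_monomials D) \<le> (D + 1) ^ 4"
proof -
  let ?S = "{1, 2, 4, 5} :: 6 set"
  let ?r = "\<lambda>m. restrict (lookup m) ?S"
  have le: "lookup m i \<le> mdeg m" for m :: "6 \<Rightarrow>\<^sub>0 nat" and i
  proof (cases "i \<in> keys m")
    case True
    then show ?thesis unfolding mdeg_def by (intro member_le_sum) simp_all
  qed (simp add: in_keys_iff)
  have sub: "?r ` base_monomials D \<subseteq> ?S \<rightarrow>\<^sub>E {..D}"
  proof (intro image_subsetI PiE_I)
    fix m i assume "m \<in> base_monomials D" "i \<in> ?S"
    then show "?r m i \<in> {..D}" using le[of m i] by (simp only: base_monomials_def restrict_apply) simp
  qed simp
  have inj: "inj_on ?r (base_monomials D)"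
  proof (rule inj_onI, rule poly_mapping_eqI)
    fix m n k assume mn: "m \<in> base_monomials D" "n \<in> base_monomials D" "?r m = ?r n"
    show "lookup m k = lookup n k"
    proof (cases "k \<in> ?S")
      case True
      then show ?thesis using fun_cong[OF mn(3), of k] by simp
    next
      case False
      then have "k \<notin> keys m" "k \<notin> keys n" using mn by (auto simp: base_monomials_def)
      then show ?thesis by (simp add: in_keys_iff)
    qed
  qed
  have fin: "finite (?S \<rightarrow>\<^sub>E {..D})" by (intro finite_PiE) simp_all
  have "card (?S \<rightarrow>\<^sub>E {..D}) = (\<Prod>i\<in>?S. card {..D})" by (rule card_PiE) simp
  also have "\<dots> = (D + 1) ^ card ?S" by (simp only: prod_constant card_atMost Suc_eq_plus1)
  also have "card ?S = 4" by simp
  finally have "card (?S \<rightarrow>\<^sub>E {..D}) = (D + 1) ^ 4" .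
  moreover have "card (base_monomials D) \<le> card (?S \<rightarrow>\<^sub>E {..D})"
    using card_inj_on_le[OF inj sub fin] .
  ultimately show ?thesis using finite_imageD[OF finite_subset[OF sub fin] inj] by simp
qed

abbreviation q6 :: "6 mpol" where "q6 \<equiv> Var 0 * Var 1 + Var 0 * Var 2 + Var 1 * Var 2"

text \<open>Three coefficients suffice because the cubic eliminates all higher powers of \<open>q\<close>. So these polynomials
  form a space of dimension at most \<open>3 (D + 1)\<^sup>4\<close> modulo the ideal.\<close>

definition bounded_class :: "nat \<Rightarrow> 6 mpol set" where
  "bounded_class D = {f. \<exists>c0 c1 c2. c0 \<in> base_polys D \<and> c1 \<in> base_polys D \<and> c2 \<in> base_polys D \<and>
     f - (c0 + c1 * q6 + c2 * (q6 * q6)) \<in> ideal_gen {Q6, F6}}"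

lemma bounded_classI:
  assumes "c0 \<in> base_polys D" "c1 \<in> base_polys D" "c2 \<in> base_polys D"
    "f - (c0 + c1 * q6 + c2 * (q6 * q6)) \<in> ideal_gen {Q6, F6}"
  shows "f \<in> bounded_class D"
  using assms unfolding bounded_class_def by blast

lemma bounded_class_mono: "f \<in> bounded_class D \<Longrightarrow> D \<le> E \<Longrightarrow> f \<in> bounded_class E"
  unfolding bounded_class_def using base_polys_mono by blast

lemma bounded_class_cong:
  assumes "f \<in> bounded_class D" "g - f \<in> ideal_gen {Q6, F6}"
  shows "g \<in> bounded_class D"
proof -
  obtain c0 c1 c2 where c: "c0 \<in> base_polys D" "c1 \<in> base_polys D" "c2 \<in> base_polys D"
    and f: "f - (c0 + c1 * q6 + c2 * (q6 * q6)) \<in> ideal_gen {Q6, F6}"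
    using assms(1) unfolding bounded_class_def by blast
  have "(g - f) + (f - (c0 + c1 * q6 + c2 * (q6 * q6))) \<in> ideal_gen {Q6, F6}"
    by (rule is_idealD(2)[OF ideal_gen_ideal assms(2) f])
  moreover have "(g - f) + (f - x) = g - x" for x by simp
  ultimately have "g - (c0 + c1 * q6 + c2 * (q6 * q6)) \<in> ideal_gen {Q6, F6}" by (simp only:)
  with c show ?thesis by (rule bounded_classI)
qed

lemma bounded_class_add:
  assumes "f \<in> bounded_class D" "g \<in> bounded_class D"
  shows "f + g \<in> bounded_class D"
proof -
  obtain c0 c1 c2 where c: "c0 \<in> base_polys D" "c1 \<in> base_polys D" "c2 \<in> base_polys D"
    and f: "f - (c0 + c1 * q6 + c2 * (q6 * q6)) \<in> ideal_gen {Q6, F6}"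
    using assms(1) unfolding bounded_class_def by blast
  obtain e0 e1 e2 where e: "e0 \<in> base_polys D" "e1 \<in> base_polys D" "e2 \<in> base_polys D"
    and g: "g - (e0 + e1 * q6 + e2 * (q6 * q6)) \<in> ideal_gen {Q6, F6}"
    using assms(2) unfolding bounded_class_def by blast
  have "(f - (c0 + c1 * q + c2 * (q * q))) + (g - (e0 + e1 * q + e2 * (q * q)))
      = f + g - ((c0 + e0) + (c1 + e1) * q + (c2 + e2) * (q * q))" for q
    by (simp add: algebra_simps)
  then have "f + g - ((c0 + e0) + (c1 + e1) * q6 + (c2 + e2) * (q6 * q6)) \<in> ideal_gen {Q6, F6}"
    using is_idealD(2)[OF ideal_gen_ideal f g] by (simp only:)
  then show ?thesis by (intro bounded_classI[of "c0 + e0" _ "c1 + e1" "c2 + e2"] base_polys_add c e)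
qed

lemma bounded_class_base_mult:
  assumes "f \<in> bounded_class D" "u \<in> base_polys E"
  shows "u * f \<in> bounded_class (D + E)"
proof -
  obtain c0 c1 c2 where c: "c0 \<in> base_polys D" "c1 \<in> base_polys D" "c2 \<in> base_polys D"
    and f: "f - (c0 + c1 * q6 + c2 * (q6 * q6)) \<in> ideal_gen {Q6, F6}"
    using assms(1) unfolding bounded_class_def by blast
  have "u * (f - (c0 + c1 * q + c2 * (q * q))) = u * f - (c0 * u + c1 * u * q + c2 * u * (q * q))" for q
    by (simp add: algebra_simps)
  then have "u * f - (c0 * u + c1 * u * q6 + c2 * u * (q6 * q6)) \<in> ideal_gen {Q6, F6}"
    using is_idealD(3)[OF ideal_gen_ideal f, of u] by (simp only:)
  then show ?thesis by (intro bounded_classI[of "c0 * u" _ "c1 * u" "c2 * u"] base_polys_mult c assms)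
qed

lemma bounded_class_uminus: "f \<in> bounded_class D \<Longrightarrow> - f \<in> bounded_class D"
  using bounded_class_base_mult[of f D "Const (- 1)" 0] base_polys_Const[of "- 1"] by (simp add: hom_simps[OF Const_hom])

text \<open>The power \<open>q\<^sup>3\<close> is eliminated by means of the cubic, whose coefficients have degree at most
  six and whose leading coefficient \<open>2\<close> is invertible.\<close>

lemma bounded_class_q_mult:
  assumes "f \<in> bounded_class D"
  shows "q6 * f \<in> bounded_class (D + 6)"
proof -
  obtain c0 c1 c2 where c: "c0 \<in> base_polys D" "c1 \<in> base_polys D" "c2 \<in> base_polys D"
    and f: "f - (c0 + c1 * q6 + c2 * (q6 * q6)) \<in> ideal_gen {Q6, F6}"
    using assms unfolding bounded_class_def by blast
  obtain h0 h1 h2 where H: "model_coeffs (Var 1) (Var 2) (Var 4) (Var (5::6)) = (h0, h1, h2)" by (metis prod_cases3)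
  note V = base_polys_Vars
  have m: "f * g \<in> base_polys n" if "f \<in> base_polys d" "g \<in> base_polys e" "d + e \<le> n" for f g d e n
    using base_polys_mult[OF that(1,2)] that(3) by (rule base_polys_mono)
  define p1 p2 r1 r2 M N where "p1 = Var 1 + Var (2::6)" and "p2 = Var 1 * Var (2::6)"
    and "r1 = Var 4 + Var (5::6)" and "r2 = Var 4 * Var (5::6)" and "M = p1 * p1 - p2" and "N = r1 * r1 - r2"
  have B: "p1 \<in> base_polys 1" "r1 \<in> base_polys 1" "p2 \<in> base_polys 2" "r2 \<in> base_polys 2"
    unfolding p1_def r1_def p2_def r2_def by (intro base_polys_add V) (intro base_polys_add V, (rule m[OF V(1,2)] m[OF V(3,4)], simp)+)
  have MN: "M \<in> base_polys 2" "N \<in> base_polys 2"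
    unfolding M_def N_def by (intro base_polys_minus B m[OF B(1,1)] m[OF B(2,2)]; simp)+
  have num: "numeral k * g \<in> base_polys n" if "g \<in> base_polys n" for k g n
    by (rule m[OF base_polys_consts(3) that]) simp
  have hs: "h0 = - (9 * (p2 * p2 * N + r2 * r2 * M))" "h1 = 2 * (M * N) + 9 * (p2 * (N - p2) + r2 * (M - r2))"
    "h2 = 2 * (M + N) - 12 * (p1 * r1) + 9 * (p2 + r2)"
    using H unfolding model_coeffs_def Let_def p1_def[symmetric] p2_def[symmetric] r1_def[symmetric] r2_def[symmetric]
      M_def[symmetric] N_def[symmetric] by (simp_all add: mult.assoc)
  have p22: "p2 * p2 \<in> base_polys 4" "r2 * r2 \<in> base_polys 4" by (rule m[OF B(3,3)] m[OF B(4,4)], simp)+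
  have "p2 * p2 * N \<in> base_polys 6" "r2 * r2 * M \<in> base_polys 6"
    by (rule m[OF p22(1) MN(2)] m[OF p22(2) MN(1)], simp)+
  then have h0: "h0 \<in> base_polys 6" unfolding hs by (intro base_polys_uminus num base_polys_add)
  have "M * N \<in> base_polys 6" "p2 * (N - p2) \<in> base_polys 6" "r2 * (M - r2) \<in> base_polys 6"
    by (rule m[OF MN] m[OF B(3) base_polys_minus[OF MN(2) B(3)]] m[OF B(4) base_polys_minus[OF MN(1) B(4)]], simp)+
  then have h1: "h1 \<in> base_polys 6" unfolding hs by (intro num base_polys_add)
  have "p1 * r1 \<in> base_polys 2" by (rule m[OF B(1,2)]) simp
  then have "h2 \<in> base_polys 2" unfolding hs by (intro num base_polys_add base_polys_minus MN B)
  then have h2: "h2 \<in> base_polys 6" by (rule base_polys_mono) simp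
  have cubic: "h0 + q6 * (h1 + q6 * (h2 + q6 * 2)) \<in> ideal_gen {Q6, F6}"
    using lift_model_cubic_mem unfolding lift_model_cubic Let_def H by simp
  define e where "e = c2 * Const (- 1 / 2)"
  have e: "e \<in> base_polys D" unfolding e_def by (rule m[OF c(3) base_polys_Const]) simp
  have "Const (- 1 / 2) * Const 2 = Const (- 1 / 2 * 2 :: complex)" by (simp only: hom_simps(4)[OF Const_hom])
  then have half: "Const (- 1 / 2) * 2 = (- 1 :: 6 mpol)" by (simp add: hom_simps[OF Const_hom])
  have e2: "e * 2 = - c2" unfolding e_def mult.assoc half by simp
  note I = ideal_gen_ideal[of "{Q6, F6}"]
  have "q6 * (f - (c0 + c1 * q6 + c2 * (q6 * q6))) - e * (h0 + q6 * (h1 + q6 * (h2 + q6 * 2))) \<in> ideal_gen {Q6, F6}"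
    by (intro is_idealD(6)[OF I] is_idealD(3)[OF I] f cubic)
  also have "q6 * (f - (c0 + c1 * q6 + c2 * (q6 * q6))) - e * (h0 + q6 * (h1 + q6 * (h2 + q6 * 2))) =
      q6 * f - (e * h0 + (c0 + e * h1) * q6 + (c1 + e * h2) * (q6 * q6))"
  proof -
    have "q * (f - (c0 + c1 * q + c2 * (q * q))) - e * (h0 + q * (h1 + q * (h2 + q * 2))) =
      q * f - (e * h0 + (c0 + e * h1) * q + (c1 + e * h2) * (q * q)) - (c2 + e * 2) * (q * q * q)" for q
      by (simp add: algebra_simps)
    from this[of q6] show ?thesis by (simp only: e2 add.right_inverse mult_zero_left diff_zero)
  qed
  finally show ?thesis
    using c e h0 h1 h2
    by (intro bounded_classI[of "e * h0" _ "c0 + e * h1" "c1 + e * h2"] base_polys_add base_polys_mult)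
      (auto intro: base_polys_mono)
qed

lemma denom_base: "denom6 \<in> base_polys 2"
  using base_polys_mult[OF base_polys_add[OF base_polys_Vars(1,2)] base_polys_add[OF base_polys_Vars(3,4)]]
  by (simp only: one_add_one)

lemma bounded_class_denom:
  assumes "f \<in> bounded_class D"
  shows "denom6 ^ n * f \<in> bounded_class (D + 2 * n)"
proof (induction n)
  case (Suc n)
  from bounded_class_base_mult[OF this denom_base] show ?case by (simp add: mult.assoc)
qed (use assms in simp)

lemma bounded_class_Var:
  assumes f: "f \<in> bounded_class D"
  shows "denom6 ^ 1 * Var i * f \<in> bounded_class (D + 10)"
proof -
  note V = base_polys_Vars
  define p r where "p = Var 1 + Var (2::6)" and "r = Var 4 + Var (5::6)"
  have pr: "p \<in> base_polys 1" "r \<in> base_polys 1" unfolding p_def r_def by (intro base_polys_add V)+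
  have qf: "q6 * f \<in> bounded_class (D + 6)" by (rule bounded_class_q_mult[OF f])
  have two: "Var 1 * Var 2 \<in> base_polys 2" "Var 4 * Var 5 \<in> base_polys 2"
    using base_polys_mult[OF V(1,2)] base_polys_mult[OF V(3,4)] by (simp_all only: one_add_one)
  have step: "u * (q6 * f - w * f) \<in> bounded_class (D + 10)" if "u \<in> base_polys 1" "w \<in> base_polys 2" for u w
  proof -
    have "w * f \<in> bounded_class (D + 6)" by (rule bounded_class_mono[OF bounded_class_base_mult[OF f that(2)]]) simp
    then have "q6 * f + - (w * f) \<in> bounded_class (D + 6)" by (intro bounded_class_add qf bounded_class_uminus)
    from bounded_class_base_mult[OF this that(1)] have "u * (q6 * f + - (w * f)) \<in> bounded_class (D + 6 + 1)" .
    then have "u * (q6 * f + - (w * f)) \<in> bounded_class (D + 10)" by (rule bounded_class_mono) simp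
    then show ?thesis by simp
  qed
  have "i \<in> {0, 1, 2, 3, 4, 5}" unfolding UNIV_6[symmetric] by simp
  then consider "i = 0" | "i = 3" | "i \<in> {1, 2, 4, 5}" by auto
  then show ?thesis
  proof cases
    case 1
    have "denom6 ^ 1 * Var 0 * f = r * (q6 * f - (Var 1 * Var 2) * f)"
      by (simp add: r_def algebra_simps)
    then show ?thesis using step[OF pr(2) two(1)] 1 by (simp only:)
  next
    case 2
    have "denom6 ^ 1 * Var 3 * f - p * (q6 * f - (Var 4 * Var 5) * f) = (- p * f) * Q6 + 0 * F6"
      by (simp add: p_def quadric_def algebra_simps)
    then have "denom6 ^ 1 * Var 3 * f - p * (q6 * f - (Var 4 * Var 5) * f) \<in> ideal_gen {Q6, F6}"
      by (rule ideal_gen_pairI)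
    from bounded_class_cong[OF step[OF pr(1) two(2)] this] show ?thesis using 2 by (simp only:)
  next
    case 3
    have "denom6 * Var i \<in> base_polys (2 + 1)" by (rule base_polys_mult[OF denom_base base_polys_Var[OF 3]])
    from bounded_class_base_mult[OF f this] have "denom6 * Var i * f \<in> bounded_class (D + (2 + 1))" .
    then show ?thesis unfolding power_one_right by (rule bounded_class_mono) simp
  qed
qed

text \<open>The number \<open>k\<close> of denominators to be cleared and the increase \<open>E\<close> of the degree bound do not depend on
  \<open>f\<close>. Therefore they add up in products, and the bounds for monomials in five fixed polynomials grow linearly
  with the degree.\<close>

definition controlled :: "nat \<Rightarrow> nat \<Rightarrow> 6 mpol \<Rightarrow> bool" where
  "controlled k E v \<longleftrightarrow> (\<forall>f D. f \<in> bounded_class D \<longrightarrow> denom6 ^ k * v * f \<in> bounded_class (D + E))"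

lemma controlledD: "controlled k E v \<Longrightarrow> f \<in> bounded_class D \<Longrightarrow> denom6 ^ k * v * f \<in> bounded_class (D + E)"
  by (simp add: controlled_def)

lemma controlled_pad:
  assumes "controlled k E v"
  shows "controlled (k + j) (E + 2 * j + l) v"
  unfolding controlled_def
proof (intro allI impI)
  fix f D assume "f \<in> bounded_class D"
  then have "denom6 ^ j * (denom6 ^ k * v * f) \<in> bounded_class (D + E + 2 * j)"
    by (intro bounded_class_denom controlledD[OF assms])
  also have "denom6 ^ j * (denom6 ^ k * v * f) = denom6 ^ (k + j) * v * f"
    by (simp only: power_add ac_simps)
  finally show "denom6 ^ (k + j) * v * f \<in> bounded_class (D + (E + 2 * j + l))"
    by (rule bounded_class_mono) simp
qed

lemma controlled_mult:
  assumes "controlled k E v" "controlled j G w"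
  shows "controlled (k + j) (E + G) (v * w)"
  unfolding controlled_def
proof (intro allI impI)
  fix f D assume "f \<in> bounded_class D"
  then have "denom6 ^ k * v * (denom6 ^ j * w * f) \<in> bounded_class (D + G + E)"
    by (intro controlledD[OF assms(1)] controlledD[OF assms(2)])
  also have "denom6 ^ k * v * (denom6 ^ j * w * f) = denom6 ^ (k + j) * (v * w) * f"
    by (simp only: power_add ac_simps)
  finally show "denom6 ^ (k + j) * (v * w) * f \<in> bounded_class (D + (E + G))" by (simp add: ac_simps)
qed

lemma controlled_add:
  assumes "controlled k E v" "controlled k E w"
  shows "controlled k E (v + w)"
  unfolding controlled_def
proof (intro allI impI)
  fix f D assume "f \<in> bounded_class D"
  then have "denom6 ^ k * v * f + denom6 ^ k * w * f \<in> bounded_class (D + E)"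
    by (intro bounded_class_add controlledD[OF assms(1)] controlledD[OF assms(2)])
  then show "denom6 ^ k * (v + w) * f \<in> bounded_class (D + E)" by (simp only: distrib_left distrib_right)
qed

lemma controlled_one: "controlled 0 0 1"
  by (simp add: controlled_def)

lemma controlled_exists: "\<exists>k E. controlled k E v"
proof (induction v rule: mpol_induct)
  case (Const c)
  have "controlled 0 0 (Const c)"
    using bounded_class_base_mult[OF _ base_polys_Const[of c]] by (fastforce simp: controlled_def)
  then show ?case by blast
next
  case (Var i)
  have "controlled 1 10 (Var i)" unfolding controlled_def using bounded_class_Var by blast
  then show ?case by blast
next
  case (add v w)
  then obtain k E j G where kE: "controlled k E v" and jG: "controlled j G w" by blast
  have "controlled (k + j) (E + 2 * j + (G + 2 * k)) v" by (rule controlled_pad[OF kE])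
  moreover have "controlled (j + k) (G + 2 * k + (E + 2 * j)) w" by (rule controlled_pad[OF jG])
  ultimately show ?case using controlled_add by (metis add.commute)
next
  case (mult v w)
  then show ?case using controlled_mult by blast
qed

lemma controlled_uniform:
  assumes "finite A"
  shows "\<exists>k E. \<forall>v\<in>A. controlled k E v"
  using assms
proof induction
  case (insert w A)
  then obtain k E where kE: "\<forall>v\<in>A. controlled k E v" by blast
  obtain j G where jG: "controlled j G w" using controlled_exists by blast
  have "controlled (k + j) (E + 2 * j + (G + 2 * k)) v" if "v \<in> A" for v
    using kE that controlled_pad by blast
  moreover have "controlled (k + j) (E + 2 * j + (G + 2 * k)) w"
    using controlled_pad[OF jG, of k "E + 2 * j"] by (simp add: ac_simps)
  ultimately show ?case by blast
qed simp

lemma controlled_power: "controlled k E v \<Longrightarrow> controlled (k * n) (E * n) (v ^ n)"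
proof (induction n)
  case (Suc n)
  then show ?case using controlled_mult[OF Suc.prems Suc.IH] by simp
qed (simp add: controlled_one)

text \<open>The same power of the denominator is used for all products of bounded degree, so that
  linear combinations of the products can be formed.\<close>

lemma controlled_prod:
  assumes "finite A" "\<forall>v\<in>A. controlled k E v" "\<forall>v\<in>A. g v \<le> N"
  shows "controlled (k * (N * card A)) ((E + 2 * k) * (N * card A)) (\<Prod>v\<in>A. v ^ g v)"
proof -
  have "controlled (k * (\<Sum>v\<in>A. g v)) (E * (\<Sum>v\<in>A. g v)) (\<Prod>v\<in>A. v ^ g v)"
    using assms(1,2)
  proof (induction A)
    case (insert v A)
    have "controlled (k * g v + k * (\<Sum>v\<in>A. g v)) (E * g v + E * (\<Sum>v\<in>A. g v)) (v ^ g v * (\<Prod>v\<in>A. v ^ g v))"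
      using insert by (intro controlled_mult controlled_power) simp_all
    then show ?case using insert.hyps by (simp add: distrib_left)
  qed (simp add: controlled_one)
  moreover have "(\<Sum>v\<in>A. g v) \<le> N * card A"
    using sum_bounded_above[of A g N] assms(3) by (simp add: mult.commute)
  then obtain d where d: "N * card A = (\<Sum>v\<in>A. g v) + d" using le_Suc_ex by blast
  ultimately have "controlled (k * (\<Sum>v\<in>A. g v) + k * d)
     (E * (\<Sum>v\<in>A. g v) + 2 * (k * d) + (E * d + 2 * k * (\<Sum>v\<in>A. g v))) (\<Prod>v\<in>A. v ^ g v)"
    by (intro controlled_pad)
  then show ?thesis unfolding d by (simp add: algebra_simps)
qed

lemma one_bounded_class: "1 \<in> bounded_class 0"
  by (rule bounded_classI[of 1 _ 0 0]) (simp_all add: base_polys_consts is_idealD(1)[OF ideal_gen_ideal])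

text \<open>There are \<open>(N + 1)\<^sup>5\<close> monomials with exponents at most \<open>N\<close> in five polynomials, in a space of
  dimension \<open>O(N\<^sup>4)\<close>.\<close>

lemma counting_inequality:
  "3 * ((5 * (E * (N::nat)) + 1) ^ 4) < (N + 1) ^ 5" if "N = 3 * (5 * E + 1) ^ 4"
proof -
  have "5 * (E * N) + 1 \<le> (5 * E + 1) * (N + 1)" by (simp add: algebra_simps)
  then have "(5 * (E * N) + 1) ^ 4 \<le> ((5 * E + 1) * (N + 1)) ^ 4" by (rule power_mono) simp
  then have "3 * (5 * (E * N) + 1) ^ 4 \<le> 3 * ((5 * E + 1) ^ 4 * (N + 1) ^ 4)" by (simp only: power_mult_distrib)
  also have "\<dots> = N * (N + 1) ^ 4" by (simp only: that mult.assoc)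
  finally have "3 * (5 * (E * N) + 1) ^ 4 \<le> N * (N + 1) ^ 4" .
  also have "\<dots> < (N + 1) * (N + 1) ^ 4" by simp
  finally show ?thesis by (simp add: eval_nat_numeral)
qed

text \<open>The products with exponents at most \<open>N\<close> of five polynomials outnumber the coefficients
  that describe them modulo the ideal. Hence some linear combination of them vanishes modulo the ideal up to a denominator,
  which can be cancelled.\<close>

lemma five_dependent:
  assumes A: "finite A" "card A = 5"
  shows "\<not> alg_indep_mod (ideal_gen {Q6, F6}) A"
proof
  assume indep: "alg_indep_mod (ideal_gen {Q6, F6}) A"
  note I = ideal_gen_ideal[of "{Q6, F6}"]
  obtain k E0 where kE: "\<forall>v\<in>A. controlled k E0 v" using controlled_uniform[OF A(1)] by blast
  define E where "E = E0 + 2 * k"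
  define N where "N = 3 * (5 * E + 1) ^ 4"
  define D where "D = 5 * (E * N)"
  define h where "h = denom6 ^ (k * (N * 5))"
  define X where "X = (A \<rightarrow>\<^sub>E {..N})"
  define mon where "mon g = (\<Prod>v\<in>A. v ^ g v)" for g :: "6 mpol \<Rightarrow> nat"
  have X: "finite X" "card X = (N + 1) ^ 5"
  proof -
    show "finite X" unfolding X_def using A(1) by (intro finite_PiE) simp_all
    have "card X = (\<Prod>v\<in>A. card {..N})" unfolding X_def by (rule card_PiE[OF A(1)])
    also have "\<dots> = (N + 1) ^ card A" by (simp only: prod_constant card_atMost Suc_eq_plus1)
    finally show "card X = (N + 1) ^ 5" by (simp only: A(2))
  qed
  have "h * mon g \<in> bounded_class D" if "g \<in> X" for g
  proof -
    have "\<forall>v\<in>A. g v \<le> N" using that by (auto simp: X_def)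
    from controlledD[OF controlled_prod[OF A(1) kE this] one_bounded_class] show ?thesis
      by (simp add: h_def mon_def A(2) D_def E_def ac_simps)
  qed
  then have "\<forall>g\<in>X. \<exists>c. c 0 \<in> base_polys D \<and> c 1 \<in> base_polys D \<and> c 2 \<in> base_polys D \<and>
      h * mon g - (c 0 + c 1 * q6 + c (2::nat) * (q6 * q6)) \<in> ideal_gen {Q6, F6}"
  proof (intro ballI)
    fix g assume "g \<in> X" and red: "\<And>g. g \<in> X \<Longrightarrow> h * mon g \<in> bounded_class D"
    then obtain c0 c1 c2 where "c0 \<in> base_polys D" "c1 \<in> base_polys D" "c2 \<in> base_polys D"
      "h * mon g - (c0 + c1 * q6 + c2 * (q6 * q6)) \<in> ideal_gen {Q6, F6}"
      unfolding bounded_class_def by blast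
    then show "\<exists>c. c 0 \<in> base_polys D \<and> c 1 \<in> base_polys D \<and> c 2 \<in> base_polys D \<and>
      h * mon g - (c 0 + c 1 * q6 + c (2::nat) * (q6 * q6)) \<in> ideal_gen {Q6, F6}"
      by (intro exI[of _ "\<lambda>n. if n = 0 then c0 else if n = 1 then c1 else c2"]) simp
  qed
  from bchoice[OF this] obtain c where c: "\<And>g. g \<in> X \<Longrightarrow> c g 0 \<in> base_polys D"
      "\<And>g. g \<in> X \<Longrightarrow> c g 1 \<in> base_polys D" "\<And>g. g \<in> X \<Longrightarrow> c g 2 \<in> base_polys D"
    and cI: "\<And>g. g \<in> X \<Longrightarrow> h * mon g - (c g 0 + c g 1 * q6 + c g (2::nat) * (q6 * q6)) \<in> ideal_gen {Q6, F6}"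
    by blast
  define J where "J = {0, 1, 2 :: nat} \<times> base_monomials D"
  have J: "finite J" "card J \<le> 3 * (D + 1) ^ 4"
    using card_base_monomials[of D] by (simp_all add: J_def card_cartesian_product)
  have "card J < card X"
    using J(2) counting_inequality[OF N_def] unfolding X(2) D_def by linarith
  \<comment> \<open>The coefficient vectors of the products outnumber their entries, so they are linearly dependent.\<close>
  from homogeneous_system_solution[OF J(1) X(1) this, of "\<lambda>g j. lookup (c g (fst j)) (snd j)"]
  obtain l where l: "\<exists>g\<in>X. l g \<noteq> 0" "\<forall>j\<in>J. (\<Sum>g\<in>X. l g * lookup (c g (fst j)) (snd j)) = 0" by blast
  have zero: "(\<Sum>g\<in>X. Const (l g) * c g n) = 0" if n: "n \<in> {0, 1, 2}" for n
  proof (rule poly_mapping_eqI)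
    fix m
    have Cl: "lookup (Const z * p) m = z * lookup p m" for z and p :: "6 mpol"
    proof -
      have "Const z * p = Poly_Mapping.map ((*) z) p" unfolding Const_def by (rule mult_map_scale_conv_mult[symmetric])
      then show ?thesis by (simp add: map.rep_eq when_def)
    qed
    have "(\<Sum>g\<in>X. l g * lookup (c g n) m) = 0"
    proof (cases "m \<in> base_monomials D")
      case True
      then show ?thesis using l(2) n by (auto simp: J_def)
    next
      case False
      have "lookup (c g n) m = 0" if "g \<in> X" for g
        using False c[OF that] n by (auto simp: base_polys_def base_monomials_def in_keys_iff)
      then show ?thesis by simp
    qed
    then show "lookup (\<Sum>g\<in>X. Const (l g) * c g n) m = lookup 0 m" by (simp add: lookup_sum Cl)
  qed
  define r where "r g = c g 0 + c g 1 * q6 + c g 2 * (q6 * q6)" for g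
  have "(\<Sum>g\<in>X. Const (l g) * r g) = (\<Sum>g\<in>X. Const (l g) * c g 0) + (\<Sum>g\<in>X. Const (l g) * c g 1) * q6
      + (\<Sum>g\<in>X. Const (l g) * c g 2) * (q6 * q6)"
    by (simp only: r_def distrib_left sum.distrib sum_distrib_right mult.assoc)
  also have "\<dots> = 0" by (simp only: zero insert_iff simp_thms mult_zero_left add_0)
  finally have r0: "(\<Sum>g\<in>X. Const (l g) * r g) = 0" .
  have "(\<Sum>g\<in>X. Const (l g) * (h * mon g - r g)) \<in> ideal_gen {Q6, F6}"
    by (intro is_ideal_sum[OF I] is_idealD(3)[OF I]) (use cI in \<open>simp only: r_def\<close>)
  also have "(\<Sum>g\<in>X. Const (l g) * (h * mon g - r g)) = h * (\<Sum>g\<in>X. Const (l g) * mon g) - (\<Sum>g\<in>X. Const (l g) * r g)"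
    by (simp add: right_diff_distrib sum_subtractf sum_distrib_left mult.left_commute)
  finally have "h * (\<Sum>g\<in>X. Const (l g) * mon g) \<in> ideal_gen {Q6, F6}" by (simp add: r0)
  then have mem: "(\<Sum>g\<in>X. Const (l g) * mon g) \<in> ideal_gen {Q6, F6}"
    unfolding h_def by (rule denominator_regular)
  define e where "e g = (\<Sum>v\<in>A. single v (g v))" for g :: "6 mpol \<Rightarrow> nat"
  have e_lookup: "lookup (e g) v = (if v \<in> A then g v else 0)" for g v
    using A(1) by (simp add: e_def lookup_sum lookup_single when_def)
  have e_inj: "g = g'" if "g \<in> X" "g' \<in> X" "e g = e g'" for g g'
  proof (rule PiE_ext[of g A "\<lambda>_. {..N}" g'])
    show "g v = g' v" if "v \<in> A" for v
      using e_lookup[of g v] e_lookup[of g' v] \<open>e g = e g'\<close> that by simp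
  qed (use that in \<open>simp_all add: X_def\<close>)
  \<comment> \<open>The same combination of monomials is an algebraic relation among the elements of \<open>A\<close>.\<close>
  define P where "P = (\<Sum>g\<in>X. single (e g) (l g))"
  have "poly_subst id (single (e g) z) = Const z * mon g" for g z
  proof -
    have "poly_subst id (single (e g) z) = Const z * monom_val id (e g)"
      by (simp add: poly_subst_def insertion_single[OF Const_hom])
    also have "monom_val id (e g) = (\<Prod>v\<in>A. id v ^ lookup (e g) v)"
      by (rule monom_val_superset[OF A(1)]) (auto simp: in_keys_iff e_lookup split: if_splits)
    also have "\<dots> = mon g" unfolding mon_def by (rule prod.cong) (simp_all add: e_lookup)
    finally show ?thesis .
  qed
  then have "poly_subst id P \<in> ideal_gen {Q6, F6}"
    using mem by (simp add: P_def hom_sum[OF poly_subst_hom])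
  moreover have "\<forall>m\<in>keys P. keys m \<subseteq> A"
  proof
    fix m assume "m \<in> keys P"
    then obtain g where "m \<in> keys (single (e g) (l g))"
      using keys_sum[of "\<lambda>g. single (e g) (l g)" X] unfolding P_def by blast
    then have "m = e g" by (auto split: if_splits)
    then show "keys m \<subseteq> A" by (auto simp: in_keys_iff e_lookup split: if_splits)
  qed
  ultimately have "P = 0" using indep unfolding alg_indep_mod_def by blast
  obtain g where g: "g \<in> X" "l g \<noteq> 0" using l(1) by blast
  have "lookup P (e g) = (\<Sum>g'\<in>X. if g' = g then l g' else 0)"
    unfolding P_def lookup_sum
    by (rule sum.cong) (use e_inj g(1) in \<open>auto simp: lookup_single when_def\<close>)
  also have "\<dots> = l g" using g(1) X(1) by simp
  finally show False using \<open>P = 0\<close> g(2) by simp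
qed

lemma alg_indep_mod_subset: "alg_indep_mod I A \<Longrightarrow> B \<subseteq> A \<Longrightarrow> alg_indep_mod I B"
  unfolding alg_indep_mod_def by (meson subset_trans)

theorem threefold_dimension: "proj_dim (ideal_gen {Q6, F6}) = 3"
proof -
  have "trdeg_mod (ideal_gen {Q6, F6}) = 4"
    unfolding trdeg_mod_def
  proof (rule Greatest_equality)
    show "\<exists>A. finite A \<and> card A = 4 \<and> alg_indep_mod (ideal_gen {Q6, F6}) A"
      using four_independent card_four_variables by (intro exI[of _ "{Var 1, Var 2, Var 4, Var 5}"]) simp
    fix n assume "\<exists>A. finite A \<and> card A = n \<and> alg_indep_mod (ideal_gen {Q6, F6}) A"
    then obtain A where A: "finite A" "card A = n" "alg_indep_mod (ideal_gen {Q6, F6}) A" by blast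
    show "n \<le> 4"
    proof (rule ccontr)
      assume "\<not> n \<le> 4"
      then have "5 \<le> card A" using A by simp
      then obtain B where B: "B \<subseteq> A" "card B = 5" by (meson obtain_subset_with_card_n)
      with A alg_indep_mod_subset five_dependent finite_subset show False by metis
    qed
  qed
  then show ?thesis by (simp add: proj_dim_def)
qed

section \<open>Seven ordinary triple points\<close>

lemma homogeneous_quadric: "homogeneous 2 Q6"
  unfolding quadric_def by (blast intro: homogeneous_intros)

lemma homogeneous_quartic: "homogeneous 4 F6"
  unfolding quartic_def Let_def by (blast intro: homogeneous_intros)

lemma quadric_quartic_nonzero: "Q6 \<noteq> 0" "F6 \<noteq> 0"
proof -
  have "poly_eval Q6 (\<chi> i. if i = 0 \<or> i = 1 then 1 else 0) = 1"
    unfolding poly_eval_Q6 by (simp add: quadric_def)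
  then show "Q6 \<noteq> 0" by (auto simp: hom_simps[OF poly_eval_hom])
  have "poly_eval F6 (\<chi> i. if i = 2 \<or> i = 5 then 0 else 1) = - 4"
    unfolding poly_eval_F6 by (simp add: quartic_def)
  then show "F6 \<noteq> 0" by (auto simp: hom_simps[OF poly_eval_hom])
qed

text \<open>Isolatedness is a matter of separating finitely many points: a product of two linear forms is
  nonzero at exactly one of them.\<close>

lemma separating_form:
  "\<exists>h :: 6 mpol. homogeneous 2 h \<and>
     (\<forall>c k'. c \<noteq> 0 \<longrightarrow> (poly_eval h (c *s triple_point k') \<noteq> 0 \<longleftrightarrow> k' = k))"
proof (cases k)
  case None
  have "homogeneous 2 (Var 0 * Var (1::6))" by (blast intro: homogeneous_intros)
  moreover have "poly_eval (Var 0 * Var 1) (c *s triple_point k') \<noteq> 0 \<longleftrightarrow> k' = None" if "c \<noteq> 0" for c k'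
    using that by (cases k') (auto simp: poly_eval_simps triple_point_def axis_def)
  ultimately show ?thesis using None by blast
next
  case (Some i)
  define j :: 6 where "j = (if i = 0 then 1 else 0)"
  have ij: "i \<noteq> j" by (simp add: j_def)
  have "homogeneous 2 (Var i * (Var i - Var j))" by (blast intro: homogeneous_intros)
  moreover have "poly_eval (Var i * (Var i - Var j)) (c *s triple_point k') \<noteq> 0 \<longleftrightarrow> k' = Some i" if "c \<noteq> 0" for c k'
    using that ij by (cases k') (auto simp: poly_eval_simps triple_point_def axis_def)
  ultimately show ?thesis using Some by blast
qed

lemma ordinary_triple_points:
  assumes dim: "proj_dim (ideal_gen {Q6, F6}) = 3" and p: "singular_at (ideal_gen {Q6, F6}) p"
  shows "ordinary_triple_point (ideal_gen {Q6, F6}) p"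
proof -
  note sing = singular_at_threefold_iff[OF dim]
  obtain c k where c: "c \<noteq> 0" and pk: "p = c *s triple_point k" using p unfolding sing by blast
  obtain h where h: "homogeneous 2 h"
    "\<And>c k'. c \<noteq> 0 \<Longrightarrow> poly_eval h (c *s triple_point k') \<noteq> 0 \<longleftrightarrow> k' = k"
    using separating_form[of k] by blast
  have "vec.span {q} = vec.span {p}" if q: "singular_at (ideal_gen {Q6, F6}) q" "poly_eval h q \<noteq> 0" for q
  proof -
    obtain d k' where d: "d \<noteq> 0" "q = d *s triple_point k'" using q(1) unfolding sing by blast
    with h(2) q(2) have "k' = k" by blast
    then show ?thesis unfolding pk d(2) by (simp only: span_scaled[OF c] span_scaled[OF d(1)])
  qed
  moreover have "poly_eval h p \<noteq> 0" unfolding pk using h(2)[OF c] by blast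
  ultimately have "isolated_singularity (ideal_gen {Q6, F6}) p"
    unfolding isolated_singularity_def using p h(1) by blast
  moreover have "has_cubic_tangent_cone (ideal_gen {Q6, F6}) p"
    unfolding pk by (rule triple_point_tangent_cone[OF c])
  ultimately show ?thesis unfolding ordinary_triple_point_def has_cubic_tangent_cone_def by blast
qed

lemma card_singular_points:
  assumes "proj_dim (ideal_gen {Q6, F6}) = 3"
  shows "card (singular_points (ideal_gen {Q6, F6})) = 7"
proof -
  have "singular_points (ideal_gen {Q6, F6}) = range (\<lambda>k. vec.span {triple_point k})"
  proof (intro antisym subsetI)
    fix S assume "S \<in> singular_points (ideal_gen {Q6, F6})"
    then obtain c k where "c \<noteq> 0" "S = vec.span {c *s triple_point k}"
      unfolding singular_points_def singular_at_threefold_iff[OF assms] by blast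
    then show "S \<in> range (\<lambda>k. vec.span {triple_point k})" by (simp add: span_scaled)
  next
    fix S assume "S \<in> range (\<lambda>k. vec.span {triple_point k})"
    then obtain k where "S = vec.span {triple_point k}" by blast
    moreover have "triple_point k = 1 *s triple_point k" by simp
    ultimately show "S \<in> singular_points (ideal_gen {Q6, F6})"
      unfolding singular_points_def singular_at_threefold_iff[OF assms] by (metis (mono_tags, lifting) mem_Collect_eq zero_neq_one)
  qed
  moreover have "inj (\<lambda>k. vec.span {triple_point k})"
    by (rule injI) (simp add: span_triple_point_eq_iff)
  ultimately have "card (singular_points (ideal_gen {Q6, F6})) = CARD(6 option)"
    by (simp add: card_image)
  then show ?thesis by simp
qed

theorem lemma2p2:
  "\<exists>(I :: 6 mpol set) Q F.
     hypersurface_form 2 Q \<and> hypersurface_form 4 F \<and>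
     is_prime_ideal I \<and> complete_intersection2 I Q F \<and> proj_dim I = 3 \<and>
     card (singular_points I) = 7 \<and>
     (\<forall>p. singular_at I p \<longrightarrow> ordinary_triple_point I p)"
proof (intro exI conjI allI impI)
  show "hypersurface_form 2 Q6" "hypersurface_form 4 F6"
    using homogeneous_quadric homogeneous_quartic quadric_quartic_nonzero by (simp_all add: hypersurface_form_def)
  show "is_prime_ideal (ideal_gen {Q6, F6})" by (rule prime_threefold_ideal)
  show dim: "proj_dim (ideal_gen {Q6, F6}) = 3" by (rule threefold_dimension)
  then show "complete_intersection2 (ideal_gen {Q6, F6}) Q6 F6" by (simp add: complete_intersection2_def)
  show "card (singular_points (ideal_gen {Q6, F6})) = 7" by (rule card_singular_points[OF dim])
  show "ordinary_triple_point (ideal_gen {Q6, F6}) p" if "singular_at (ideal_gen {Q6, F6}) p" for p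
    by (rule ordinary_triple_points[OF dim that])
qed

end
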